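(* Let $0<r<1/2$, $s=\frac{r}{2-4r}$ and $P_0>0$. There is $c_0=c_0(P_0)>0$ such that, if $h_n\asymp n^{4r-2}=n^{-\frac{2}{1+4s}}$ and $h_n<c_0n^{4r-2}$, then the ball $U=\mathbb B^s_{2\infty}(P_0)$ in the Besov space $\mathbb B^s_{2\infty}$ is a maxiset for the kernel-based test statistics $T_n(Y_n)$ with bandwidth $h_n$; that is: (i) with $V_n=\{g\in U:\|g\|\ge cn^{-r}\}$ ($c>0$ a fixed constant), there is a sequence of tests $K_n$ generated by $T_n$, with $\alpha(K_n)=\alpha(1+o(1))$, $0<\alpha<1$, such that $\limsup_{n\to\infty}(\alpha(K_n)+\beta(K_n,V_n))<1$; (ii) for every $f\in\mathbb L_2^{per}(\mathbb R^1)$, $f\notin\mathbb B^s_{2\infty}$, there are sequences of positive integers $i_n\to\infty$ and $m_n$ and constants $0<c_1<C_1$ with $c_1m_n^{-r}<\|\tilde f_{i_n}\|<C_1m_n^{-r}$ such that any sequence of tests $K_{m_n}$ generated by $T_{m_n}$ with $\alpha(K_{m_n})=\alpha(1+o(1))$, $0<\alpha<1$, satisfies $\liminf_{n\to\infty}(\alpha(K_{m_n})+\beta(K_{m_n},\tilde f_{i_n}))\ge1$.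
   Context: Model: one observes $dY_n(t)=f(t)dt+\frac{\sigma}{\sqrt n}dw(t)$, $t\in[0,1]$, $\sigma>0$, $dw$ Gaussian white noise, where the unknown signal $f$ belongs to $\mathbb L_2^{per}(\mathbb R^1)$, the set of 1-periodic functions whose restriction to $[0,1)$ is in $\mathbb L_2(0,1)$; $\|\cdot\|$ is the $\mathbb L_2(0,1)$ norm. Signal and noise are extended 1-periodically to the real line. The hypothesis is $H_0:f=0$. $\alpha(K_n)$, $\beta(K_n,f)$ are the type I error probability and the type II error probability at $f$ of a test $K_n$; $\beta(K_n,V)=\sup_{f\in V}\beta(K_n,f)$. A test is generated by $T_n$ if it rejects $H_0$ when $T_n$ exceeds a threshold. $a_n\asymp b_n$ means $ca_n\le b_n\le Ca_n$ for all $n$ with constants $0<c\le C$. Kernel-based statistics: $\hat f_{h_n}(t)=\frac1{h_n}\int_{-\infty}^\infty K\bigl(\frac{t-u}{h_n}\bigr)dY_n(u)$, $t\in(0,1)$ (with the periodic extension of $Y_n$), where $h_n>0$, $h_n\to0$ as $n\to\infty$, and $K$ is a bounded function supported in $[-1,1]$ with $K(t)=K(-t)$ and $\int K=1$. Then $T_n(Y_n)=nh_n^{1/2}\sigma^{-2}\kappa^{-1}\bigl(\|\hat f_{h_n}\|^2-\sigma^2(nh_n)^{-1}\|K\|^2\bigr)$, with $\kappa^2=2\int\bigl(\int K(t-s)K(s)ds\bigr)^2dt$ and $\|K\|^2=\int K^2$. Balls: with $\phi_j(t)=\exp\{2\pi ijt\}$, $j=0,\pm1,\dots$, $\mathbb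 B^s_{2\infty}(P_0)=\{f=\sum_{j\in\mathbb Z}\theta_j\phi_j:\ \sup_{\lambda>0}\lambda^{2s}\sum_{|j|>\lambda}|\theta_j|^2\le P_0\}$ and $\mathbb B^s_{2\infty}=\bigcup_{P_0>0}\mathbb B^s_{2\infty}(P_0)$. For $f=\sum_{j\in\mathbb Z}\theta_j\phi_j$ put $\tilde f_i=\sum_{|j|>i}\theta_j\phi_j$ (the remainder of $f$ after projection on $\mathrm{span}\{\phi_j:|j|\le i\}$). *)

theory Defs
  imports "HOL-Probability.Probability" "HOL-Library.Landau_Symbols"
begin

(* Elements of L2 are represented by Borel functions on the real line, not by
   equivalence classes; only the values on [0,1) enter the inner product. *)

definition L2_unit :: "(real \<Rightarrow> real) set" where
  "L2_unit = {\<phi>. \<phi> \<in> borel_measurable borel \<and> set_integrable lborel {0..<1} (\<lambda>t. (\<phi> t)\<^sup>2)}"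

definition L2_per :: "(real \<Rightarrow> real) set" where
  "L2_per = {f \<in> L2_unit. \<forall>t. f (t + 1) = f t}"

definition L2_inner :: "(real \<Rightarrow> real) \<Rightarrow> (real \<Rightarrow> real) \<Rightarrow> real" where
  "L2_inner f g = (LINT t:{0..<1}|lborel. f t * g t)"

definition L2_nrm :: "(real \<Rightarrow> real) \<Rightarrow> real" where
  "L2_nrm f = sqrt (L2_inner f f)"


definition trig :: "int \<Rightarrow> real \<Rightarrow> complex" where
  "trig j t = exp (2 * of_real pi * \<i> * of_int j * of_real t)"

definition fourier_coeff :: "(real \<Rightarrow> real) \<Rightarrow> int \<Rightarrow> complex" where
  "fourier_coeff f j = (LINT t:{0..<1}|lborel. of_real (f t) * cnj (trig j t))"

definition besov_ball :: "real \<Rightarrow> real \<Rightarrow> (real \<Rightarrow> real) set" where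
  "besov_ball s P = {f \<in> L2_per. \<forall>x>0.
     x powr (2 * s) * (\<Sum>\<^sub>\<infinity>j\<in>{j. real_of_int \<bar>j\<bar> > x}. (cmod (fourier_coeff f j))\<^sup>2) \<le> P}"

definition besov_space :: "real \<Rightarrow> (real \<Rightarrow> real) set" where
  "besov_space s = (\<Union>P\<in>{0<..}. besov_ball s P)"

(* The partial Fourier sum of a real function over |j| <= i is real, so taking
   real parts loses nothing. *)
definition fourier_tail :: "nat \<Rightarrow> (real \<Rightarrow> real) \<Rightarrow> real \<Rightarrow> real" where
  "fourier_tail i f t = f t - Re (\<Sum>j\<in>{- int i..int i}. fourier_coeff f j * trig j t)"


(* Gaussian white noise dw on [0,1) with intensity 1, as an isonormal process:
   W \<phi> stands for the stochastic integral of \<phi> against dw. By linearity all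
   finite-dimensional distributions are Gaussian, and the covariance of W \<phi> and
   W \<psi> is L2_inner \<phi> \<psi> by polarization. *)
definition white_noise :: "'w measure \<Rightarrow> ((real \<Rightarrow> real) \<Rightarrow> 'w \<Rightarrow> real) \<Rightarrow> bool" where
  "white_noise M W \<longleftrightarrow> prob_space M \<and>
     (\<forall>\<phi>\<in>L2_unit. W \<phi> \<in> borel_measurable M) \<and>
     (\<forall>\<phi>\<in>L2_unit. L2_nrm \<phi> > 0 \<longrightarrow> distributed M lborel (W \<phi>) (normal_density 0 (L2_nrm \<phi>))) \<and>
     (\<forall>\<phi>\<in>L2_unit. L2_nrm \<phi> = 0 \<longrightarrow> (AE \<omega> in M. W \<phi> \<omega> = 0)) \<and>
     (\<forall>\<phi>\<in>L2_unit. \<forall>\<psi>\<in>L2_unit. \<forall>a b.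
        AE \<omega> in M. W (\<lambda>t. a * \<phi> t + b * \<psi> t) \<omega> = a * W \<phi> \<omega> + b * W \<psi> \<omega>)"

(* The stochastic integral of \<phi> against dY_n = f dt + (\<sigma> / sqrt n) dw over [0,1). *)
definition observation ::
  "((real \<Rightarrow> real) \<Rightarrow> 'w \<Rightarrow> real) \<Rightarrow> real \<Rightarrow> nat \<Rightarrow> (real \<Rightarrow> real) \<Rightarrow> (real \<Rightarrow> real) \<Rightarrow> 'w \<Rightarrow> real" where
  "observation W \<sigma> n f \<phi> \<omega> = L2_inner f \<phi> + \<sigma> / sqrt (real n) * W \<phi> \<omega>"

(* The integral of a compactly supported g over the whole line against the
   1-periodic extension of Y is the integral of this function over [0,1). *)
definition periodize :: "(real \<Rightarrow> real) \<Rightarrow> real \<Rightarrow> real" where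
  "periodize g u = (\<Sum>\<^sub>\<infinity>k::int. g (u + of_int k))"

(* Stochastic integrals are determined only almost surely, separately for every t.
   To form the L2-norm of the estimator in t one needs a jointly measurable
   version of it; any two such versions have almost surely equal L2-norms. *)
definition kernel_estimator ::
  "'w measure \<Rightarrow> ((real \<Rightarrow> real) \<Rightarrow> 'w \<Rightarrow> real) \<Rightarrow> (real \<Rightarrow> real) \<Rightarrow> real \<Rightarrow> (real \<Rightarrow> 'w \<Rightarrow> real) \<Rightarrow> bool" where
  "kernel_estimator M Y K h F \<longleftrightarrow>
     (\<lambda>(t, \<omega>). F t \<omega>) \<in> borel_measurable (borel \<Otimes>\<^sub>M M) \<and>
     (\<forall>t\<in>{0<..<1}. AE \<omega> in M. F t \<omega> = 1 / h * Y (periodize (\<lambda>u. K ((t - u) / h))) \<omega>)"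

definition smoothing_kernel :: "(real \<Rightarrow> real) \<Rightarrow> bool" where
  "smoothing_kernel K \<longleftrightarrow> K \<in> borel_measurable borel \<and> bounded (range K) \<and> (\<forall>t. t \<notin> {-1..1} \<longrightarrow> K t = 0) \<and>
     (\<forall>t. K t = K (- t)) \<and> (LINT t|lborel. K t) = 1"

definition kernel_kappa :: "(real \<Rightarrow> real) \<Rightarrow> real" where
  "kernel_kappa K = sqrt (2 * (LINT t|lborel. (LINT s|lborel. K (t - s) * K s)\<^sup>2))"

(* As a function of the path of the kernel estimator. *)
definition kernel_stat :: "real \<Rightarrow> (real \<Rightarrow> real) \<Rightarrow> nat \<Rightarrow> real \<Rightarrow> (real \<Rightarrow> real) \<Rightarrow> real" where
  "kernel_stat \<sigma> K n h x =
     real n * sqrt h / (\<sigma>\<^sup>2 * kernel_kappa K) *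
       ((L2_nrm x)\<^sup>2 - \<sigma>\<^sup>2 / (real n * h) * (LINT t|lborel. (K t)\<^sup>2))"


(* A test is a predicate on the data; True means rejection of the hypothesis. *)
definition generated_by :: "('d \<Rightarrow> real) \<Rightarrow> ('d \<Rightarrow> bool) \<Rightarrow> bool" where
  "generated_by T R \<longleftrightarrow> (\<exists>x. \<forall>y. R y \<longleftrightarrow> T y > x)"

definition reject_prob :: "'w measure \<Rightarrow> (real \<Rightarrow> 'w \<Rightarrow> real) \<Rightarrow> ((real \<Rightarrow> real) \<Rightarrow> bool) \<Rightarrow> real" where
  "reject_prob M F R = measure M {\<omega> \<in> space M. R (\<lambda>t. F t \<omega>)}"

definition accept_prob :: "'w measure \<Rightarrow> (real \<Rightarrow> 'w \<Rightarrow> real) \<Rightarrow> ((real \<Rightarrow> real) \<Rightarrow> bool) \<Rightarrow> real" where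
  "accept_prob M F R = measure M {\<omega> \<in> space M. \<not> R (\<lambda>t. F t \<omega>)}"

definition same_order :: "(nat \<Rightarrow> real) \<Rightarrow> (nat \<Rightarrow> real) \<Rightarrow> bool" where
  "same_order a b \<longleftrightarrow> (\<exists>c C. 0 < c \<and> c \<le> C \<and> (\<forall>n\<ge>1. c * a n \<le> b n \<and> b n \<le> C * a n))"

end

theory Submission
  imports Defs
begin

text \<open>
  The functions \<open>cas j t = cos (2 \<pi> j t) + sin (2 \<pi> j t)\<close>, \<open>j \<in> \<int>\<close>, form a real orthonormal basis of
  eigenfunctions of the periodized convolution with the kernel, with eigenvalues
  \<open>\<mu>\<^sub>j = \<integral> K(v) cos (2 \<pi> j h v) dv\<close>. Almost surely the estimator therefore has the coefficients
  \<open>\<mu>\<^sub>j (\<theta>\<^sub>j + \<tau> \<xi>\<^sub>j)\<close> with independent standard normal \<open>\<xi>\<^sub>j\<close> and \<open>\<tau> = \<sigma> / \<surd>n\<close>, and by Parseval's identity the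
  test statistic is an increasing affine function of \<open>\<Sum>\<^sub>j \<mu>\<^sub>j\<^sup>2 (\<theta>\<^sub>j + \<tau> \<xi>\<^sub>j)\<^sup>2\<close>. Under the hypothesis it is
  asymptotically normal after standardization. A signal shifts the standardized statistic by
  a drift of the order \<open>n h\<^sup>1\<^sup>/\<^sup>2 \<Sum>\<^sub>j \<mu>\<^sub>j\<^sup>2 \<theta>\<^sub>j\<^sup>2\<close>, up to a term negligible in comparison. For a signal in the
  Besov ball, the frequencies below \<open>const / h\<close>, where \<open>\<mu>\<^sub>j \<ge> 1/2\<close>, carry at least half of the energy
  and the drift stays away from 0. Outside the Besov space there are tails at
  frequencies much larger than \<open>1 / h\<close>, where \<open>\<mu>\<^sub>j\<close> is small by the Riemann-Lebesgue lemma, and the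
  drift tends to 0.
\<close>

subsection \<open>Square integrable functions on the unit interval\<close>

text \<open>The noise acts on real functions only, hence a real basis. It is given by
  one-dimensional Gaussian laws and almost sure linearity alone, so the independence of the
  \<open>\<xi> j\<close> is derived by Kac's criterion on characteristic functions. The estimator is
  prescribed almost surely for each fixed \<open>t\<close>, with an exceptional set that depends on
  \<open>t\<close>; its coefficients are therefore identified in mean square through Fubini's
  theorem and not path by path. No limit theorem is needed under an alternative: the statistics with
  and without signal are functionals of the same noise, their difference minus the drift is linear
  in that noise, and Chebyshev's inequality controls it uniformly over signals. The bandwidth rate
  is critical: the normalizing factor is of order \<open>sqrt h\<close>, that is
  \<open>n^(2r-1)\<close>, so a signal of energy \<open>n^(-2r)\<close> has a drift of order
  \<open>n^(2r-1) * n * n^(-2r) = 1\<close>. The bound by \<open>c\<^sub>0\<close> pushes the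
  frequency cutoff \<open>const / h\<close> so high that a signal of the ball keeps at most the
  energy \<open>c^2 n^(-2r) / 2\<close> above it.\<close>

definition unit_lebesgue :: "real measure" where
  "unit_lebesgue = restrict_space lborel {0..<1}"

lemma space_unit_lebesgue [simp]: "space unit_lebesgue = {0..<1}"
  by (simp add: unit_lebesgue_def space_restrict_space)

lemma measurable_unit_lebesgue:
  "f \<in> borel_measurable borel \<Longrightarrow> f \<in> borel_measurable unit_lebesgue"
  unfolding unit_lebesgue_def by (intro measurable_restrict_space1) simp

lemma measurable_ident_unit_lebesgue: "(\<lambda>t. t) \<in> borel_measurable unit_lebesgue"
  by (rule measurable_unit_lebesgue) simp

text \<open>Total mass 1 makes bounded measurable functions integrable and lets the time interval be
  paired with the noise space in Fubini's theorem.\<close>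

lemma prob_space_unit_lebesgue: "prob_space unit_lebesgue"
  by (intro prob_spaceI) (simp add: unit_lebesgue_def emeasure_restrict_space space_restrict_space)

interpretation unit: prob_space unit_lebesgue
  by (rule prob_space_unit_lebesgue)

lemma set_integral_unit: "(LINT t:{0..<1}|lborel. f t) = (LINT t|unit_lebesgue. f t)"
  for f :: "real \<Rightarrow> 'a :: {banach, second_countable_topology}"
  by (simp add: unit_lebesgue_def set_lebesgue_integral_def integral_restrict_space)

lemma set_integrable_unit: "set_integrable lborel {0..<1} f \<longleftrightarrow> integrable unit_lebesgue f"
  for f :: "real \<Rightarrow> 'a :: {banach, second_countable_topology}"
  by (simp add: unit_lebesgue_def set_integrable_def integrable_restrict_space)

lemma L2_unit_iff:
  "\<phi> \<in> L2_unit \<longleftrightarrow> \<phi> \<in> borel_measurable borel \<and> integrable unit_lebesgue (\<lambda>t. (\<phi> t)\<^sup>2)"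
  by (simp add: L2_unit_def set_integrable_unit)

lemma L2_unit_measurable [measurable_dest]: "\<phi> \<in> L2_unit \<Longrightarrow> \<phi> \<in> borel_measurable borel"
  by (simp add: L2_unit_iff)

lemma L2_unit_measurable_unit: "\<phi> \<in> L2_unit \<Longrightarrow> \<phi> \<in> borel_measurable unit_lebesgue"
  by (simp add: L2_unit_iff measurable_unit_lebesgue)

lemma L2_inner_eq: "L2_inner f g = (LINT t|unit_lebesgue. f t * g t)"
  by (simp add: L2_inner_def set_integral_unit)

lemma integrable_mult_of_squares:
  fixes f g :: "'a \<Rightarrow> real"
  assumes [measurable]: "f \<in> borel_measurable N" "g \<in> borel_measurable N"
    and "integrable N (\<lambda>x. (f x)\<^sup>2)" "integrable N (\<lambda>x. (g x)\<^sup>2)"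
  shows "integrable N (\<lambda>x. f x * g x)"
proof (rule Bochner_Integration.integrable_bound)
  show "integrable N (\<lambda>x. (f x)\<^sup>2 + (g x)\<^sup>2)" using assms by simp
  have "\<bar>x * y\<bar> \<le> x\<^sup>2 + y\<^sup>2" for x y :: real
    using sum_squares_bound[of "\<bar>x\<bar>" "\<bar>y\<bar>"] abs_ge_zero[of "x * y"]
    unfolding abs_mult power2_abs by linarith
  then show "AE x in N. norm (f x * g x) \<le> norm ((f x)\<^sup>2 + (g x)\<^sup>2)" by simp
qed simp

lemma integrable_mult_L2:
  "f \<in> L2_unit \<Longrightarrow> g \<in> L2_unit \<Longrightarrow> integrable unit_lebesgue (\<lambda>t. f t * g t)"
  by (rule integrable_mult_of_squares) (auto simp: L2_unit_iff measurable_unit_lebesgue)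

lemma L2_unit_lincomb:
  assumes "f \<in> L2_unit" "g \<in> L2_unit"
  shows "(\<lambda>t. a * f t + b * g t) \<in> L2_unit"
proof -
  have "integrable unit_lebesgue (\<lambda>t. a\<^sup>2 * (f t)\<^sup>2 + 2 * a * b * (f t * g t) + b\<^sup>2 * (g t)\<^sup>2)"
    using assms integrable_mult_L2[OF assms] by (simp add: L2_unit_iff)
  moreover have "(\<lambda>t. (a * f t + b * g t)\<^sup>2) = (\<lambda>t. a\<^sup>2 * (f t)\<^sup>2 + 2 * a * b * (f t * g t) + b\<^sup>2 * (g t)\<^sup>2)"
    by (auto simp: power2_eq_square algebra_simps)
  ultimately show ?thesis
    using assms by (auto simp: L2_unit_iff)
qed

lemma bounded_L2_unit:
  assumes "f \<in> borel_measurable borel" "\<And>t. t \<in> {0..<1} \<Longrightarrow> \<bar>f t\<bar> \<le> B"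
  shows "f \<in> L2_unit"
proof -
  have "(f t)\<^sup>2 \<le> B\<^sup>2" if "t \<in> {0..<1}" for t
    using assms(2)[OF that] power_mono[of "\<bar>f t\<bar>" B 2] by simp
  then have "integrable unit_lebesgue (\<lambda>t. (f t)\<^sup>2)"
    using assms(1) by (intro unit.integrable_const_bound[of _ "B\<^sup>2"]) (auto intro!: measurable_unit_lebesgue)
  then show ?thesis
    using assms(1) by (simp add: L2_unit_iff)
qed

lemma L2_unit_zero [simp]: "(\<lambda>_. 0) \<in> L2_unit"
  by (rule bounded_L2_unit[of _ 0]) auto

lemma L2_unit_add: "f \<in> L2_unit \<Longrightarrow> g \<in> L2_unit \<Longrightarrow> (\<lambda>t. f t + g t) \<in> L2_unit"
  using L2_unit_lincomb[of f g 1 1] by simp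

lemma L2_unit_diff: "f \<in> L2_unit \<Longrightarrow> g \<in> L2_unit \<Longrightarrow> (\<lambda>t. f t - g t) \<in> L2_unit"
  using L2_unit_lincomb[of f g 1 "-1"] by simp

lemma L2_unit_cmult: "f \<in> L2_unit \<Longrightarrow> (\<lambda>t. a * f t) \<in> L2_unit"
  using L2_unit_lincomb[of f f a 0] by simp

lemma L2_unit_sum:
  assumes "\<And>i. i \<in> A \<Longrightarrow> f i \<in> L2_unit"
  shows "(\<lambda>t. \<Sum>i\<in>A. f i t) \<in> L2_unit"
  using assms by (induction A rule: infinite_finite_induct) (auto intro: L2_unit_add)

lemma L2_inner_commute: "L2_inner f g = L2_inner g f"
  by (simp add: L2_inner_eq mult.commute)

lemma L2_inner_lincomb:
  assumes "f \<in> L2_unit" "g \<in> L2_unit" "k \<in> L2_unit"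
  shows "L2_inner (\<lambda>t. a * f t + b * g t) k = a * L2_inner f k + b * L2_inner g k"
proof -
  have "(\<lambda>t. (a * f t + b * g t) * k t) = (\<lambda>t. a * (f t * k t) + b * (g t * k t))"
    by (auto simp: algebra_simps)
  then show ?thesis
    using assms by (simp add: L2_inner_eq integrable_mult_L2)
qed

lemma L2_inner_add:
  "f \<in> L2_unit \<Longrightarrow> g \<in> L2_unit \<Longrightarrow> k \<in> L2_unit \<Longrightarrow> L2_inner (\<lambda>t. f t + g t) k = L2_inner f k + L2_inner g k"
  using L2_inner_lincomb[of f g k 1 1] by simp

lemma L2_inner_diff:
  "f \<in> L2_unit \<Longrightarrow> g \<in> L2_unit \<Longrightarrow> k \<in> L2_unit \<Longrightarrow> L2_inner (\<lambda>t. f t - g t) k = L2_inner f k - L2_inner g k"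
  using L2_inner_lincomb[of f g k 1 "-1"] by simp

lemma L2_inner_cmult: "L2_inner (\<lambda>t. a * f t) k = a * L2_inner f k"
  by (simp add: L2_inner_eq mult.assoc)

lemma L2_inner_zero [simp]: "L2_inner (\<lambda>_. 0) k = 0"
  by (simp add: L2_inner_eq)

lemma L2_inner_sum:
  assumes "\<And>i. i \<in> A \<Longrightarrow> f i \<in> L2_unit" "k \<in> L2_unit"
  shows "L2_inner (\<lambda>t. \<Sum>i\<in>A. f i t) k = (\<Sum>i\<in>A. L2_inner (f i) k)"
  using assms
  by (induction A rule: infinite_finite_induct) (simp_all add: L2_inner_add L2_unit_sum)

lemma L2_inner_self_nonneg [simp]: "L2_inner f f \<ge> 0"
  unfolding L2_inner_eq by (rule Bochner_Integration.integral_nonneg) simp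

lemma L2_nrm_nonneg [simp]: "L2_nrm f \<ge> 0"
  by (simp add: L2_nrm_def)

lemma L2_nrm_squared: "(L2_nrm f)\<^sup>2 = L2_inner f f"
  by (simp add: L2_nrm_def)

lemma L2_inner_lincomb_self:
  assumes "f \<in> L2_unit" "g \<in> L2_unit"
  shows "L2_inner (\<lambda>t. a * f t + b * g t) (\<lambda>t. a * f t + b * g t) =
    a\<^sup>2 * L2_inner f f + 2 * a * b * L2_inner f g + b\<^sup>2 * L2_inner g g"
proof -
  have "L2_inner k (\<lambda>t. a * f t + b * g t) = a * L2_inner k f + b * L2_inner k g" if "k \<in> L2_unit" for k
    using L2_inner_lincomb[OF assms that] by (simp add: L2_inner_commute[of k])
  then show ?thesis
    using assms L2_unit_lincomb[OF assms] L2_inner_commute[of f g]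
    by (simp add: L2_inner_lincomb power2_eq_square algebra_simps)
qed

subsection \<open>The Hartley basis\<close>

definition cas :: "int \<Rightarrow> real \<Rightarrow> real" where
  "cas j t = cos (2 * pi * of_int j * t) + sin (2 * pi * of_int j * t)"

lemma cas_measurable [measurable]: "cas j \<in> borel_measurable borel"
  unfolding cas_def by measurable

lemma abs_cas_le: "\<bar>cas j t\<bar> \<le> 2"
  using abs_cos_le_one[of "2 * pi * of_int j * t"] abs_sin_le_one[of "2 * pi * of_int j * t"]
  unfolding cas_def by linarith

lemma cas_L2_unit [simp]: "cas j \<in> L2_unit"
  by (rule bounded_L2_unit[of _ 2]) (auto simp: abs_cas_le)

lemma cas_periodic: "cas j (t + 1) = cas j t"
proof -
  have "2 * pi * of_int j * (t + 1) = 2 * pi * of_int j * t + (2 * pi) * of_int j"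
    by (simp add: algebra_simps)
  then show ?thesis
    by (simp only: cas_def cos_add sin_add cos_int_2pin sin_int_2pin)
qed

text \<open>Serves twice: integrated, it gives orthonormality; pointwise, it closes the span of the
  \<open>cas j\<close> under products, as Stone-Weierstrass requires.\<close>

lemma cas_mult:
  "cas j t * cas l t = (cas (j - l) t + cas (l - j) t) / 2 + (cas (j + l) t - cas (- j - l) t) / 2"
proof -
  have *: "2 * pi * of_int (j - l) * t = 2 * pi * of_int j * t - 2 * pi * of_int l * t"
    "2 * pi * of_int (l - j) * t = 2 * pi * of_int l * t - 2 * pi * of_int j * t"
    "2 * pi * of_int (j + l) * t = 2 * pi * of_int j * t + 2 * pi * of_int l * t"
    "2 * pi * of_int (- j - l) * t = - (2 * pi * of_int j * t + 2 * pi * of_int l * t)"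
    by (simp_all add: algebra_simps)
  show ?thesis
    unfolding cas_def * by (simp add: cos_add sin_add cos_diff sin_diff field_simps)
qed

lemma integral_cas: "(LINT t|unit_lebesgue. cas j t) = (if j = 0 then 1 else 0)"
proof (cases "j = 0")
  case True
  then show ?thesis using unit.prob_space by (simp add: cas_def)
next
  case False
  define w where "w = 2 * pi * of_int j"
  have w: "w \<noteq> 0" using False by (simp add: w_def)
  have "(LINT t|unit_lebesgue. cas j t) = (LBINT t:{0..<1}. cas j t)"
    by (simp add: set_integral_unit)
  also have "\<dots> = (LBINT t:{0..1}. cas j t)"
    by (rule set_integral_cong_set)
       (auto simp: set_borel_measurable_def intro!: AE_I'[of "{1}"])
  also have "\<dots> = (LBINT t=0..1. cas j t)"
    by (simp add: interval_integral_Icc zero_ereal_def one_ereal_def)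
  also have "\<dots> = (LBINT t=ereal 0..ereal 1. cas j t)"
    by (simp add: zero_ereal_def one_ereal_def)
  also have "\<dots> = (sin (w * 1) - cos (w * 1)) / w - (sin (w * 0) - cos (w * 0)) / w"
  proof (rule interval_integral_FTC_finite)
    show "continuous_on {min 0 1..max 0 1} (cas j)"
      unfolding cas_def by (intro continuous_intros)
    fix x :: real
    show "((\<lambda>t. (sin (w * t) - cos (w * t)) / w) has_vector_derivative cas j x) (at x within {min 0 1..max 0 1})"
      unfolding has_real_derivative_iff_has_vector_derivative[symmetric]
      using w by (auto intro!: derivative_eq_intros simp: cas_def w_def field_simps)
  qed
  also have "\<dots> = 0"
  proof -
    have "w * 1 = (2 * pi) * of_int j" by (simp add: w_def)
    then show ?thesis by (simp only: cos_int_2pin sin_int_2pin) simp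
  qed
  finally show ?thesis using False by simp
qed

lemma integrable_cas: "integrable unit_lebesgue (cas j)"
  by (rule unit.integrable_const_bound[of _ 2])
     (auto intro!: measurable_unit_lebesgue abs_cas_le)

lemma L2_inner_cas: "L2_inner (cas j) (cas l) = (if j = l then 1 else 0)"
  unfolding L2_inner_eq cas_mult using integrable_cas
  by (simp add: integral_cas)

subsection \<open>Parseval's identity\<close>

text \<open>Expand the squared norm of \<open>f - g\<close>, where \<open>g\<close> is the
  projection of \<open>f\<close> on the span of the \<open>cas j\<close>, \<open>j \<in> A\<close>;
  both the inner product of \<open>f\<close> with \<open>g\<close> and the squared norm of
  \<open>g\<close> equal the left side.\<close>

lemma bessel:
  assumes f: "f \<in> L2_unit" and "finite A"
  shows "(\<Sum>j\<in>A. (L2_inner f (cas j))\<^sup>2) \<le> L2_inner f f"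
proof -
  define g where "g = (\<lambda>t. \<Sum>j\<in>A. L2_inner f (cas j) * cas j t)"
  have g: "g \<in> L2_unit"
    unfolding g_def by (intro L2_unit_sum L2_unit_cmult cas_L2_unit)
  have gk: "L2_inner g k = (\<Sum>j\<in>A. L2_inner f (cas j) * L2_inner (cas j) k)" if "k \<in> L2_unit" for k
    unfolding g_def using that
    by (subst L2_inner_sum) (auto intro: L2_unit_cmult simp: L2_inner_cmult)
  have gf: "L2_inner f g = (\<Sum>j\<in>A. (L2_inner f (cas j))\<^sup>2)"
    unfolding L2_inner_commute[of f g] gk[OF f]
    by (simp add: L2_inner_commute[of "cas _" f] power2_eq_square)
  have "L2_inner (cas l) g = L2_inner f (cas l)" if "l \<in> A" for l
    unfolding L2_inner_commute[of _ g] using that assms(2)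
    by (simp add: gk L2_inner_cas if_distrib cong: if_cong)
  then have gg: "L2_inner g g = (\<Sum>j\<in>A. (L2_inner f (cas j))\<^sup>2)"
    by (simp add: gk[OF g] power2_eq_square)
  have "0 \<le> L2_inner (\<lambda>t. 1 * f t + (-1) * g t) (\<lambda>t. 1 * f t + (-1) * g t)"
    by (rule L2_inner_self_nonneg)
  then show ?thesis
    unfolding L2_inner_lincomb_self[OF f g] gg gf by simp
qed

text \<open>The squared distance of \<open>f\<close> from the span of the \<open>cas j\<close> with
  \<open>\<bar>j\<bar> \<le> N\<close>. It is a quadratic form in \<open>f\<close>, and Parseval's
  identity says that it tends to 0.\<close>

definition residual :: "nat \<Rightarrow> (real \<Rightarrow> real) \<Rightarrow> real" where
  "residual N f = L2_inner f f - (\<Sum>j\<in>{- int N..int N}. (L2_inner f (cas j))\<^sup>2)"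

lemma residual_nonneg: "f \<in> L2_unit \<Longrightarrow> residual N f \<ge> 0"
  using bessel[of f "{- int N..int N}"] by (simp add: residual_def)

lemma residual_le: "residual N f \<le> L2_inner f f"
  by (simp add: residual_def sum_nonneg)

lemma residual_cmult: "residual N (\<lambda>t. a * f t) = a\<^sup>2 * residual N f"
proof -
  have "L2_inner (\<lambda>t. a * f t) (\<lambda>t. a * f t) = a\<^sup>2 * L2_inner f f"
    by (simp add: L2_inner_cmult L2_inner_commute[of f "\<lambda>t. a * f t"] power2_eq_square)
  then show ?thesis
    by (simp add: residual_def L2_inner_cmult power_mult_distrib sum_distrib_left algebra_simps)
qed

text \<open>A quadratic form satisfies the parallelogram law; the term of \<open>f - g\<close> is
  dropped because Bessel's inequality makes it nonnegative.\<close>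

lemma residual_add_le:
  assumes f: "f \<in> L2_unit" and g: "g \<in> L2_unit"
  shows "residual N (\<lambda>t. f t + g t) \<le> 2 * residual N f + 2 * residual N g"
proof -
  let ?S = "\<lambda>f. \<Sum>j\<in>{- int N..int N}. (L2_inner f (cas j))\<^sup>2"
  have "residual N (\<lambda>t. f t + g t) + residual N (\<lambda>t. f t - g t) = 2 * residual N f + 2 * residual N g"
  proof -
    have "L2_inner (\<lambda>t. f t + g t) (\<lambda>t. f t + g t) + L2_inner (\<lambda>t. f t - g t) (\<lambda>t. f t - g t)
        = 2 * L2_inner f f + 2 * L2_inner g g"
      using L2_inner_lincomb_self[OF f g, of 1 1] L2_inner_lincomb_self[OF f g, of 1 "-1"] by simp
    moreover have "?S (\<lambda>t. f t + g t) + ?S (\<lambda>t. f t - g t) = 2 * ?S f + 2 * ?S g"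
      unfolding sum.distrib[symmetric] sum_distrib_left
      using f g by (intro sum.cong) (auto simp: L2_inner_add L2_inner_diff power2_eq_square algebra_simps)
    ultimately show ?thesis by (simp add: residual_def)
  qed
  moreover have "residual N (\<lambda>t. f t - g t) \<ge> 0"
    using f g by (intro residual_nonneg L2_unit_diff)
  ultimately show ?thesis by linarith
qed

section \<open>Closure properties of the functions with vanishing residual\<close>

definition parseval_holds :: "(real \<Rightarrow> real) \<Rightarrow> bool" where
  "parseval_holds f \<longleftrightarrow> f \<in> L2_unit \<and> (\<lambda>N. residual N f) \<longlonglongrightarrow> 0"

lemma parseval_holds_L2: "parseval_holds f \<Longrightarrow> f \<in> L2_unit"
  by (simp add: parseval_holds_def)

lemma parseval_holds_cmult: "parseval_holds f \<Longrightarrow> parseval_holds (\<lambda>t. a * f t)"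
  by (auto simp: parseval_holds_def residual_cmult L2_unit_cmult intro!: tendsto_mult_right_zero)

lemma parseval_holds_add:
  assumes "parseval_holds f" "parseval_holds g"
  shows "parseval_holds (\<lambda>t. f t + g t)"
proof -
  have "(\<lambda>N. 2 * residual N f + 2 * residual N g) \<longlonglongrightarrow> 2 * 0 + 2 * 0"
    using assms by (intro tendsto_intros) (auto simp: parseval_holds_def)
  then have lim: "(\<lambda>N. 2 * residual N f + 2 * residual N g) \<longlonglongrightarrow> 0" by simp
  have fg: "f \<in> L2_unit" "g \<in> L2_unit" using assms parseval_holds_L2 by auto
  have "(\<lambda>N. residual N (\<lambda>t. f t + g t)) \<longlonglongrightarrow> 0"
    by (rule Lim_null_comparison[OF always_eventually lim])
       (use fg in \<open>simp add: residual_nonneg L2_unit_add residual_add_le\<close>)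
  then show ?thesis
    using fg by (simp add: parseval_holds_def L2_unit_add)
qed

lemma parseval_holds_sum:
  assumes "\<And>i. i \<in> A \<Longrightarrow> parseval_holds (f i)"
  shows "parseval_holds (\<lambda>t. \<Sum>i\<in>A. f i t)"
  using assms
proof (induction A rule: infinite_finite_induct)
  case (insert x A)
  then show ?case by (simp add: parseval_holds_add)
qed (simp_all add: parseval_holds_def residual_def)

lemma parseval_holds_cas: "parseval_holds (cas l)"
proof -
  have "residual N (cas l) = 0" if "N \<ge> nat \<bar>l\<bar>" for N
  proof -
    have "l \<in> {- int N..int N}" using that by auto
    then show ?thesis
      by (simp add: residual_def L2_inner_cas if_distrib[of "\<lambda>x. x\<^sup>2"] cong: if_cong)
  qed
  then have "\<forall>\<^sub>F N in sequentially. residual N (cas l) = 0"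
    by (auto simp: eventually_sequentially)
  then show ?thesis
    by (simp add: parseval_holds_def tendsto_eventually)
qed

lemma parseval_holds_const: "parseval_holds (\<lambda>t. a)"
proof -
  have "(\<lambda>t. a * cas 0 t) = (\<lambda>t. a)" by (simp add: cas_def)
  then show ?thesis using parseval_holds_cmult[OF parseval_holds_cas, of a 0] by simp
qed

text \<open>Closedness in the L2 norm: write \<open>f = g + (f - g)\<close>; the residual of
  \<open>g\<close> tends to 0 and that of \<open>f - g\<close> never exceeds its squared
  norm.\<close>

lemma parseval_holds_approx:
  assumes f: "f \<in> L2_unit"
    and ex: "\<And>e. e > 0 \<Longrightarrow> \<exists>g. parseval_holds g \<and> L2_inner (\<lambda>t. f t - g t) (\<lambda>t. f t - g t) < e"
  shows "parseval_holds f"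
proof -
  have "(\<lambda>N. residual N f) \<longlonglongrightarrow> 0"
  proof (rule LIMSEQ_I)
    fix e :: real assume "e > 0"
    then obtain g where g: "parseval_holds g" "L2_inner (\<lambda>t. f t - g t) (\<lambda>t. f t - g t) < e / 4"
      using ex[of "e / 4"] by auto
    have gL: "g \<in> L2_unit" using g(1) by (rule parseval_holds_L2)
    have "e / 4 > 0" using \<open>e > 0\<close> by simp
    then obtain N0 where N0: "\<And>N. N \<ge> N0 \<Longrightarrow> norm (residual N g - 0) < e / 4"
      using g(1) LIMSEQ_D unfolding parseval_holds_def by meson
    show "\<exists>N0. \<forall>N\<ge>N0. norm (residual N f - 0) < e"
    proof (intro exI[of _ N0] allI impI)
      fix N assume "N \<ge> N0"
      have "residual N f \<le> 2 * residual N g + 2 * residual N (\<lambda>t. f t - g t)"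
        using residual_add_le[OF gL L2_unit_diff[OF f gL], of N] by simp
      also have "\<dots> < 2 * (e / 4) + 2 * (e / 4)"
        using N0[OF \<open>N \<ge> N0\<close>] g(2) residual_le[of N "\<lambda>t. f t - g t"] by simp
      finally show "norm (residual N f - 0) < e"
        using residual_nonneg[OF f, of N] by simp
    qed
  qed
  then show ?thesis using f by (simp add: parseval_holds_def)
qed

text \<open>Turns L2 density arguments into pointwise limits. Only values on \<open>{0..<1}\<close>
  are compared, so a constant sequence \<open>s\<close> also transfers the property between
  functions that agree there.\<close>

lemma parseval_holds_dominated:
  assumes f: "f \<in> borel_measurable borel" and s: "\<And>n. parseval_holds (s n)"
    and lim: "\<And>t. t \<in> {0..<1} \<Longrightarrow> (\<lambda>n. s n t) \<longlonglongrightarrow> f t"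
    and w: "w \<in> L2_unit" "\<And>n t. t \<in> {0..<1} \<Longrightarrow> \<bar>s n t\<bar> \<le> w t"
  shows "parseval_holds f"
proof -
  have fw: "\<bar>f t\<bar> \<le> w t" if "t \<in> {0..<1}" for t
    using w(2)[OF that] by (intro LIMSEQ_le_const2[OF tendsto_rabs[OF lim[OF that]]]) auto
  have sL: "s n \<in> L2_unit" for n using s by (rule parseval_holds_L2)
  have "integrable unit_lebesgue (\<lambda>t. (f t)\<^sup>2)"
  proof (rule Bochner_Integration.integrable_bound)
    show "integrable unit_lebesgue (\<lambda>t. (w t)\<^sup>2)" using w by (simp add: L2_unit_iff)
    show "AE t in unit_lebesgue. norm ((f t)\<^sup>2) \<le> norm ((w t)\<^sup>2)"
    proof (intro AE_I2)
      fix t assume "t \<in> space unit_lebesgue"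
      then show "norm ((f t)\<^sup>2) \<le> norm ((w t)\<^sup>2)"
        using power_mono[OF fw[of t] abs_ge_zero, of 2] by simp
    qed
  qed (use f in \<open>intro measurable_unit_lebesgue, measurable\<close>)
  then have f2: "f \<in> L2_unit" using f by (simp add: L2_unit_iff)
  have "(\<lambda>n. L2_inner (\<lambda>t. f t - s n t) (\<lambda>t. f t - s n t)) \<longlonglongrightarrow> (LINT t|unit_lebesgue. 0)"
    unfolding L2_inner_eq
  proof (rule integral_dominated_convergence[where w = "\<lambda>t. 4 * (w t)\<^sup>2"])
    show "AE t in unit_lebesgue. (\<lambda>n. (f t - s n t) * (f t - s n t)) \<longlonglongrightarrow> 0"
    proof (intro AE_I2)
      fix t assume "t \<in> space unit_lebesgue"
      then have "(\<lambda>n. (f t - s n t) * (f t - s n t)) \<longlonglongrightarrow> (f t - f t) * (f t - f t)"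
        using lim[of t] by (intro tendsto_intros) auto
      then show "(\<lambda>n. (f t - s n t) * (f t - s n t)) \<longlonglongrightarrow> 0" by simp
    qed
    show "AE t in unit_lebesgue. norm ((f t - s n t) * (f t - s n t)) \<le> 4 * (w t)\<^sup>2" for n
    proof (intro AE_I2)
      fix t assume "t \<in> space unit_lebesgue"
      then have "\<bar>f t - s n t\<bar> \<le> 2 * w t"
        using fw[of t] w(2)[of t n] by auto
      then have "(f t - s n t)\<^sup>2 \<le> (2 * w t)\<^sup>2"
        by (metis abs_ge_zero power_mono power2_abs)
      then show "norm ((f t - s n t) * (f t - s n t)) \<le> 4 * (w t)\<^sup>2"
        by (simp add: power2_eq_square)
    qed
    show "(\<lambda>t. (f t - s n t) * (f t - s n t)) \<in> borel_measurable unit_lebesgue" for n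
      using f sL[of n] by (intro measurable_unit_lebesgue) (measurable, auto)
  qed (use w in \<open>simp_all add: L2_unit_iff\<close>)
  then have "(\<lambda>n. L2_inner (\<lambda>t. f t - s n t) (\<lambda>t. f t - s n t)) \<longlonglongrightarrow> 0" by simp
  then show ?thesis
    using s by (intro parseval_holds_approx[OF f2]) (auto dest!: order_tendstoD(2) eventually_happens)
qed

section \<open>Completeness: from trigonometric polynomials to continuous functions, indicators and
  L2\<close>

inductive trig_polynomial :: "(real \<Rightarrow> real) \<Rightarrow> bool" where
  cas: "trig_polynomial (cas j)"
| lincomb: "trig_polynomial f \<Longrightarrow> trig_polynomial g \<Longrightarrow> trig_polynomial (\<lambda>t. a * f t + b * g t)"

lemma trig_polynomial_parseval: "trig_polynomial f \<Longrightarrow> parseval_holds f"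
  by (induction rule: trig_polynomial.induct)
     (auto intro: parseval_holds_cas parseval_holds_add parseval_holds_cmult)

lemma trig_polynomial_mult:
  assumes "trig_polynomial f" "trig_polynomial g"
  shows "trig_polynomial (\<lambda>t. f t * g t)"
  using assms(1)
proof (induction rule: trig_polynomial.induct)
  case (cas j)
  show ?case
    using assms(2)
  proof (induction rule: trig_polynomial.induct)
    case (cas l)
    have "trig_polynomial (\<lambda>t. 1 * (1/2 * cas (j - l) t + 1/2 * cas (l - j) t)
        + 1 * (1/2 * cas (j + l) t + (-1/2) * cas (- j - l) t))"
      by (intro trig_polynomial.intros)
    then show ?case unfolding cas_mult by (simp add: add_divide_distrib diff_divide_distrib)
  next
    case (lincomb f g a b)
    have "(\<lambda>t. cas j t * (a * f t + b * g t)) = (\<lambda>t. a * (cas j t * f t) + b * (cas j t * g t))"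
      by (auto simp: algebra_simps)
    with lincomb show ?case by (auto intro: trig_polynomial.lincomb)
  qed
next
  case (lincomb f h a b)
  have "(\<lambda>t. (a * f t + b * h t) * g t) = (\<lambda>t. a * (f t * g t) + b * (h t * g t))"
    by (auto simp: algebra_simps)
  with lincomb show ?case by (auto intro: trig_polynomial.lincomb)
qed

text \<open>A real linear map on the plane is determined by its values at 1 and \<open>\<i>\<close>,
  and cosine and sine are half the sum and half the difference of \<open>cas 1\<close> and
  \<open>cas (-1)\<close>. Sums and products then follow from the algebra structure.\<close>

lemma trig_polynomial_of_real_polynomial:
  assumes "real_polynomial_function p"
  shows "trig_polynomial (\<lambda>t. p (cis (2 * pi * t)))"
  using assms
proof (induction rule: real_polynomial_function.induct)
  case (linear p)
  then interpret bounded_linear p .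
  have "p (cis x) = cos x * p 1 + sin x * p \<i>" for x
  proof -
    have "cis x = cos x *\<^sub>R 1 + sin x *\<^sub>R \<i>" by (simp add: complex_eq_iff)
    then show ?thesis by (simp only: add scaleR) simp
  qed
  moreover have "cos (2 * pi * t) * p 1 + sin (2 * pi * t) * p \<i> =
      ((p 1 + p \<i>) / 2) * cas 1 t + ((p 1 - p \<i>) / 2) * cas (-1) t" for t
    by (simp add: cas_def field_simps)
  ultimately show ?case
    by (simp only:) (intro trig_polynomial.intros)
next
  case (const c)
  have "trig_polynomial (\<lambda>t. c * cas 0 t + 0 * cas 0 t)"
    by (intro trig_polynomial.intros)
  then show ?case by (simp add: cas_def)
next
  case (add p q)
  then show ?case using trig_polynomial.lincomb[of _ _ 1 1] by simp
next
  case (mult p q)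
  from trig_polynomial_mult[OF mult.IH] show ?case by simp
qed

text \<open>Periodic functions are read as functions on the unit circle, which is compact, so that
  Stone-Weierstrass applies without boundary conditions at 0 and 1.\<close>

lemma parseval_holds_circle:
  assumes g: "continuous_on (sphere 0 1) (g :: complex \<Rightarrow> real)"
    and gm: "(\<lambda>t. g (cis (2 * pi * t))) \<in> borel_measurable borel"
  shows "parseval_holds (\<lambda>t. g (cis (2 * pi * t)))"
proof -
  have "\<exists>p. real_polynomial_function p \<and> (\<forall>x\<in>sphere 0 1. \<bar>g x - p x\<bar> < inverse (real (Suc n)))" for n
    using Stone_Weierstrass_real_polynomial_function[OF compact_sphere g, of "inverse (real (Suc n))"]
    by (metis inverse_positive_iff_positive of_nat_0_less_iff zero_less_Suc)
  then obtain p where p: "\<And>n. real_polynomial_function (p n)"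
      "\<And>n x. x \<in> sphere 0 1 \<Longrightarrow> \<bar>g x - p n x\<bar> < inverse (real (Suc n))"
    by metis
  have "bounded (g ` sphere 0 1)"
    by (intro compact_imp_bounded compact_continuous_image g compact_sphere)
  then obtain B where B: "\<And>x. x \<in> sphere 0 1 \<Longrightarrow> \<bar>g x\<bar> \<le> B"
    unfolding bounded_iff by (metis imageI real_norm_def)
  have S: "cis x \<in> sphere 0 1" for x by simp
  show ?thesis
  proof (rule parseval_holds_dominated[OF gm, where s = "\<lambda>n t. p n (cis (2 * pi * t))" and w = "\<lambda>_. B + 1"])
    show "parseval_holds (\<lambda>t. p n (cis (2 * pi * t)))" for n
      by (intro trig_polynomial_parseval trig_polynomial_of_real_polynomial p)
    fix t :: real
    have "(\<lambda>n. g (cis (2 * pi * t)) - p n (cis (2 * pi * t))) \<longlonglongrightarrow> 0"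
      by (rule Lim_null_comparison[OF _ LIMSEQ_inverse_real_of_nat])
         (intro always_eventually allI, unfold real_norm_def, rule less_imp_le[OF p(2)[OF S]])
    from tendsto_diff[OF tendsto_const[of "g (cis (2 * pi * t))"] this]
    show "(\<lambda>n. p n (cis (2 * pi * t))) \<longlonglongrightarrow> g (cis (2 * pi * t))" by simp
    fix n
    have "inverse (real (Suc n)) \<le> 1" by (simp add: field_simps)
    then show "\<bar>p n (cis (2 * pi * t))\<bar> \<le> B + 1"
      using p(2)[OF S, of "2 * pi * t" n] B[OF S, of "2 * pi * t"] by linarith
  qed (rule parseval_holds_L2[OF parseval_holds_const])
qed

text \<open>The interval up to \<open>a\<close> is mapped to a closed arc \<open>C\<close>, and the
  indicator of \<open>C\<close> is the limit of the continuous functions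
  \<open>max 0 (1 - n * infdist z C)\<close>. Since \<open>a < 1\<close>, the arc does not wrap
  around: two points of \<open>{0..<1}\<close> with the same image differ by an integer strictly
  between -1 and 1.\<close>

lemma parseval_holds_indicator_initial:
  assumes "0 \<le> a" "a < 1"
  shows "parseval_holds (indicator {..a})"
proof -
  define C where "C = (\<lambda>t. cis (2 * pi * t)) ` {0..a}"
  have "compact C"
    unfolding C_def by (intro compact_continuous_image continuous_intros) simp
  then have C: "closed C" "C \<noteq> {}" using assms by (auto intro: compact_imp_closed simp: C_def)
  have inC: "cis (2 * pi * t) \<in> C \<longleftrightarrow> t \<le> a" if t: "t \<in> {0..<1}" for t
  proof
    assume "cis (2 * pi * t) \<in> C"
    then obtain u where u: "0 \<le> u" "u \<le> a" "cis (2 * pi * t) = cis (2 * pi * u)"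
      by (auto simp: C_def)
    then have "cos (2 * pi * t) = cos (2 * pi * u) \<and> sin (2 * pi * t) = sin (2 * pi * u)"
      by (simp add: complex_eq_iff)
    then have "\<exists>n::int. 2 * pi * t = 2 * pi * u + 2 * pi * n"
      by (intro iffD1[OF sin_cos_eq_iff]) auto
    then obtain n :: int where n: "2 * pi * t = 2 * pi * u + 2 * pi * of_int n" by auto
    then have "2 * pi * (t - u - of_int n) = 0" by (simp add: algebra_simps)
    then have "t - u = of_int n" by simp
    then have "of_int n < (1::real)" "of_int n > (-1::real)" using t u assms by auto
    then have "n = 0" by linarith
    then show "t \<le> a" using \<open>t - u = of_int n\<close> u by simp
  qed (use t in \<open>auto simp: C_def\<close>)
  define g where "g n z = max 0 (1 - real n * infdist z C)" for n z
  have gb: "\<bar>g n z\<bar> \<le> 1" for n z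
    using infdist_nonneg[of z C] by (auto simp: g_def)
  have cont: "continuous_on UNIV (g n)" for n
    unfolding g_def by (intro continuous_intros)
  have cont2: "continuous_on UNIV (\<lambda>t::real. g n (cis (2 * pi * t)))" for n
    by (intro continuous_on_compose2[OF cont] continuous_intros) auto
  show ?thesis
  proof (rule parseval_holds_dominated[where s = "\<lambda>n t. g n (cis (2 * pi * t))" and w = "\<lambda>_. 1"])
    show "parseval_holds (\<lambda>t. g n (cis (2 * pi * t)))" for n
      by (intro parseval_holds_circle continuous_on_subset[OF cont] borel_measurable_continuous_onI cont2) simp
    fix t :: real assume t: "t \<in> {0..<1}"
    let ?z = "cis (2 * pi * t)"
    show "(\<lambda>n. g n ?z) \<longlonglongrightarrow> indicator {..a} t"
    proof (cases "t \<le> a")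
      case True
      then have "g n ?z = 1" for n
        using inC[OF t] C by (simp add: g_def)
      then show ?thesis using True by simp
    next
      case False
      then have "infdist ?z C > 0"
        using inC[OF t] C by (simp add: in_closed_iff_infdist_zero infdist_nonneg less_le)
      then obtain n0 where n0: "1 < real n0 * infdist ?z C"
        using reals_Archimedean3 by blast
      have "g n ?z = 0" if "n \<ge> n0" for n
      proof -
        have "real n0 * infdist ?z C \<le> real n * infdist ?z C"
          using that by (intro mult_right_mono) (auto simp: infdist_nonneg)
        then show ?thesis using n0 by (simp add: g_def)
      qed
      then have "\<forall>\<^sub>F n in sequentially. g n ?z = 0"
        by (auto simp: eventually_sequentially)
      then show ?thesis using False by (simp add: tendsto_eventually)
    qed
  qed (auto simp: gb parseval_holds_L2[OF parseval_holds_const])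
qed

text \<open>Dynkin's theorem with the half-lines as intersection-stable generator. Half-lines with
  endpoint outside \<open>{0..<1}\<close> agree with a constant on that interval.\<close>

lemma parseval_holds_indicator:
  assumes "A \<in> sets borel"
  shows "parseval_holds (indicator A)"
proof -
  have S: "sets borel = sigma_sets UNIV (range (\<lambda>a::real. {..a}))"
    by (subst borel_eq_atMost) (simp add: sets_measure_of)
  have "Int_stable (range (\<lambda>a::real. {..a}))"
    by (auto simp: Int_stable_def intro!: range_eqI[of _ _ "min _ _"])
  then show ?thesis
  proof (rule sigma_sets_induct_disjoint[OF _ _ assms[unfolded S]])
    show "range (\<lambda>a::real. {..a}) \<subseteq> Pow UNIV" by simp
    show "parseval_holds (indicator {})"
      using parseval_holds_const[of 0] by (rule back_subst[of parseval_holds]) auto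
  next
    fix A :: "real set" assume "A \<in> range (\<lambda>a. {..a})"
    then obtain a where A: "A = {..a}" by auto
    consider "a < 0" | "0 \<le> a" "a < 1" | "a \<ge> 1" by linarith
    then show "parseval_holds (indicator A)"
    proof cases
      case 1
      show ?thesis
        by (rule parseval_holds_dominated[where s = "\<lambda>_ _. 0" and w = "\<lambda>_. 0"])
           (use 1 A in \<open>auto intro: parseval_holds_const\<close>)
    next
      case 2
      then show ?thesis using A parseval_holds_indicator_initial by simp
    next
      case 3
      show ?thesis
        by (rule parseval_holds_dominated[where s = "\<lambda>_ _. 1" and w = "\<lambda>_. 1"])
           (use 3 A in \<open>auto intro: parseval_holds_const parseval_holds_L2\<close>)
    qed
  next
    fix A assume "parseval_holds (indicator A)"
    from parseval_holds_add[OF parseval_holds_const[of 1] parseval_holds_cmult[OF this, of "-1"]]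
    show "parseval_holds (indicator (UNIV - A))"
      by (rule back_subst[of parseval_holds]) (auto simp: indicator_def)
  next
    fix A :: "nat \<Rightarrow> real set"
    assume A: "disjoint_family A" "range A \<subseteq> sigma_sets UNIV (range (\<lambda>a. {..a}))"
      "\<And>i. parseval_holds (indicator (A i))"
    have m: "A i \<in> sets borel" for i using A(2) S by auto
    show "parseval_holds (indicator (\<Union>i. A i))"
    proof (rule parseval_holds_dominated[where s = "\<lambda>n t. \<Sum>i<n. indicator (A i) t" and w = "\<lambda>_. 1"])
      show "parseval_holds (\<lambda>t. \<Sum>i<n. indicator (A i) t)" for n
        by (intro parseval_holds_sum A)
      fix t
      have "(\<lambda>i. indicator (A i) t :: real) sums indicator (\<Union>i. A i) t"
        by (rule indicator_sums) (use A(1) in \<open>auto simp: disjoint_family_on_def\<close>)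
      then show "(\<lambda>n. \<Sum>i<n. indicator (A i) t) \<longlonglongrightarrow> (indicator (\<Union>i. A i) t :: real)"
        by (simp add: sums_def)
      fix n
      have "(\<Sum>i<n. indicator (A i) t :: real) = indicator (\<Union>i<n. A i) t"
        using A(1) by (subst indicator_UN_disjoint) (auto simp: disjoint_family_on_def)
      then show "\<bar>\<Sum>i<n. indicator (A i) t :: real\<bar> \<le> 1" by (simp add: indicator_def)
    qed (use m in \<open>auto intro: parseval_holds_const parseval_holds_L2\<close>)
  qed
qed

text \<open>Simple functions converge pointwise to \<open>f\<close> and can be chosen bounded by
  \<open>2 * \<bar>f\<bar>\<close>, which is a square integrable majorant.\<close>

lemma parseval_holds_L2_unit:
  assumes f: "f \<in> L2_unit"
  shows "parseval_holds f"
proof -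
  obtain s where s: "\<And>i. simple_function borel (s i)" "\<And>x. (\<lambda>i. s i x) \<longlonglongrightarrow> f x"
      "\<And>i x. dist (s i x) 0 \<le> 2 * dist (f x) 0"
    using borel_measurable_implies_sequence_metric[OF L2_unit_measurable[OF f], of 0] by auto
  show ?thesis
  proof (rule parseval_holds_dominated[where s = s and w = "\<lambda>t. 2 * \<bar>f t\<bar>"])
    fix n
    have "finite (range (s n))"
      using s(1)[of n] by (simp add: simple_function_def)
    moreover have "s n -` {y} \<in> sets borel" for y
      using measurable_sets_borel[OF borel_measurable_simple_function[OF s(1)], of "{y}"] by simp
    ultimately have "parseval_holds (\<lambda>t. \<Sum>y\<in>range (s n). y * indicator (s n -` {y}) t)"
      by (intro parseval_holds_sum parseval_holds_cmult parseval_holds_indicator)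
    moreover
    have "s n t = (\<Sum>y\<in>range (s n). y * indicator (s n -` {y}) t)" for t
      by (subst simple_function_indicator_representation_banach[OF s(1), of t n])
         (auto intro!: sum.cong)
    then have "(\<lambda>t. \<Sum>y\<in>range (s n). y * indicator (s n -` {y}) t) = s n"
      by (intro ext) (rule sym)
    ultimately show "parseval_holds (s n)" by simp
  next
    have "(\<lambda>t. 1 * \<bar>f t\<bar> + 1 * \<bar>f t\<bar>) \<in> L2_unit"
      using f by (intro L2_unit_lincomb) (auto simp: L2_unit_iff)
    then show "(\<lambda>t. 2 * \<bar>f t\<bar>) \<in> L2_unit" by simp
  qed (use s f in auto)
qed

text \<open>Connects unordered sums over the integers with limits of symmetric partial sums, the
  form in which the sequential limit theorems of integration apply.\<close>

lemma filterlim_symmetric_intervals: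
  "filterlim (\<lambda>N. {- int N..int N}) (finite_subsets_at_top UNIV) sequentially"
  unfolding filterlim_finite_subsets_at_top
proof (intro allI impI)
  fix X :: "int set" assume "finite X \<and> X \<subseteq> UNIV"
  then have "finite ((\<lambda>x. nat \<bar>x\<bar>) ` X)" by simp
  then obtain M where "\<forall>y\<in>(\<lambda>x. nat \<bar>x\<bar>) ` X. y \<le> M"
    by (meson finite_nat_set_iff_bounded_le)
  then have "X \<subseteq> {- int N..int N}" if "N \<ge> M" for N using that by force
  then show "\<forall>\<^sub>F N in sequentially. finite {- int N..int N} \<and> X \<subseteq> {- int N..int N} \<and> {- int N..int N} \<subseteq> UNIV"
    by (auto simp: eventually_sequentially)
qed

theorem parseval:
  assumes f: "f \<in> L2_unit"
  shows "((\<lambda>j. (L2_inner f (cas j))\<^sup>2) has_sum L2_inner f f) UNIV"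
proof -
  let ?c = "\<lambda>j. (L2_inner f (cas j))\<^sup>2"
  have "?c summable_on UNIV"
    by (rule nonneg_bdd_above_summable_on) (auto intro!: bdd_aboveI2[of _ _ "L2_inner f f"] bessel f)
  then have sum: "(?c has_sum (\<Sum>\<^sub>\<infinity>j. ?c j)) UNIV" by simp
  then have lim: "(\<lambda>N. sum ?c {- int N..int N}) \<longlonglongrightarrow> (\<Sum>\<^sub>\<infinity>j. ?c j)"
    unfolding has_sum_def by (rule filterlim_compose[OF _ filterlim_symmetric_intervals])
  have "(\<lambda>N. L2_inner f f - residual N f) \<longlonglongrightarrow> L2_inner f f - 0"
    using parseval_holds_L2_unit[OF f] by (intro tendsto_intros) (simp add: parseval_holds_def)
  then have "(\<lambda>N. sum ?c {- int N..int N}) \<longlonglongrightarrow> L2_inner f f"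
    by (simp add: residual_def)
  then show ?thesis using sum LIMSEQ_unique[OF lim] by simp
qed

lemma cas_coeff_summable: "f \<in> L2_unit \<Longrightarrow> (\<lambda>j. (L2_inner f (cas j))\<^sup>2) summable_on A"
  by (rule summable_on_subset_banach[OF has_sum_imp_summable[OF parseval]]) auto

lemma L2_nrm_squared_infsum: "f \<in> L2_unit \<Longrightarrow> (L2_nrm f)\<^sup>2 = (\<Sum>\<^sub>\<infinity>j. (L2_inner f (cas j))\<^sup>2)"
  unfolding L2_nrm_squared by (rule infsumI[OF parseval, symmetric])

subsection \<open>Independence from characteristic functions\<close>

context prob_space
begin

text \<open>Tilting the measure by the density proportional to \<open>2 + V\<close> leaves the characteristic
  function of \<open>X\<close> unchanged, hence also its law.\<close>

lemma expectation_indicator_of_char_real: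
  fixes V X :: "'a \<Rightarrow> real"
  assumes [measurable]: "X \<in> borel_measurable M" "V \<in> borel_measurable M"
    and V: "\<And>\<omega>. \<bar>V \<omega>\<bar> \<le> 1"
    and eq: "\<And>t. (CLINT \<omega>|M. V \<omega> * iexp (t * X \<omega>)) = v * (CLINT \<omega>|M. iexp (t * X \<omega>))"
    and A [measurable]: "A \<in> sets borel"
  shows "expectation (\<lambda>\<omega>. V \<omega> * indicator A (X \<omega>)) = v * prob (X -` A \<inter> space M)"
proof -
  have iV: "integrable M V"
    using V by (intro integrable_const_bound[of _ 1]) auto
  have iVi: "integrable M (\<lambda>\<omega>. V \<omega> * indicator A (X \<omega>))"
    using V by (intro integrable_const_bound[of _ 1]) (auto simp: indicator_def)
  have iVe: "complex_integrable M (\<lambda>\<omega>. V \<omega> * iexp (t * X \<omega>))" for t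
    using V by (intro integrable_const_bound[of _ 1]) (auto simp: norm_mult)
  have ie: "complex_integrable M (\<lambda>\<omega>. iexp (t * X \<omega>))" for t
    by (intro integrable_const_bound[of _ 1]) auto
  have "complex_of_real v = complex_of_real (expectation V)"
    using eq[of 0] by (simp add: prob_space)
  then have v: "v = expectation V" by (simp only: of_real_eq_iff)
  have "\<bar>expectation V\<bar> \<le> expectation (\<lambda>\<omega>. \<bar>V \<omega>\<bar>)"
    by (rule integral_abs_bound)
  also have "\<dots> \<le> 1"
    using V integral_mono[OF integrable_abs[OF iV] integrable_const[of 1]] by (simp add: prob_space)
  finally have v1: "2 + v > 0" using v by simp
  \<comment> \<open>The constant 2 keeps the density nonnegative and its normalization away from 0,
    since \<open>V\<close> and its mean \<open>v\<close> are at least -1.\<close>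
  define w where "w \<omega> = (2 + V \<omega>) / (2 + v)" for \<omega>
  have w0: "0 \<le> w \<omega>" for \<omega> using V[of \<omega>] v1 by (simp add: w_def abs_le_iff)
  have [measurable]: "w \<in> borel_measurable M" unfolding w_def by measurable
  have iw: "integrable M w" unfolding w_def using iV by simp
  have "expectation w = 1"
    unfolding w_def using iV v v1 by (simp add: prob_space)
  define N where "N = density M w"
  have "emeasure N (space N) = ennreal (expectation w)"
    using iw w0 by (simp add: N_def emeasure_density nn_integral_eq_integral cong: nn_integral_cong)
  then interpret N: prob_space N
    by (intro prob_spaceI) (simp add: \<open>expectation w = 1\<close>)
  have [measurable]: "X \<in> borel_measurable N" by (simp add: N_def)
  have "char (distr N borel X) t = char (distr M borel X) t" for t
  proof -
    have "char (distr N borel X) t = (CLINT \<omega>|N. iexp (t * X \<omega>))"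
      by (simp add: char_def integral_distr)
    also have "\<dots> = (CLINT \<omega>|M. w \<omega> *\<^sub>R iexp (t * X \<omega>))"
      unfolding N_def by (subst integral_density) (auto simp: w0)
    also have "\<dots> = (CLINT \<omega>|M. (2 * iexp (t * X \<omega>) + V \<omega> * iexp (t * X \<omega>)) / (2 + v))"
      by (simp add: w_def scaleR_conv_of_real field_simps)
    also have "\<dots> = ((2 + v) * (CLINT \<omega>|M. iexp (t * X \<omega>))) / (2 + v)"
      using ie[of t] iVe[of t] eq[of t] by (simp add: algebra_simps)
    also have "\<dots> = (CLINT \<omega>|M. iexp (t * X \<omega>))"
    proof -
      have "complex_of_real (2 + v) \<noteq> 0" using v1 by (simp only: of_real_eq_0_iff)
      then show ?thesis by simp
    qed
    also have "\<dots> = char (distr M borel X) t"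
      by (simp add: char_def integral_distr)
    finally show ?thesis .
  qed
  then have "distr N borel X = distr M borel X"
    by (intro Levy_uniqueness N.real_distribution_distr real_distribution_distr ext) auto
  then have "emeasure (distr N borel X) A = emeasure (distr M borel X) A" by simp
  then have "N.prob (X -` A \<inter> space M) = prob (X -` A \<inter> space M)"
    by (simp add: emeasure_distr measure_def N_def)
  moreover have "N.prob (X -` A \<inter> space M) = (LINT \<omega>|N. indicator A (X \<omega>))"
  proof -
    have "(LINT \<omega>|N. indicator A (X \<omega>)) = (LINT \<omega>|N. indicator (X -` A) \<omega> :: real)"
      by (auto intro!: Bochner_Integration.integral_cong simp: indicator_def)
    then show ?thesis by (simp add: N_def)
  qed
  moreover have "\<dots> = (LINT \<omega>|M. w \<omega> * indicator A (X \<omega>))"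
    unfolding N_def by (subst integral_density) (auto simp: w0)
  moreover have "\<dots> = (LINT \<omega>|M. (2 * indicator A (X \<omega>) + V \<omega> * indicator A (X \<omega>)) / (2 + v))"
    by (simp add: w_def field_simps)
  moreover have "\<dots> = (2 * prob (X -` A \<inter> space M) + expectation (\<lambda>\<omega>. V \<omega> * indicator A (X \<omega>))) / (2 + v)"
  proof -
    have 1: "integrable M (\<lambda>\<omega>. indicator A (X \<omega>) :: real)"
      by (intro integrable_const_bound[of _ 1]) auto
    have "(LINT \<omega>|M. indicator A (X \<omega>)) = (LINT \<omega>|M. indicator (X -` A) \<omega> :: real)"
      by (auto intro!: Bochner_Integration.integral_cong simp: indicator_def)
    then have "(LINT \<omega>|M. indicator A (X \<omega>)) = prob (X -` A \<inter> space M)" by simp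
    then show ?thesis using 1 iVi by simp
  qed
  ultimately show ?thesis using v1 by (simp add: field_simps)
qed

text \<open>The real and imaginary parts of \<open>V\<close> satisfy the hypothesis of the real
  case: conjugating the assumed identity at \<open>- t\<close> yields the same identity for the
  conjugate of \<open>V\<close>.\<close>

lemma expectation_indicator_of_char:
  fixes V :: "'a \<Rightarrow> complex" and X :: "'a \<Rightarrow> real"
  assumes [measurable]: "X \<in> borel_measurable M" "V \<in> borel_measurable M"
    and V: "\<And>\<omega>. cmod (V \<omega>) \<le> 1"
    and eq: "\<And>t. (CLINT \<omega>|M. V \<omega> * iexp (t * X \<omega>)) = v * (CLINT \<omega>|M. iexp (t * X \<omega>))"
    and A [measurable]: "A \<in> sets borel"
  shows "(CLINT \<omega>|M. V \<omega> * indicator A (X \<omega>)) = v * prob (X -` A \<inter> space M)"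
proof -
  have iVe: "complex_integrable M (\<lambda>\<omega>. V \<omega> * iexp (t * X \<omega>))" for t
    using V by (intro integrable_const_bound[of _ 1]) (auto simp: norm_mult)
  have iVi: "complex_integrable M (\<lambda>\<omega>. V \<omega> * indicator A (X \<omega>))"
    using V by (intro integrable_const_bound[of _ 1]) (auto simp: norm_mult indicator_def)
  have [measurable]: "(\<lambda>\<omega>. cnj (V \<omega>)) \<in> borel_measurable M"
    by (rule measurable_compose[OF assms(2)]) (intro borel_measurable_continuous_onI continuous_intros)
  have iVc: "complex_integrable M (\<lambda>\<omega>. cnj (V \<omega>) * iexp (t * X \<omega>))" for t
    using V by (intro integrable_const_bound[of _ 1]) (auto simp: norm_mult)
  have eq': "(CLINT \<omega>|M. cnj (V \<omega>) * iexp (t * X \<omega>)) = cnj v * (CLINT \<omega>|M. iexp (t * X \<omega>))" for t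
  proof -
    have *: "cnj (iexp (t * x)) = iexp (- t * x)" for x :: real
      by (simp add: exp_cnj)
    have "(CLINT \<omega>|M. cnj (V \<omega>) * iexp (t * X \<omega>)) = (CLINT \<omega>|M. cnj (V \<omega> * iexp (- t * X \<omega>)))"
      by (simp add: exp_cnj)
    also have "\<dots> = cnj (v * (CLINT \<omega>|M. iexp (- t * X \<omega>)))"
      by (simp only: Bochner_Integration.integral_cnj eq)
    also have "\<dots> = cnj v * (CLINT \<omega>|M. cnj (iexp (- t * X \<omega>)))"
      by (simp only: Bochner_Integration.integral_cnj complex_cnj_mult)
    finally show ?thesis by (simp add: exp_cnj)
  qed
  have re: "expectation (\<lambda>\<omega>. Re (V \<omega>) * indicator A (X \<omega>)) = Re v * prob (X -` A \<inter> space M)"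
  proof (rule expectation_indicator_of_char_real)
    show "\<bar>Re (V \<omega>)\<bar> \<le> 1" for \<omega> using V[of \<omega>] abs_Re_le_cmod[of "V \<omega>"] by linarith
    fix t
    have "(CLINT \<omega>|M. complex_of_real (Re (V \<omega>)) * iexp (t * X \<omega>)) =
        (CLINT \<omega>|M. (V \<omega> * iexp (t * X \<omega>) + cnj (V \<omega>) * iexp (t * X \<omega>)) / 2)"
      by (intro Bochner_Integration.integral_cong refl)
         (simp flip: distrib_right add: complex_add_cnj)
    also have "\<dots> = (v + cnj v) / 2 * (CLINT \<omega>|M. iexp (t * X \<omega>))"
      using iVe[of t] iVc[of t] eq[of t] eq'[of t] by (simp add: algebra_simps add_divide_distrib)
    finally show "(CLINT \<omega>|M. complex_of_real (Re (V \<omega>)) * iexp (t * X \<omega>)) = Re v * (CLINT \<omega>|M. iexp (t * X \<omega>))"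
      by (simp add: complex_add_cnj)
  qed measurable
  have im: "expectation (\<lambda>\<omega>. Im (V \<omega>) * indicator A (X \<omega>)) = Im v * prob (X -` A \<inter> space M)"
  proof (rule expectation_indicator_of_char_real)
    show "\<bar>Im (V \<omega>)\<bar> \<le> 1" for \<omega> using V[of \<omega>] abs_Im_le_cmod[of "V \<omega>"] by linarith
    fix t
    have "(CLINT \<omega>|M. complex_of_real (Im (V \<omega>)) * iexp (t * X \<omega>)) =
        (CLINT \<omega>|M. (V \<omega> * iexp (t * X \<omega>) - cnj (V \<omega>) * iexp (t * X \<omega>)) / (2 * \<i>))"
      by (intro Bochner_Integration.integral_cong refl)
         (simp only: left_diff_distrib[symmetric] complex_diff_cnj, simp add: field_simps)
    also have "\<dots> = (v - cnj v) / (2 * \<i>) * (CLINT \<omega>|M. iexp (t * X \<omega>))"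
      using iVe[of t] iVc[of t] eq[of t] eq'[of t] by (simp add: algebra_simps diff_divide_distrib)
    finally show "(CLINT \<omega>|M. complex_of_real (Im (V \<omega>)) * iexp (t * X \<omega>)) = Im v * (CLINT \<omega>|M. iexp (t * X \<omega>))"
      by (simp add: complex_diff_cnj field_simps)
  qed measurable
  have ri: "Re (indicator A x) = indicator A x" "Im (indicator A x) = 0" for x :: real
    by (auto simp: indicator_def)
  show ?thesis
  proof (rule complex_eqI)
    show "Re (CLINT \<omega>|M. V \<omega> * indicator A (X \<omega>)) = Re (v * prob (X -` A \<inter> space M))"
      using re iVi by (simp add: integral_Re[symmetric] ri)
    show "Im (CLINT \<omega>|M. V \<omega> * indicator A (X \<omega>)) = Im (v * prob (X -` A \<inter> space M))"
      using im iVi by (simp add: integral_Im[symmetric] ri)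
  qed
qed

text \<open>Kac's criterion. The induction in \<open>main\<close> trades the exponentials for
  indicators one index at a time: if \<open>V\<close> is the product of the indicators already
  obtained and the exponentials still present, the induction hypothesis with the frequency
  \<open>t\<close> added at index \<open>a\<close> says that \<open>V\<close> multiplies the
  characteristic function of \<open>X a\<close> by a constant, and
  \<open>expectation_indicator_of_char\<close> then passes to the indicator.\<close>

lemma indep_vars_of_char:
  fixes X :: "'i \<Rightarrow> 'a \<Rightarrow> real"
  assumes X: "\<And>i. i \<in> I \<Longrightarrow> X i \<in> borel_measurable M"
    and eq: "\<And>B s. finite B \<Longrightarrow> B \<subseteq> I \<Longrightarrow>
      (CLINT \<omega>|M. iexp (\<Sum>i\<in>B. s i * X i \<omega>)) = (\<Prod>i\<in>B. (CLINT \<omega>|M. iexp (s i * X i \<omega>)))"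
  shows "indep_vars (\<lambda>_. borel) X I"
proof -
  have main: "(CLINT \<omega>|M. (\<Prod>i\<in>J. indicator (S i) (X i \<omega>)) * iexp (\<Sum>i\<in>B. s i * X i \<omega>)) =
      (\<Prod>i\<in>J. prob (X i -` S i \<inter> space M)) * (CLINT \<omega>|M. iexp (\<Sum>i\<in>B. s i * X i \<omega>))"
    if "finite J" "finite B" "J \<subseteq> I" "B \<subseteq> I" "J \<inter> B = {}" "\<And>i. i \<in> J \<Longrightarrow> S i \<in> sets borel" for J B s S
    using that
  proof (induction J arbitrary: B s rule: finite_induct)
    case empty
    then show ?case by simp
  next
    case (insert a J)
    have [measurable]: "X i \<in> borel_measurable M" if "i \<in> insert a J \<union> B" for i
      using that insert.prems X by auto
    have [measurable]: "S i \<in> sets borel" if "i \<in> insert a J" for i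
      using that insert.prems by auto
    have aB: "a \<notin> B" using insert by auto
    define V where "V = (\<lambda>\<omega>. (\<Prod>i\<in>J. indicator (S i) (X i \<omega>)) * iexp (\<Sum>i\<in>B. s i * X i \<omega>))"
    define v where "v = (\<Prod>i\<in>J. prob (X i -` S i \<inter> space M)) * (CLINT \<omega>|M. iexp (\<Sum>i\<in>B. s i * X i \<omega>))"
    have V1: "cmod (V \<omega>) \<le> 1" for \<omega>
      unfolding V_def norm_mult norm_exp_i_times prod_norm[symmetric]
      by (auto intro!: prod_le_1 simp: indicator_def)
    have "(CLINT \<omega>|M. V \<omega> * iexp (t * X a \<omega>)) = v * (CLINT \<omega>|M. iexp (t * X a \<omega>))" for t
    proof -
      have upd: "(\<Sum>i\<in>insert a B. (s(a := t)) i * X i \<omega>) = (\<Sum>i\<in>B. s i * X i \<omega>) + t * X a \<omega>" for \<omega>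
        using aB insert.prems(1) by (auto simp: add.commute intro!: sum.cong)
      have "(CLINT \<omega>|M. V \<omega> * iexp (t * X a \<omega>)) =
          (CLINT \<omega>|M. (\<Prod>i\<in>J. indicator (S i) (X i \<omega>)) * iexp (\<Sum>i\<in>insert a B. (s(a := t)) i * X i \<omega>))"
        unfolding V_def upd by (simp add: distrib_left exp_add mult.assoc)
      also have "\<dots> = (\<Prod>i\<in>J. prob (X i -` S i \<inter> space M)) * (CLINT \<omega>|M. iexp (\<Sum>i\<in>insert a B. (s(a := t)) i * X i \<omega>))"
        using insert by (intro insert.IH) auto
      also have "(CLINT \<omega>|M. iexp (\<Sum>i\<in>insert a B. (s(a := t)) i * X i \<omega>)) =
          (\<Prod>i\<in>insert a B. (CLINT \<omega>|M. iexp ((s(a := t)) i * X i \<omega>)))"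
        using insert.prems by (intro eq) auto
      also have "\<dots> = (CLINT \<omega>|M. iexp (t * X a \<omega>)) * (\<Prod>i\<in>B. (CLINT \<omega>|M. iexp (s i * X i \<omega>)))"
        using aB insert.prems(1) by (auto intro!: prod.cong arg_cong2[where f = "(*)"])
      also have "(\<Prod>i\<in>B. (CLINT \<omega>|M. iexp (s i * X i \<omega>))) = (CLINT \<omega>|M. iexp (\<Sum>i\<in>B. s i * X i \<omega>))"
        using insert.prems by (intro eq[symmetric]) auto
      finally show ?thesis by (simp add: v_def mult_ac)
    qed
    moreover have "V \<in> borel_measurable M" unfolding V_def by measurable
    ultimately have "(CLINT \<omega>|M. V \<omega> * indicator (S a) (X a \<omega>)) = v * prob (X a -` S a \<inter> space M)"
      using V1 by (intro expectation_indicator_of_char) auto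
    then show ?case
      using insert.hyps by (simp add: V_def v_def mult_ac)
  qed
  show ?thesis
    unfolding indep_vars_def2 indep_sets_def
  proof (intro conjI ballI allI impI)
    fix J T assume J: "J \<subseteq> I" "J \<noteq> {}" "finite J"
      and T: "T \<in> Pi J (\<lambda>i. {X i -` A \<inter> space M |A. A \<in> sets borel})"
    have "\<exists>A. A \<in> sets borel \<and> T i = X i -` A \<inter> space M" if "i \<in> J" for i
      using Pi_mem[OF T that] by auto
    then obtain S where S: "\<And>i. i \<in> J \<Longrightarrow> S i \<in> sets borel" "\<And>i. i \<in> J \<Longrightarrow> T i = X i -` S i \<inter> space M"
      by metis
    have [measurable]: "T i \<in> sets M" if "i \<in> J" for i
      using that J X S by (auto intro: measurable_sets)
    have "complex_of_real (prob (\<Inter>i\<in>J. T i)) = (CLINT \<omega>|M. indicator (\<Inter>i\<in>J. T i) \<omega>)"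
    proof -
      have "(\<Inter>i\<in>J. T i) \<in> sets M" using J by (intro sets.finite_INT) auto
      then have "complex_of_real (LINT \<omega>|M. indicator (\<Inter>i\<in>J. T i) \<omega>) = complex_of_real (prob (\<Inter>i\<in>J. T i))"
        by (simp add: sets.Int_space_eq2)
      then show ?thesis
        by (simp only: integral_complex_of_real[symmetric]) (simp add: indicator_def of_bool_def if_distrib cong: if_cong)
    qed
    \<comment> \<open>The exponential of the empty sum is 1; it is written out so that
      \<open>main\<close> applies with \<open>B\<close> empty.\<close>
    also have "\<dots> = (CLINT \<omega>|M. (\<Prod>i\<in>J. indicator (S i) (X i \<omega>)) * iexp (\<Sum>i\<in>{}. 0 * X i \<omega>))"
    proof (intro Bochner_Integration.integral_cong refl)
      fix \<omega> assume "\<omega> \<in> space M"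
      then have "(\<Prod>i\<in>J. indicator (S i) (X i \<omega>)) = (\<Prod>i\<in>J. indicator (T i) \<omega> :: complex)"
        using S(2) by (intro prod.cong) (auto simp: indicator_def)
      also have "\<dots> = indicator (\<Inter>i\<in>J. T i) \<omega>"
        using J by (cases "\<forall>i\<in>J. \<omega> \<in> T i") (auto simp: prod_zero_iff indicator_eq_0_iff)
      finally show "indicator (\<Inter>i\<in>J. T i) \<omega> = (\<Prod>i\<in>J. indicator (S i) (X i \<omega>)) * iexp (\<Sum>i\<in>{}. 0 * X i \<omega>)"
        by simp
    qed
    also have "\<dots> = complex_of_real (\<Prod>i\<in>J. prob (T i))"
      using J S by (subst main) (auto simp: prob_space)
    finally show "prob (\<Inter>i\<in>J. T i) = (\<Prod>i\<in>J. prob (T i))"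
      by (simp only: of_real_eq_iff)
  qed (use X in \<open>auto intro: measurable_sets\<close>)
qed

end

subsection \<open>Gaussian white noise\<close>

locale white_noise_space =
  fixes M :: "'w measure" and W :: "(real \<Rightarrow> real) \<Rightarrow> 'w \<Rightarrow> real"
  assumes noise: "white_noise M W"
begin

sublocale prob_space M
  using noise by (simp add: white_noise_def)

lemma W_measurable [measurable]: "\<phi> \<in> L2_unit \<Longrightarrow> W \<phi> \<in> borel_measurable M"
  using noise by (simp add: white_noise_def)

lemma W_lincomb:
  "\<phi> \<in> L2_unit \<Longrightarrow> \<psi> \<in> L2_unit \<Longrightarrow> AE \<omega> in M. W (\<lambda>t. a * \<phi> t + b * \<psi> t) \<omega> = a * W \<phi> \<omega> + b * W \<psi> \<omega>"
  using noise by (simp add: white_noise_def)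

lemma W_zero: "\<phi> \<in> L2_unit \<Longrightarrow> L2_nrm \<phi> = 0 \<Longrightarrow> AE \<omega> in M. W \<phi> \<omega> = 0"
  using noise by (simp add: white_noise_def)

lemma W_normalized:
  assumes "\<phi> \<in> L2_unit" "L2_nrm \<phi> > 0"
  shows "distr M borel (\<lambda>\<omega>. W \<phi> \<omega> / L2_nrm \<phi>) = std_normal_distribution"
proof -
  have "distributed M lborel (W \<phi>) (normal_density 0 (L2_nrm \<phi>))"
    using noise assms by (simp add: white_noise_def)
  then have "distributed M lborel (\<lambda>\<omega>. (W \<phi> \<omega> - 0) / L2_nrm \<phi>) std_normal_density"
    using normal_standard_normal_convert[OF assms(2), of "W \<phi>" 0] by simp
  then have "distr M lborel (\<lambda>\<omega>. W \<phi> \<omega> / L2_nrm \<phi>) = std_normal_distribution"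
    by (simp add: distributed_distr_eq_density)
  moreover have "distr M lborel (\<lambda>\<omega>. W \<phi> \<omega> / L2_nrm \<phi>) = distr M borel (\<lambda>\<omega>. W \<phi> \<omega> / L2_nrm \<phi>)"
    by (rule distr_cong) auto
  ultimately show ?thesis by simp
qed

lemma W_char:
  assumes "\<phi> \<in> L2_unit"
  shows "(CLINT \<omega>|M. iexp (W \<phi> \<omega>)) = exp (- L2_inner \<phi> \<phi> / 2)"
proof (cases "L2_nrm \<phi> = 0")
  case True
  have "(CLINT \<omega>|M. iexp (W \<phi> \<omega>)) = (CLINT \<omega>|M. 1)"
    using W_zero[OF assms True] assms by (intro integral_cong_AE) auto
  then show ?thesis
    using L2_nrm_squared[of \<phi>] True by (simp add: prob_space)
next
  case False
  then have pos: "L2_nrm \<phi> > 0" using L2_nrm_nonneg[of \<phi>] by linarith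
  have "(CLINT \<omega>|M. iexp (W \<phi> \<omega>)) = (CLINT \<omega>|M. iexp (L2_nrm \<phi> * (W \<phi> \<omega> / L2_nrm \<phi>)))"
    using pos by simp
  also have "\<dots> = (CLINT x|distr M borel (\<lambda>\<omega>. W \<phi> \<omega> / L2_nrm \<phi>). iexp (L2_nrm \<phi> * x))"
    using assms by (subst integral_distr) auto
  also have "\<dots> = exp (- L2_inner \<phi> \<phi> / 2)"
    unfolding W_normalized[OF assms pos] char_def[symmetric] char_std_normal_distribution
    by (simp add: L2_nrm_squared)
  finally show ?thesis .
qed

lemma W_second_moment:
  assumes "\<phi> \<in> L2_unit"
  shows "integrable M (\<lambda>\<omega>. (W \<phi> \<omega>)\<^sup>2)" "expectation (\<lambda>\<omega>. (W \<phi> \<omega>)\<^sup>2) = L2_inner \<phi> \<phi>"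
proof -
  have "integrable M (\<lambda>\<omega>. (W \<phi> \<omega>)\<^sup>2) \<and> expectation (\<lambda>\<omega>. (W \<phi> \<omega>)\<^sup>2) = L2_inner \<phi> \<phi>"
  proof (cases "L2_nrm \<phi> = 0")
    case True
    then have AE: "AE \<omega> in M. (W \<phi> \<omega>)\<^sup>2 = 0" using W_zero[OF assms] by simp
    have "integrable M (\<lambda>\<omega>. (W \<phi> \<omega>)\<^sup>2) \<longleftrightarrow> integrable M (\<lambda>\<omega>. 0 :: real)"
      using AE assms by (intro integrable_cong_AE) auto
    moreover have "expectation (\<lambda>\<omega>. (W \<phi> \<omega>)\<^sup>2) = expectation (\<lambda>\<omega>. 0 :: real)"
      using AE assms by (intro integral_cong_AE) auto
    ultimately show ?thesis using L2_nrm_squared[of \<phi>] True by simp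
  next
    case False
    then have pos: "L2_nrm \<phi> > 0" using L2_nrm_nonneg[of \<phi>] by linarith
    have [measurable]: "W \<phi> \<in> borel_measurable M" using assms by simp
    let ?N = "distr M borel (\<lambda>\<omega>. W \<phi> \<omega> / L2_nrm \<phi>)"
    have "integrable ?N (\<lambda>x. x ^ 2)" "(LINT x|?N. x ^ 2) = 1"
      unfolding W_normalized[OF assms pos]
      using integrable_std_normal_distribution_moment[of 2] std_normal_distribution_even_moments[of 1]
      by (auto simp: fact_numeral)
    then have "integrable M (\<lambda>\<omega>. (W \<phi> \<omega> / L2_nrm \<phi>)\<^sup>2)" "expectation (\<lambda>\<omega>. (W \<phi> \<omega> / L2_nrm \<phi>)\<^sup>2) = 1"
      by (auto simp: integrable_distr_eq integral_distr)
    moreover have "(\<lambda>\<omega>. (W \<phi> \<omega>)\<^sup>2) = (\<lambda>\<omega>. L2_inner \<phi> \<phi> * (W \<phi> \<omega> / L2_nrm \<phi>)\<^sup>2)"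
      using pos unfolding L2_nrm_squared[symmetric] by (auto simp: power_divide)
    ultimately show ?thesis by simp
  qed
  then show "integrable M (\<lambda>\<omega>. (W \<phi> \<omega>)\<^sup>2)" "expectation (\<lambda>\<omega>. (W \<phi> \<omega>)\<^sup>2) = L2_inner \<phi> \<phi>" by auto
qed

text \<open>Polarization: expand the second moment of \<open>W\<close> at the sum of the two
  functions, using that \<open>W\<close> is almost surely additive.\<close>

lemma W_covariance:
  assumes "\<phi> \<in> L2_unit" "\<psi> \<in> L2_unit"
  shows "integrable M (\<lambda>\<omega>. W \<phi> \<omega> * W \<psi> \<omega>)" "expectation (\<lambda>\<omega>. W \<phi> \<omega> * W \<psi> \<omega>) = L2_inner \<phi> \<psi>"
proof -
  have [measurable]: "W \<phi> \<in> borel_measurable M" "W \<psi> \<in> borel_measurable M" using assms by auto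
  let ?s = "\<lambda>t. 1 * \<phi> t + 1 * \<psi> t"
  have s: "?s \<in> L2_unit" using assms by (rule L2_unit_lincomb)
  have sq: "AE \<omega> in M. (W ?s \<omega>)\<^sup>2 = (W \<phi> \<omega>)\<^sup>2 + 2 * (W \<phi> \<omega> * W \<psi> \<omega>) + (W \<psi> \<omega>)\<^sup>2"
    using W_lincomb[OF assms, of 1 1] by eventually_elim (simp add: power2_eq_square algebra_simps)
  have AE: "AE \<omega> in M. W \<phi> \<omega> * W \<psi> \<omega> = ((W ?s \<omega>)\<^sup>2 - (W \<phi> \<omega>)\<^sup>2 - (W \<psi> \<omega>)\<^sup>2) / 2"
    using sq by eventually_elim simp
  have "integrable M (\<lambda>\<omega>. ((W ?s \<omega>)\<^sup>2 - (W \<phi> \<omega>)\<^sup>2 - (W \<psi> \<omega>)\<^sup>2) / 2)"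
    using W_second_moment[OF s] W_second_moment[OF assms(1)] W_second_moment[OF assms(2)] by auto
  then show "integrable M (\<lambda>\<omega>. W \<phi> \<omega> * W \<psi> \<omega>)"
    using AE W_measurable[OF s] by (subst integrable_cong_AE[OF _ _ AE]) auto
  have "expectation (\<lambda>\<omega>. W \<phi> \<omega> * W \<psi> \<omega>) = expectation (\<lambda>\<omega>. ((W ?s \<omega>)\<^sup>2 - (W \<phi> \<omega>)\<^sup>2 - (W \<psi> \<omega>)\<^sup>2) / 2)"
    using AE W_measurable[OF s] by (intro integral_cong_AE) auto
  also have "\<dots> = (L2_inner ?s ?s - L2_inner \<phi> \<phi> - L2_inner \<psi> \<psi>) / 2"
    using W_second_moment[OF s] W_second_moment[OF assms(1)] W_second_moment[OF assms(2)] by simp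
  also have "\<dots> = L2_inner \<phi> \<psi>"
    using L2_inner_lincomb_self[OF assms, of 1 1] by simp
  finally show "expectation (\<lambda>\<omega>. W \<phi> \<omega> * W \<psi> \<omega>) = L2_inner \<phi> \<psi>" .
qed

lemma W_sum:
  assumes "finite A" "\<And>i. i \<in> A \<Longrightarrow> e i \<in> L2_unit"
  shows "AE \<omega> in M. W (\<lambda>t. \<Sum>i\<in>A. s i * e i t) \<omega> = (\<Sum>i\<in>A. s i * W (e i) \<omega>)"
  using assms
proof (induction A rule: finite_induct)
  case empty
  have "L2_nrm (\<lambda>_. 0) = 0" by (simp add: L2_nrm_def)
  then show ?case using W_zero[OF L2_unit_zero] by simp
next
  case (insert x A)
  then have "(\<lambda>t. \<Sum>i\<in>A. s i * e i t) \<in> L2_unit"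
    by (intro L2_unit_sum L2_unit_cmult) auto
  from W_lincomb[OF _ this, of "e x" "s x" 1] insert.prems
  have "AE \<omega> in M. W (\<lambda>t. s x * e x t + 1 * (\<Sum>i\<in>A. s i * e i t)) \<omega>
      = s x * W (e x) \<omega> + 1 * W (\<lambda>t. \<Sum>i\<in>A. s i * e i t) \<omega>" by simp
  moreover have "AE \<omega> in M. W (\<lambda>t. \<Sum>i\<in>A. s i * e i t) \<omega> = (\<Sum>i\<in>A. s i * W (e i) \<omega>)"
    using insert by simp
  ultimately show ?case
    by eventually_elim (use insert.hyps in simp)
qed

section \<open>Gaussian coordinates of the noise in the Hartley basis\<close>

definition \<xi> :: "int \<Rightarrow> 'w \<Rightarrow> real" where
  "\<xi> j = W (cas j)"

lemma \<xi>_measurable [measurable]: "\<xi> j \<in> borel_measurable M"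
  by (simp add: \<xi>_def)

lemma L2_nrm_cas: "L2_nrm (cas j) = 1"
  by (simp add: L2_nrm_def L2_inner_cas)

lemma distr_\<xi>: "distr M borel (\<xi> j) = std_normal_distribution"
  using W_normalized[OF cas_L2_unit, of j] by (simp add: L2_nrm_cas \<xi>_def)

text \<open>A finite combination of the coordinates is almost surely a single
  \<open>W \<phi>\<close>, whose law is known; joint statements thus reduce to one-dimensional
  ones.\<close>

lemma linear_combination_\<xi>:
  assumes A: "finite A"
  obtains \<phi> where "\<phi> \<in> L2_unit" "L2_inner \<phi> \<phi> = (\<Sum>i\<in>A. (s i)\<^sup>2)"
    "AE \<omega> in M. W \<phi> \<omega> = (\<Sum>i\<in>A. s i * \<xi> i \<omega>)"
proof -
  define \<phi> where "\<phi> = (\<lambda>t. \<Sum>i\<in>A. s i * cas i t)"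
  have \<phi>: "\<phi> \<in> L2_unit" unfolding \<phi>_def by (intro L2_unit_sum L2_unit_cmult cas_L2_unit)
  have inner: "L2_inner \<phi> k = (\<Sum>i\<in>A. s i * L2_inner (cas i) k)" if "k \<in> L2_unit" for k
    unfolding \<phi>_def using that
    by (subst L2_inner_sum) (auto intro: L2_unit_cmult simp: L2_inner_cmult)
  have "L2_inner (cas i) \<phi> = s i" if "i \<in> A" for i
    unfolding L2_inner_commute[of _ \<phi>] using that A
    by (simp add: inner L2_inner_cas if_distrib cong: if_cong)
  then have "L2_inner \<phi> \<phi> = (\<Sum>i\<in>A. (s i)\<^sup>2)"
    by (simp add: inner[OF \<phi>] power2_eq_square)
  moreover have "AE \<omega> in M. W \<phi> \<omega> = (\<Sum>i\<in>A. s i * \<xi> i \<omega>)"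
    using W_sum[OF A, of cas s] by (simp add: \<phi>_def \<xi>_def)
  ultimately show ?thesis using that \<phi> by blast
qed

lemma second_moment_\<xi>_sum:
  assumes A: "finite A"
  shows "integrable M (\<lambda>\<omega>. (\<Sum>i\<in>A. s i * \<xi> i \<omega>)\<^sup>2)"
    and "expectation (\<lambda>\<omega>. (\<Sum>i\<in>A. s i * \<xi> i \<omega>)\<^sup>2) = (\<Sum>i\<in>A. (s i)\<^sup>2)"
proof -
  obtain \<phi> where \<phi>: "\<phi> \<in> L2_unit" "L2_inner \<phi> \<phi> = (\<Sum>i\<in>A. (s i)\<^sup>2)"
    "AE \<omega> in M. W \<phi> \<omega> = (\<Sum>i\<in>A. s i * \<xi> i \<omega>)"
    using linear_combination_\<xi>[OF A] by blast
  have AE: "AE \<omega> in M. (W \<phi> \<omega>)\<^sup>2 = (\<Sum>i\<in>A. s i * \<xi> i \<omega>)\<^sup>2"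
    using \<phi>(3) by eventually_elim simp
  have "integrable M (\<lambda>\<omega>. (W \<phi> \<omega>)\<^sup>2) \<longleftrightarrow> integrable M (\<lambda>\<omega>. (\<Sum>i\<in>A. s i * \<xi> i \<omega>)\<^sup>2)"
    using W_measurable[OF \<phi>(1)] by (intro integrable_cong_AE AE) auto
  then show "integrable M (\<lambda>\<omega>. (\<Sum>i\<in>A. s i * \<xi> i \<omega>)\<^sup>2)"
    using W_second_moment[OF \<phi>(1)] by simp
  have "expectation (\<lambda>\<omega>. (W \<phi> \<omega>)\<^sup>2) = expectation (\<lambda>\<omega>. (\<Sum>i\<in>A. s i * \<xi> i \<omega>)\<^sup>2)"
    using W_measurable[OF \<phi>(1)] by (intro integral_cong_AE AE) auto
  then show "expectation (\<lambda>\<omega>. (\<Sum>i\<in>A. s i * \<xi> i \<omega>)\<^sup>2) = (\<Sum>i\<in>A. (s i)\<^sup>2)"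
    using W_second_moment[OF \<phi>(1)] \<phi>(2) by simp
qed

text \<open>Orthonormality makes the variance of a combination the sum of the squared coefficients,
  so the Gaussian characteristic function factorizes.\<close>

lemma \<xi>_indep: "indep_vars (\<lambda>_. borel) \<xi> UNIV"
proof (rule indep_vars_of_char)
  fix B :: "int set" and s :: "int \<Rightarrow> real"
  assume B: "finite B"
  have *: "(CLINT \<omega>|M. iexp (\<Sum>i\<in>A. s i * \<xi> i \<omega>)) = exp (- (\<Sum>i\<in>A. (s i)\<^sup>2) / 2)" if A: "finite A" for A
  proof -
    obtain \<phi> where \<phi>: "\<phi> \<in> L2_unit" and norm: "L2_inner \<phi> \<phi> = (\<Sum>i\<in>A. (s i)\<^sup>2)"
      and "AE \<omega> in M. W \<phi> \<omega> = (\<Sum>i\<in>A. s i * \<xi> i \<omega>)"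
      using linear_combination_\<xi>[OF A] by blast
    then have "(CLINT \<omega>|M. iexp (\<Sum>i\<in>A. s i * \<xi> i \<omega>)) = (CLINT \<omega>|M. iexp (W \<phi> \<omega>))"
      using W_measurable[OF \<phi>] by (intro integral_cong_AE) auto
    then show ?thesis
      unfolding W_char[OF \<phi>] norm by simp
  qed
  have "(\<Prod>i\<in>B. (CLINT \<omega>|M. iexp (s i * \<xi> i \<omega>))) = (\<Prod>i\<in>B. complex_of_real (exp (- (s i)\<^sup>2 / 2)))"
    using *[of "{_}"] by (intro prod.cong) auto
  also have "\<dots> = exp (\<Sum>i\<in>B. - (s i)\<^sup>2 / 2)"
    using B by (simp add: exp_sum)
  also have "\<dots> = (CLINT \<omega>|M. iexp (\<Sum>i\<in>B. s i * \<xi> i \<omega>))"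
    unfolding *[OF B] by (simp add: sum_negf sum_divide_distrib)
  finally show "(CLINT \<omega>|M. iexp (\<Sum>i\<in>B. s i * \<xi> i \<omega>)) = (\<Prod>i\<in>B. (CLINT \<omega>|M. iexp (s i * \<xi> i \<omega>)))" by simp
qed simp

end

subsection \<open>Periodized kernels\<close>

text \<open>Evenness and unit integral are left to later locales, so that this one can also be
  instantiated with \<open>\<bar>K\<bar>\<close> in \<open>m2_le\<close>.\<close>

locale compact_kernel =
  fixes K :: "real \<Rightarrow> real" and B h :: real
  assumes K_measurable [measurable]: "K \<in> borel_measurable borel"
    and K_bound: "\<And>t. \<bar>K t\<bar> \<le> B"
    and K_support: "\<And>t. t \<notin> {-1..1} \<Longrightarrow> K t = 0"
    and h_pos: "h > 0"
begin

definition ker :: "real \<Rightarrow> real \<Rightarrow> real" where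
  "ker t = periodize (\<lambda>u. K ((t - u) / h))"

lemma B_nonneg: "B \<ge> 0"
  using K_bound[of 0] by linarith

lemma
  fixes g :: "real \<Rightarrow> real"
  assumes [measurable]: "g \<in> borel_measurable borel" and g: "\<And>v. \<bar>v\<bar> \<le> 1 \<Longrightarrow> \<bar>g v\<bar> \<le> C"
  shows K_integrable: "integrable lborel (\<lambda>v. K v * g v)"
    and integral_K_le: "\<bar>LINT v|lborel. K v * g v\<bar> \<le> 2 * B * C"
proof -
  have i: "integrable lborel (\<lambda>v::real. (B * C) * indicator {-1..1} v :: real)"
    by (intro integrable_mult_right integrable_real_indicator) auto
  have "\<bar>K v * g v\<bar> \<le> B * C" if "v \<in> {-1..1}" for v
    unfolding abs_mult using K_bound g[of v] B_nonneg that by (intro mult_mono) (auto simp: abs_le_iff)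
  then have le: "\<bar>K v * g v\<bar> \<le> (B * C) * indicator {-1..1} v" for v
    using K_support[of v] by (auto simp: indicator_def)
  show iK: "integrable lborel (\<lambda>v. K v * g v)"
    by (rule Bochner_Integration.integrable_bound[OF i]) (use le in \<open>auto intro: order.trans[OF _ abs_ge_self]\<close>)
  have "\<bar>LINT v|lborel. K v * g v\<bar> \<le> (LINT v|lborel. \<bar>K v * g v\<bar>)" by (rule integral_abs_bound)
  also have "\<dots> \<le> (LINT v::real|lborel. (B * C) * indicator {-1..1} v)"
    by (intro integral_mono i le integrable_abs iK)
  finally show "\<bar>LINT v|lborel. K v * g v\<bar> \<le> 2 * B * C" by simp
qed

text \<open>Any \<open>N\<close> large enough will do, so one finite range of shifts serves all
  \<open>t\<close> and \<open>u\<close> of a bounded region at once.\<close>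

lemma ker_eq_sum:
  assumes "\<bar>t - u\<bar> + h \<le> real N"
  shows "ker t u = (\<Sum>k\<in>{- int N..int N}. K ((t - (u + of_int k)) / h))"
proof -
  have 0: "K ((t - (u + of_int k)) / h) = 0" if "k \<notin> {- int N..int N}" for k :: int
  proof (rule K_support)
    have "\<bar>of_int k\<bar> > real N" using that by (auto simp: not_le)
    then have "\<bar>t - (u + of_int k)\<bar> > h" using assms by linarith
    then have "\<bar>(t - (u + of_int k)) / h\<bar> > 1" using h_pos by (simp add: abs_divide)
    then show "(t - (u + of_int k)) / h \<notin> {-1..1}" by auto
  qed
  have "ker t u = (\<Sum>\<^sub>\<infinity>k\<in>{- int N..int N}. K ((t - (u + of_int k)) / h))"
    unfolding ker_def periodize_def using 0 by (intro infsum_cong_neutral) auto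
  then show ?thesis by simp
qed

text \<open>At each point the truncated sums are eventually constant, so the periodization is a
  pointwise limit of jointly measurable functions.\<close>

lemma ker_measurable_pair [measurable]: "(\<lambda>(t, u). ker t u) \<in> borel_measurable (borel \<Otimes>\<^sub>M borel)"
proof (rule borel_measurable_LIMSEQ_metric)
  fix N
  show "(\<lambda>(t, u). \<Sum>k\<in>{- int N..int N}. K ((t - (u + of_int k)) / h)) \<in> borel_measurable (borel \<Otimes>\<^sub>M borel)"
    by measurable
next
  fix x :: "real \<times> real"
  obtain t u where x: "x = (t, u)" by fastforce
  obtain N0 where N0: "\<bar>t - u\<bar> + h \<le> real N0" using real_arch_simple by blast
  have "\<forall>\<^sub>F N in sequentially. (\<Sum>k\<in>{- int N..int N}. K ((t - (u + of_int k)) / h)) = ker t u"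
    unfolding eventually_sequentially
  proof (intro exI allI impI)
    fix N assume "N \<ge> N0"
    then have "\<bar>t - u\<bar> + h \<le> real N" using N0 by linarith
    then show "(\<Sum>k\<in>{- int N..int N}. K ((t - (u + of_int k)) / h)) = ker t u"
      by (simp add: ker_eq_sum)
  qed
  then show "(\<lambda>N. case x of (t, u) \<Rightarrow> \<Sum>k\<in>{- int N..int N}. K ((t - (u + of_int k)) / h))
      \<longlonglongrightarrow> (case x of (t, u) \<Rightarrow> ker t u)"
    unfolding x by (simp add: tendsto_eventually)
qed

lemma ker_measurable [measurable]: "ker t \<in> borel_measurable borel"
  using measurable_compose[OF measurable_Pair1'[of t borel borel] ker_measurable_pair] by simp

lemma abs_ker_le:
  assumes "t \<in> {0..1}" "u \<in> {0..1}"
  shows "\<bar>ker t u\<bar> \<le> (2 * h + 5) * B"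
proof -
  \<comment> \<open>On the unit square \<open>\<bar>t - u\<bar> \<le> 1\<close>, so
    \<open>N \<ge> h + 1\<close> suffices; \<open>N \<le> h + 2\<close> bounds the number
    \<open>2 * N + 1\<close> of terms by \<open>2 * h + 5\<close>.\<close>
  define N where "N = nat \<lceil>h\<rceil> + 1"
  have N: "h + 1 \<le> real N" "real N \<le> h + 2" using h_pos by (auto simp: N_def) linarith+
  have "\<bar>t - u\<bar> + h \<le> real N" using assms N by auto
  then have "\<bar>ker t u\<bar> \<le> (\<Sum>k\<in>{- int N..int N}. \<bar>K ((t - (u + of_int k)) / h)\<bar>)"
    by (simp only: ker_eq_sum) (rule sum_abs)
  also have "\<dots> \<le> (\<Sum>k\<in>{- int N..int N}. B)" by (intro sum_mono K_bound)
  also have "\<dots> = (2 * real N + 1) * B" by simp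
  also have "\<dots> \<le> (2 * h + 5) * B" using N B_nonneg by (intro mult_right_mono) auto
  finally show ?thesis .
qed

lemma ker_L2: "t \<in> {0..1} \<Longrightarrow> ker t \<in> L2_unit"
  by (rule bounded_L2_unit[of _ "(2 * h + 5) * B"]) (auto intro: abs_ker_le)

text \<open>Unfolding: the unit intervals shifted by integers tile the line, so a periodized
  function integrated over one period against the periodic \<open>g\<close> gives the integral of
  the original over the line; then substitute \<open>x = t - h * v\<close>.\<close>

lemma integral_ker:
  fixes g :: "real \<Rightarrow> real"
  assumes [measurable]: "g \<in> borel_measurable borel" and C: "\<And>v. \<bar>g v\<bar> \<le> C"
    and per: "\<And>v. g (v + 1) = g v"
  shows "L2_inner (ker t) g = h * (LINT v|lborel. K v * g (t - h * v))"
proof -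
  have per': "g (v + of_int k) = g v" for v and k :: int
  proof (induction k arbitrary: v rule: int_induct[where k = 0])
    case (step1 i)
    from step1(2)[of "v + 1"] per[of v] show ?case by (simp add: add_ac)
  next
    case (step2 i)
    from step2(2)[of "v - 1"] per[of "v - 1"] show ?case by (simp add: algebra_simps)
  qed simp
  define f where "f x = K ((t - x) / h) * g x" for x
  have [measurable]: "f \<in> borel_measurable borel" unfolding f_def by measurable
  obtain N where N: "\<bar>t\<bar> + 1 + h \<le> real N" using real_arch_simple by blast
  have "integrable lborel (\<lambda>v. K v * g (t + (- h) * v))"
    by (rule K_integrable[where C = C]) (auto simp: C)
  then have "integrable lborel (\<lambda>v. f (t + (- h) * v))"
    using h_pos by (simp add: f_def)
  then have f: "integrable lborel f"
    using h_pos by (subst (asm) lborel_integrable_real_affine_iff) auto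
  have fk: "integrable lborel (\<lambda>u. f (of_int k + 1 * u))" for k :: int
    by (rule lborel_integrable_real_affine[OF f]) simp
  have "L2_inner (ker t) g = (LINT u:{0..<1}|lborel. ker t u * g u)"
    by (simp add: L2_inner_def)
  also have "\<dots> = (LINT u:{0..<1}|lborel. (\<Sum>k\<in>{- int N..int N}. f (of_int k + 1 * u)))"
  proof (rule set_lebesgue_integral_cong)
    show "\<forall>u. u \<in> {0..<1} \<longrightarrow> ker t u * g u = (\<Sum>k\<in>{- int N..int N}. f (of_int k + 1 * u))"
    proof (intro allI impI)
      fix u :: real assume "u \<in> {0..<1}"
      then have "\<bar>t - u\<bar> + h \<le> real N" using N by auto
      then have "ker t u * g u = (\<Sum>k\<in>{- int N..int N}. K ((t - (u + of_int k)) / h) * g (u + of_int k))"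
        by (simp add: ker_eq_sum sum_distrib_right per')
      then show "ker t u * g u = (\<Sum>k\<in>{- int N..int N}. f (of_int k + 1 * u))"
        by (simp add: f_def add.commute)
    qed
  qed simp
  also have "\<dots> = (LINT u|lborel. (\<Sum>k\<in>{- int N..int N}. indicator {0..<1} u * f (of_int k + 1 * u)))"
    by (simp add: set_lebesgue_integral_def sum_distrib_left)
  also have "\<dots> = (\<Sum>k\<in>{- int N..int N}. (LINT u|lborel. indicator {0..<1} u * f (of_int k + 1 * u)))"
    using integrable_mult_indicator[OF _ fk, of "{0..<1}"] by (intro Bochner_Integration.integral_sum) auto
  also have "\<dots> = (\<Sum>k\<in>{- int N..int N}. (LINT x|lborel. indicator {of_int k..<of_int k + 1} x * f x))"
  proof (intro sum.cong refl)
    fix k :: int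
    have "(LINT x|lborel. indicator {of_int k..<of_int k + 1} x * f x) =
        \<bar>1\<bar> *\<^sub>R (LINT u|lborel. indicator {of_int k..<of_int k + 1} (of_int k + 1 * u) * f (of_int k + 1 * u))"
      by (rule lborel_integral_real_affine) simp
    also have "\<dots> = (LINT u|lborel. indicator {0..<1} u * f (of_int k + 1 * u))"
      by (simp add: indicator_def)
    finally show "(LINT u|lborel. indicator {0..<1} u * f (of_int k + 1 * u)) =
      (LINT x|lborel. indicator {of_int k..<of_int k + 1} x * f x)" by simp
  qed
  also have "\<dots> = (LINT x|lborel. (\<Sum>k\<in>{- int N..int N}. indicator {of_int k..<of_int k + 1} x * f x))"
    using integrable_mult_indicator[OF _ f] by (intro Bochner_Integration.integral_sum[symmetric]) auto
  also have "\<dots> = (LINT x|lborel. f x)"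
  proof (intro Bochner_Integration.integral_cong refl)
    fix x :: real
    have ind: "indicator {of_int k..<of_int k + 1} x = (if k = \<lfloor>x\<rfloor> then 1 else 0 :: real)" for k :: int
      by (auto simp: indicator_def) linarith+
    show "(\<Sum>k\<in>{- int N..int N}. indicator {of_int k..<of_int k + 1} x * f x) = f x"
    proof (cases "\<lfloor>x\<rfloor> \<in> {- int N..int N}")
      case True
      then show ?thesis by (simp add: ind if_distrib[of "\<lambda>y. y * _"] cong: if_cong)
    next
      case False
      then have "\<bar>x\<bar> \<ge> real N" by (auto simp: not_le) linarith+
      then have "\<bar>t - x\<bar> > h" using N by linarith
      then have "\<bar>(t - x) / h\<bar> > 1" using h_pos by (simp add: abs_divide)
      then have "K ((t - x) / h) = 0" by (intro K_support) auto
      then show ?thesis by (simp add: f_def)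
    qed
  qed
  also have "\<dots> = \<bar>- h\<bar> *\<^sub>R (LINT v|lborel. f (t + (- h) * v))"
    using h_pos by (intro lborel_integral_real_affine) simp
  also have "\<dots> = h * (LINT v|lborel. K v * g (t - h * v))"
    using h_pos by (simp add: f_def)
  finally show ?thesis .
qed

end

text \<open>For an even kernel this is its Fourier transform, which is then real.\<close>

definition kernel_ft :: "(real \<Rightarrow> real) \<Rightarrow> real \<Rightarrow> real" where
  "kernel_ft K x = (LINT v|lborel. K v * cos (2 * pi * x * v))"

locale even_kernel = compact_kernel +
  assumes K_even: "\<And>t. K (- t) = K t"
begin

abbreviation \<mu> :: "int \<Rightarrow> real" where "\<mu> j \<equiv> kernel_ft K (of_int j * h)"

lemma ker_commute: "ker t u = ker u t"
proof -
  have "ker t u = (\<Sum>\<^sub>\<infinity>k::int. K ((t - (u + of_int k)) / h))"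
    by (simp add: ker_def periodize_def)
  also have "\<dots> = (\<Sum>\<^sub>\<infinity>k::int. K ((t - (u + of_int (- k))) / h))"
    by (rule infsum_reindex_bij_betw[symmetric]) (auto intro!: bij_betwI[where g = uminus])
  also have "\<dots> = (\<Sum>\<^sub>\<infinity>k::int. K ((u - (t + of_int k)) / h))"
  proof (intro infsum_cong)
    fix k :: int
    have "(t - (u + of_int (- k))) / h = - ((u - (t + of_int k)) / h)"
      by (simp add: minus_divide_left algebra_simps)
    then show "K ((t - (u + of_int (- k))) / h) = K ((u - (t + of_int k)) / h)" by (simp only: K_even)
  qed
  finally show ?thesis by (simp add: ker_def periodize_def)
qed

lemma integral_K_sin: "(LINT v|lborel. K v * sin (a * v)) = 0"
proof -
  have "(LINT v|lborel. K v * sin (a * v)) = \<bar>- 1\<bar> *\<^sub>R (LINT v|lborel. K (0 + (-1) * v) * sin (a * (0 + (-1) * v)))"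
    by (rule lborel_integral_real_affine) simp
  then show ?thesis by (simp add: K_even)
qed

text \<open>In the addition formula for \<open>cas j (t - h * v)\<close> the sine terms in
  \<open>v\<close> integrate to 0 because \<open>K\<close> is even; what remains is a multiple of
  \<open>cas j t\<close>.\<close>

lemma ker_cas: "L2_inner (ker t) (cas j) = h * kernel_ft K (of_int j * h) * cas j t"
proof -
  define a where "a = 2 * pi * of_int j"
  have "L2_inner (ker t) (cas j) = h * (LINT v|lborel. K v * cas j (t - h * v))"
    by (rule integral_ker[where C = 2]) (auto simp: abs_cas_le cas_periodic)
  also have "(LINT v|lborel. K v * cas j (t - h * v)) =
      (LINT v|lborel. cas j t * (K v * cos (a * h * v)) + (sin (a * t) - cos (a * t)) * (K v * sin (a * h * v)))"
  proof (intro Bochner_Integration.integral_cong refl)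
    fix v
    have "2 * pi * of_int j * (t - h * v) = a * t - a * h * v" by (simp add: a_def algebra_simps)
    then have 1: "cas j (t - h * v) = cos (a * t - a * h * v) + sin (a * t - a * h * v)"
      by (simp only: cas_def)
    have 2: "cas j t = cos (a * t) + sin (a * t)" by (simp only: cas_def a_def)
    show "K v * cas j (t - h * v) =
        cas j t * (K v * cos (a * h * v)) + (sin (a * t) - cos (a * t)) * (K v * sin (a * h * v))"
      unfolding 1 2 cos_diff sin_diff by (simp add: algebra_simps)
  qed
  also have "\<dots> = cas j t * (LINT v|lborel. K v * cos (a * h * v))"
    using K_integrable[of "\<lambda>v. cos (a * h * v)" 1] K_integrable[of "\<lambda>v. sin (a * h * v)" 1]
    by (simp add: integral_K_sin)
  finally show ?thesis by (simp add: kernel_ft_def a_def mult_ac)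
qed

text \<open>The third claim is self-adjointness: Fubini's theorem and the symmetry of
  \<open>ker\<close> move the operator from \<open>\<phi>\<close> to its eigenfunction
  \<open>cas j\<close>. The first two claims make the integrals meaningful.\<close>

lemma ker_operator_cas:
  assumes \<phi>: "\<phi> \<in> L2_unit"
  shows "(\<lambda>t. L2_inner (ker t) \<phi>) \<in> borel_measurable borel"
    and "\<exists>C. \<forall>t\<in>{0..1}. \<bar>L2_inner (ker t) \<phi>\<bar> \<le> C"
    and "L2_inner (\<lambda>t. L2_inner (ker t) \<phi>) (cas j) = h * kernel_ft K (of_int j * h) * L2_inner \<phi> (cas j)"
proof -
  have [measurable]: "\<phi> \<in> borel_measurable borel" using \<phi> by (rule L2_unit_measurable)
  have id [measurable]: "(\<lambda>t. t) \<in> borel_measurable unit_lebesgue" by (rule measurable_ident_unit_lebesgue)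
  have i\<phi>: "integrable unit_lebesgue (\<lambda>u. \<bar>\<phi> u\<bar>)"
  proof -
    have "(\<lambda>_. 1) \<in> L2_unit" by (rule bounded_L2_unit[of _ 1]) auto
    from integrable_mult_L2[OF \<phi> this] show ?thesis by simp
  qed
  define C where "C = (2 * h + 5) * B"
  show "\<exists>C. \<forall>t\<in>{0..1}. \<bar>L2_inner (ker t) \<phi>\<bar> \<le> C"
  proof (intro exI ballI)
    fix t :: real assume t: "t \<in> {0..1}"
    have "\<bar>L2_inner (ker t) \<phi>\<bar> \<le> (LINT u|unit_lebesgue. \<bar>ker t u * \<phi> u\<bar>)"
      unfolding L2_inner_eq by (rule integral_abs_bound)
    also have "\<dots> \<le> (LINT u|unit_lebesgue. C * \<bar>\<phi> u\<bar>)"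
    proof (rule integral_mono)
      show "integrable unit_lebesgue (\<lambda>u. \<bar>ker t u * \<phi> u\<bar>)"
        by (intro integrable_abs integrable_mult_L2 ker_L2 t \<phi>)
      fix u assume "u \<in> space unit_lebesgue"
      then show "\<bar>ker t u * \<phi> u\<bar> \<le> C * \<bar>\<phi> u\<bar>"
        unfolding abs_mult C_def using t by (intro mult_right_mono abs_ker_le) auto
    qed (use i\<phi> in simp)
    finally show "\<bar>L2_inner (ker t) \<phi>\<bar> \<le> (LINT u|unit_lebesgue. C * \<bar>\<phi> u\<bar>)" .
  qed
  have kid: "(\<lambda>(t, u). ker t u * \<phi> u) \<in> borel_measurable (borel \<Otimes>\<^sub>M unit_lebesgue)"
  proof -
    have "(\<lambda>x. (fst x, snd x)) \<in> borel \<Otimes>\<^sub>M unit_lebesgue \<rightarrow>\<^sub>M (borel \<Otimes>\<^sub>M borel :: (real \<times> real) measure)"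
      using measurable_compose[OF measurable_snd id] by (intro measurable_Pair) auto
    then have "(\<lambda>x. (\<lambda>(t, u). ker t u * \<phi> u) (fst x, snd x)) \<in> borel_measurable (borel \<Otimes>\<^sub>M unit_lebesgue)"
      by (rule measurable_compose) measurable
    then show ?thesis by (simp add: case_prod_beta)
  qed
  show "(\<lambda>t. L2_inner (ker t) \<phi>) \<in> borel_measurable borel"
    unfolding L2_inner_eq using kid by (rule unit.borel_measurable_lebesgue_integral)
  have kid2: "(\<lambda>(t, u). ker t u * \<phi> u * cas j t) \<in> borel_measurable (unit_lebesgue \<Otimes>\<^sub>M unit_lebesgue)"
  proof -
    have "(\<lambda>x. (fst x, snd x)) \<in> unit_lebesgue \<Otimes>\<^sub>M unit_lebesgue \<rightarrow>\<^sub>M (borel \<Otimes>\<^sub>M borel :: (real \<times> real) measure)"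
      using measurable_compose[OF measurable_snd id] measurable_compose[OF measurable_fst id] by (intro measurable_Pair) auto
    then have "(\<lambda>x. (\<lambda>(t, u). ker t u * \<phi> u * cas j t) (fst x, snd x)) \<in> borel_measurable (unit_lebesgue \<Otimes>\<^sub>M unit_lebesgue)"
      by (rule measurable_compose) measurable
    then show ?thesis by (simp add: case_prod_beta)
  qed
  interpret UU: pair_prob_space unit_lebesgue unit_lebesgue ..
  have int: "integrable (unit_lebesgue \<Otimes>\<^sub>M unit_lebesgue) (\<lambda>(t, u). ker t u * \<phi> u * cas j t)"
  proof (rule Bochner_Integration.integrable_bound)
    show "integrable (unit_lebesgue \<Otimes>\<^sub>M unit_lebesgue) (\<lambda>(t, u). 2 * C * \<bar>\<phi> u\<bar>)"
    proof (rule UU.Fubini_integrable)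
      have "(\<lambda>x. 2 * C * \<bar>\<phi> (snd x)\<bar>) \<in> borel_measurable (unit_lebesgue \<Otimes>\<^sub>M unit_lebesgue)"
        using measurable_compose[OF measurable_snd L2_unit_measurable_unit[OF \<phi>]] by measurable
      then show "(\<lambda>(t, u). 2 * C * \<bar>\<phi> u\<bar>) \<in> borel_measurable (unit_lebesgue \<Otimes>\<^sub>M unit_lebesgue)"
        by (simp add: case_prod_beta)
    qed (use i\<phi> in auto)
    show "AE x in unit_lebesgue \<Otimes>\<^sub>M unit_lebesgue.
      norm (case x of (t, u) \<Rightarrow> ker t u * \<phi> u * cas j t) \<le> norm (case x of (t, u) \<Rightarrow> 2 * C * \<bar>\<phi> u\<bar>)"
    proof (intro AE_I2)
      fix x assume "x \<in> space (unit_lebesgue \<Otimes>\<^sub>M unit_lebesgue)"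
      then obtain t u where x: "x = (t, u)" "t \<in> {0..1}" "u \<in> {0..1}"
        by (auto simp: space_pair_measure)
      have "\<bar>ker t u\<bar> * \<bar>\<phi> u\<bar> * \<bar>cas j t\<bar> \<le> C * \<bar>\<phi> u\<bar> * 2"
        using abs_ker_le[OF x(2,3)] abs_cas_le[of j t] by (intro mult_mono) (auto simp: C_def intro: order.trans[OF abs_ge_zero])
      also have "\<dots> \<le> \<bar>2 * C * \<bar>\<phi> u\<bar>\<bar>" by (simp add: mult_ac)
      finally show "norm (case x of (t, u) \<Rightarrow> ker t u * \<phi> u * cas j t) \<le> norm (case x of (t, u) \<Rightarrow> 2 * C * \<bar>\<phi> u\<bar>)"
        by (simp add: x abs_mult)
    qed
  qed (rule kid2)
  have "L2_inner (\<lambda>t. L2_inner (ker t) \<phi>) (cas j) =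
      (LINT t|unit_lebesgue. (LINT u|unit_lebesgue. ker t u * \<phi> u * cas j t))"
    by (simp add: L2_inner_eq)
  also have "\<dots> = (LINT u|unit_lebesgue. (LINT t|unit_lebesgue. ker t u * \<phi> u * cas j t))"
    using UU.Fubini_integral[OF int] by simp
  also have "\<dots> = (LINT u|unit_lebesgue. \<phi> u * L2_inner (ker u) (cas j))"
    unfolding L2_inner_eq by (simp add: ker_commute[of _ "_ :: real"] mult_ac cong: Bochner_Integration.integral_cong) 
  also have "\<dots> = (LINT u|unit_lebesgue. h * kernel_ft K (of_int j * h) * (\<phi> u * cas j u))"
    by (simp add: ker_cas mult_ac)
  also have "\<dots> = h * kernel_ft K (of_int j * h) * L2_inner \<phi> (cas j)"
    by (simp add: L2_inner_eq)
  finally show "L2_inner (\<lambda>t. L2_inner (ker t) \<phi>) (cas j) = h * kernel_ft K (of_int j * h) * L2_inner \<phi> (cas j)" .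
qed

end

subsection \<open>Fourier coefficients of the kernel estimator\<close>

locale kernel_observation = white_noise_space M W + even_kernel K B h
  for M :: "'w measure" and W :: "(real \<Rightarrow> real) \<Rightarrow> 'w \<Rightarrow> real" and K B h +
  fixes \<sigma> :: real and n :: nat and f :: "real \<Rightarrow> real" and F :: "real \<Rightarrow> 'w \<Rightarrow> real"
  assumes f_L2: "f \<in> L2_unit"
    and estimator: "kernel_estimator M (observation W \<sigma> n f) K h F"
begin

definition \<tau> :: real where "\<tau> = \<sigma> / sqrt (real n)"

text \<open>The noise part of the estimator; the subtracted smoothed signal is
  deterministic.\<close>

definition D :: "real \<Rightarrow> 'w \<Rightarrow> real" where
  "D t \<omega> = F t \<omega> - 1 / h * L2_inner (ker t) f"

sublocale UM: pair_prob_space unit_lebesgue M ..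

lemma F_measurable [measurable]: "(\<lambda>(t, \<omega>). F t \<omega>) \<in> borel_measurable (borel \<Otimes>\<^sub>M M)"
  using estimator by (simp add: kernel_estimator_def)

lemma ker_f_measurable [measurable]: "(\<lambda>t. L2_inner (ker t) f) \<in> borel_measurable borel"
  by (rule ker_operator_cas(1)[OF f_L2])

lemma D_measurable_borel [measurable]: "(\<lambda>(t, \<omega>). D t \<omega>) \<in> borel_measurable (borel \<Otimes>\<^sub>M M)"
  unfolding D_def by measurable

lemma measurable_pair_unit:
  assumes "(\<lambda>(t, \<omega>). g t \<omega>) \<in> borel_measurable (borel \<Otimes>\<^sub>M M)"
  shows "(\<lambda>(t, \<omega>). g t \<omega>) \<in> borel_measurable (unit_lebesgue \<Otimes>\<^sub>M M)"
proof -
  have "(\<lambda>x. (fst x, snd x)) \<in> unit_lebesgue \<Otimes>\<^sub>M M \<rightarrow>\<^sub>M borel \<Otimes>\<^sub>M M"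
    using measurable_compose[OF measurable_fst measurable_ident_unit_lebesgue] by (intro measurable_Pair) auto
  then have "(\<lambda>x. (\<lambda>(t, \<omega>). g t \<omega>) (fst x, snd x)) \<in> borel_measurable (unit_lebesgue \<Otimes>\<^sub>M M)"
    using assms by (rule measurable_compose)
  then show ?thesis by (simp add: case_prod_beta)
qed

lemma integral_unit_measurable:
  fixes g :: "real \<Rightarrow> 'w \<Rightarrow> real"
  assumes "(\<lambda>(t, \<omega>). g t \<omega>) \<in> borel_measurable (unit_lebesgue \<Otimes>\<^sub>M M)"
  shows "(\<lambda>\<omega>. LINT t|unit_lebesgue. g t \<omega>) \<in> borel_measurable M"
  using measurable_pair_swap[OF assms] by (intro unit.borel_measurable_lebesgue_integral) simp

lemma D_AE: "t \<in> {0<..<1} \<Longrightarrow> AE \<omega> in M. D t \<omega> = \<tau> / h * W (ker t) \<omega>"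
proof -
  assume t: "t \<in> {0<..<1}"
  then have "AE \<omega> in M. F t \<omega> = 1 / h * observation W \<sigma> n f (ker t) \<omega>"
    using estimator by (simp add: kernel_estimator_def ker_def)
  then show ?thesis
    by eventually_elim
       (simp add: D_def observation_def \<tau>_def L2_inner_commute[of f] add_divide_distrib mult_ac)
qed

lemma D_section [measurable]: "D t \<in> borel_measurable M"
  using measurable_compose[OF measurable_Pair1'[of t borel M] D_measurable_borel] by simp

text \<open>\<open>kernel_estimator\<close> prescribes the estimator on the open interval, while
  \<open>unit_lebesgue\<close> also contains the point 0.\<close>

lemma AE_unit_interior: "AE t in unit_lebesgue. t \<in> {0<..<1}"
proof (rule AE_I')
  show "{0} \<in> null_sets unit_lebesgue"
    by (simp add: unit_lebesgue_def null_sets_restrict_space countable_imp_null_set_lborel)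
qed auto

lemma D_second_moment:
  assumes t: "t \<in> {0<..<1}"
  shows "integrable M (\<lambda>\<omega>. (D t \<omega>)\<^sup>2)" "expectation (\<lambda>\<omega>. (D t \<omega>)\<^sup>2) = (\<tau> / h)\<^sup>2 * L2_inner (ker t) (ker t)"
proof -
  have L: "ker t \<in> L2_unit" using t by (intro ker_L2) auto
  have [measurable]: "W (ker t) \<in> borel_measurable M" using L by simp
  have AE: "AE \<omega> in M. (D t \<omega>)\<^sup>2 = (\<tau> / h)\<^sup>2 * (W (ker t) \<omega>)\<^sup>2"
    using D_AE[OF t] by eventually_elim (simp add: power_mult_distrib power_divide)
  have "integrable M (\<lambda>\<omega>. (D t \<omega>)\<^sup>2) \<longleftrightarrow> integrable M (\<lambda>\<omega>. (\<tau> / h)\<^sup>2 * (W (ker t) \<omega>)\<^sup>2)"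
    by (intro integrable_cong_AE AE) auto
  then show "integrable M (\<lambda>\<omega>. (D t \<omega>)\<^sup>2)" using W_second_moment[OF L] by simp
  have "expectation (\<lambda>\<omega>. (D t \<omega>)\<^sup>2) = expectation (\<lambda>\<omega>. (\<tau> / h)\<^sup>2 * (W (ker t) \<omega>)\<^sup>2)"
    by (intro integral_cong_AE AE) auto
  then show "expectation (\<lambda>\<omega>. (D t \<omega>)\<^sup>2) = (\<tau> / h)\<^sup>2 * L2_inner (ker t) (ker t)"
    using W_second_moment[OF L] by simp
qed

text \<open>The second moment of \<open>D t\<close> is bounded uniformly in \<open>t\<close> by the
  bound on \<open>ker\<close>. This joint integrability makes almost all paths square integrable and
  licenses the later exchanges of integrals.\<close>

lemma D_square_integrable: "integrable (unit_lebesgue \<Otimes>\<^sub>M M) (\<lambda>(t, \<omega>). (D t \<omega>)\<^sup>2)"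
proof (rule UM.Fubini_integrable)
  show m: "(\<lambda>(t, \<omega>). (D t \<omega>)\<^sup>2) \<in> borel_measurable (unit_lebesgue \<Otimes>\<^sub>M M)"
    by (rule measurable_pair_unit) measurable
  show "AE t in unit_lebesgue. integrable M (\<lambda>\<omega>. case (t, \<omega>) of (t, \<omega>) \<Rightarrow> (D t \<omega>)\<^sup>2)"
    using AE_unit_interior by eventually_elim (simp add: D_second_moment)
  define C where "C = (2 * h + 5) * B"
  show "integrable unit_lebesgue (\<lambda>t. LINT \<omega>|M. norm (case (t, \<omega>) of (t, \<omega>) \<Rightarrow> (D t \<omega>)\<^sup>2))"
  proof (rule unit.integrable_const_bound)
    show "AE t in unit_lebesgue. norm (LINT \<omega>|M. norm (case (t, \<omega>) of (t, \<omega>) \<Rightarrow> (D t \<omega>)\<^sup>2)) \<le> (\<tau> / h)\<^sup>2 * C\<^sup>2"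
      using AE_unit_interior
    proof eventually_elim
      case (elim t)
      have "L2_inner (ker t) (ker t) \<le> (LINT u|unit_lebesgue. C\<^sup>2)"
        unfolding L2_inner_eq
      proof (rule integral_mono)
        show "integrable unit_lebesgue (\<lambda>u. ker t u * ker t u)"
          using elim by (intro integrable_mult_L2 ker_L2) auto
        fix u assume "u \<in> space unit_lebesgue"
        then have "\<bar>ker t u\<bar> \<le> C" using elim unfolding C_def by (intro abs_ker_le) auto
        then show "ker t u * ker t u \<le> C\<^sup>2"
          using power_mono[of "\<bar>ker t u\<bar>" C 2] by (simp add: power2_eq_square)
      qed simp
      also have "\<dots> = C\<^sup>2" using unit.prob_space by simp
      finally have "(\<tau> / h)\<^sup>2 * L2_inner (ker t) (ker t) \<le> (\<tau> / h)\<^sup>2 * C\<^sup>2"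
        by (intro mult_left_mono) auto
      then show ?case using elim by (simp add: D_second_moment)
    qed
    show "(\<lambda>t. LINT \<omega>|M. norm (case (t, \<omega>) of (t, \<omega>) \<Rightarrow> (D t \<omega>)\<^sup>2)) \<in> borel_measurable unit_lebesgue"
      by (rule borel_measurable_lebesgue_integral) (use m in \<open>simp add: case_prod_beta\<close>)
  qed
qed

lemma D_L2: "AE \<omega> in M. (\<lambda>t. D t \<omega>) \<in> L2_unit"
proof -
  have "AE \<omega> in M. integrable unit_lebesgue (\<lambda>t. (D t \<omega>)\<^sup>2)"
    using UM.AE_integrable_snd[OF D_square_integrable] .
  moreover have "AE \<omega> in M. (\<lambda>t. D t \<omega>) \<in> borel_measurable borel"
  proof (intro AE_I2)
    fix \<omega> assume "\<omega> \<in> space M"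
    then show "(\<lambda>t. D t \<omega>) \<in> borel_measurable borel"
      using measurable_compose[OF measurable_Pair2'[of \<omega> M borel] D_measurable_borel] by simp
  qed
  ultimately show ?thesis by eventually_elim (simp add: L2_unit_iff)
qed

definition X :: "int \<Rightarrow> 'w \<Rightarrow> real" where
  "X j \<omega> = L2_inner (\<lambda>t. D t \<omega>) (cas j)"

lemma D_cas_measurable: "(\<lambda>(t, \<omega>). D t \<omega> * cas j t) \<in> borel_measurable (unit_lebesgue \<Otimes>\<^sub>M M)"
  by (rule measurable_pair_unit) measurable

lemma X_measurable [measurable]: "X j \<in> borel_measurable M"
  unfolding X_def L2_inner_eq by (rule integral_unit_measurable[OF D_cas_measurable])

lemma X_square_integrable: "integrable M (\<lambda>\<omega>. (X j \<omega>)\<^sup>2)"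
proof (rule Bochner_Integration.integrable_bound)
  show "integrable M (\<lambda>\<omega>. LINT t|unit_lebesgue. (D t \<omega>)\<^sup>2)"
    using UM.integrable_snd[OF D_square_integrable] .
  show "AE \<omega> in M. norm ((X j \<omega>)\<^sup>2) \<le> norm (LINT t|unit_lebesgue. (D t \<omega>)\<^sup>2)"
    using D_L2
  proof eventually_elim
    case (elim \<omega>)
    from bessel[OF elim, of "{j}"] show ?case
      by (simp add: X_def L2_inner_eq power2_eq_square)
  qed
qed simp

text \<open>Reduces moments of the path functional \<open>X j\<close> to moments at fixed
  \<open>t\<close>, the only place where \<open>D\<close> is tied to \<open>W\<close>. It is applied
  to \<open>Z = W \<phi>\<close> and to the difference formed in \<open>X_eq\<close>.\<close>

lemma expectation_X_mult:
  assumes [measurable]: "Z \<in> borel_measurable M" and Z: "integrable M (\<lambda>\<omega>. (Z \<omega>)\<^sup>2)"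
  shows "integrable M (\<lambda>\<omega>. X j \<omega> * Z \<omega>)"
    and "expectation (\<lambda>\<omega>. X j \<omega> * Z \<omega>) = (LINT t|unit_lebesgue. cas j t * expectation (\<lambda>\<omega>. D t \<omega> * Z \<omega>))"
proof -
  have int: "integrable (unit_lebesgue \<Otimes>\<^sub>M M) (\<lambda>(t, \<omega>). cas j t * D t \<omega> * Z \<omega>)"
  proof (rule Bochner_Integration.integrable_bound)
    have "integrable (unit_lebesgue \<Otimes>\<^sub>M M) (\<lambda>(t, \<omega>). (Z \<omega>)\<^sup>2)"
    proof (rule UM.Fubini_integrable)
      show "(\<lambda>(t, \<omega>). (Z \<omega>)\<^sup>2) \<in> borel_measurable (unit_lebesgue \<Otimes>\<^sub>M M)" by measurable
    qed (use Z in auto)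
    then show "integrable (unit_lebesgue \<Otimes>\<^sub>M M) (\<lambda>x. (case x of (t, \<omega>) \<Rightarrow> (D t \<omega>)\<^sup>2) + (case x of (t, \<omega>) \<Rightarrow> (Z \<omega>)\<^sup>2))"
      using D_square_integrable by (intro Bochner_Integration.integrable_add)
    show "(\<lambda>(t, \<omega>). cas j t * D t \<omega> * Z \<omega>) \<in> borel_measurable (unit_lebesgue \<Otimes>\<^sub>M M)"
      by (rule measurable_pair_unit) measurable
    show "AE x in unit_lebesgue \<Otimes>\<^sub>M M. norm (case x of (t, \<omega>) \<Rightarrow> cas j t * D t \<omega> * Z \<omega>) \<le>
      norm ((case x of (t, \<omega>) \<Rightarrow> (D t \<omega>)\<^sup>2) + (case x of (t, \<omega>) \<Rightarrow> (Z \<omega>)\<^sup>2))"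
    proof (intro AE_I2)
      fix x :: "real \<times> 'w"
      obtain t \<omega> where x: "x = (t, \<omega>)" by fastforce
      have "\<bar>cas j t * D t \<omega> * Z \<omega>\<bar> \<le> 2 * (\<bar>D t \<omega>\<bar> * \<bar>Z \<omega>\<bar>)"
        unfolding abs_mult mult.assoc using abs_cas_le[of j t] by (intro mult_right_mono) auto
      also have "\<dots> \<le> (D t \<omega>)\<^sup>2 + (Z \<omega>)\<^sup>2"
        using sum_squares_bound[of "\<bar>D t \<omega>\<bar>" "\<bar>Z \<omega>\<bar>"] by (simp add: mult.assoc)
      finally show "norm (case x of (t, \<omega>) \<Rightarrow> cas j t * D t \<omega> * Z \<omega>) \<le>
          norm ((case x of (t, \<omega>) \<Rightarrow> (D t \<omega>)\<^sup>2) + (case x of (t, \<omega>) \<Rightarrow> (Z \<omega>)\<^sup>2))"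
        by (simp add: x)
    qed
  qed
  have eq: "(LINT t|unit_lebesgue. cas j t * D t \<omega> * Z \<omega>) = X j \<omega> * Z \<omega>" for \<omega>
    by (simp add: X_def L2_inner_eq mult.commute[of "cas j _"])
  show "integrable M (\<lambda>\<omega>. X j \<omega> * Z \<omega>)"
    using UM.integrable_snd[OF int] unfolding eq .
  have "expectation (\<lambda>\<omega>. X j \<omega> * Z \<omega>) = (LINT \<omega>|M. LINT t|unit_lebesgue. cas j t * D t \<omega> * Z \<omega>)"
    by (simp only: eq)
  also have "\<dots> = (LINT t|unit_lebesgue. LINT \<omega>|M. cas j t * D t \<omega> * Z \<omega>)"
    by (rule UM.Fubini_integral[OF int])
  finally show "expectation (\<lambda>\<omega>. X j \<omega> * Z \<omega>) = (LINT t|unit_lebesgue. cas j t * expectation (\<lambda>\<omega>. D t \<omega> * Z \<omega>))"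
    by (simp add: mult.assoc)
qed

lemma expectation_D_mult:
  assumes t: "t \<in> {0<..<1}" and [measurable]: "Z \<in> borel_measurable M"
  shows "expectation (\<lambda>\<omega>. D t \<omega> * Z \<omega>) = \<tau> / h * expectation (\<lambda>\<omega>. W (ker t) \<omega> * Z \<omega>)"
proof -
  have L: "ker t \<in> L2_unit" using t by (intro ker_L2) auto
  have [measurable]: "W (ker t) \<in> borel_measurable M" using L by simp
  have "expectation (\<lambda>\<omega>. D t \<omega> * Z \<omega>) = expectation (\<lambda>\<omega>. \<tau> / h * (W (ker t) \<omega> * Z \<omega>))"
    by (intro integral_cong_AE) (use D_AE[OF t] in \<open>auto elim!: eventually_mono\<close>)
  then show ?thesis by simp
qed

text \<open>The difference \<open>Z\<close> of both sides is orthogonal to all \<open>W \<phi>\<close>, hence to all \<open>D t\<close> and, by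
  Fubini's theorem, to \<open>X j\<close> and to itself.\<close>

lemma X_eq: "AE \<omega> in M. X j \<omega> = \<tau> * \<mu> j * \<xi> j \<omega>"
proof -
  have \<xi>2: "integrable M (\<lambda>\<omega>. (\<xi> j \<omega>)\<^sup>2)" unfolding \<xi>_def by (rule W_second_moment) simp
  define Z where "Z \<omega> = X j \<omega> - \<tau> * \<mu> j * \<xi> j \<omega>" for \<omega>
  have [measurable]: "Z \<in> borel_measurable M" unfolding Z_def by measurable
  have Z2: "integrable M (\<lambda>\<omega>. (Z \<omega>)\<^sup>2)"
  proof -
    have "integrable M (\<lambda>\<omega>. (X j \<omega>)\<^sup>2 - 2 * \<tau> * \<mu> j * (X j \<omega> * \<xi> j \<omega>) + (\<tau> * \<mu> j)\<^sup>2 * (\<xi> j \<omega>)\<^sup>2)"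
      using X_square_integrable \<xi>2 integrable_mult_of_squares[OF X_measurable \<xi>_measurable X_square_integrable \<xi>2] by simp
    then show ?thesis by (simp add: Z_def power2_eq_square algebra_simps)
  qed
  have orth: "expectation (\<lambda>\<omega>. W \<phi> \<omega> * Z \<omega>) = 0" if \<phi>: "\<phi> \<in> L2_unit" for \<phi>
  proof -
    have [measurable]: "W \<phi> \<in> borel_measurable M" using \<phi> by simp
    have "expectation (\<lambda>\<omega>. X j \<omega> * W \<phi> \<omega>) = (LINT t|unit_lebesgue. cas j t * expectation (\<lambda>\<omega>. D t \<omega> * W \<phi> \<omega>))"
      using W_second_moment[OF \<phi>] by (intro expectation_X_mult) auto
    also have "\<dots> = (LINT t|unit_lebesgue. \<tau> / h * (L2_inner (ker t) \<phi> * cas j t))"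
    proof (rule integral_cong_AE)
      show "AE t in unit_lebesgue. cas j t * expectation (\<lambda>\<omega>. D t \<omega> * W \<phi> \<omega>) = \<tau> / h * (L2_inner (ker t) \<phi> * cas j t)"
        using AE_unit_interior
      proof eventually_elim
        case (elim t)
        then have "ker t \<in> L2_unit" by (intro ker_L2) auto
        with elim \<phi> show ?case by (simp add: expectation_D_mult W_covariance)
      qed
      show "(\<lambda>t. \<tau> / h * (L2_inner (ker t) \<phi> * cas j t)) \<in> borel_measurable unit_lebesgue"
        using ker_operator_cas(1)[OF \<phi>]
        by (intro measurable_unit_lebesgue borel_measurable_times borel_measurable_const cas_measurable)
      have "(\<lambda>(t, \<omega>). D t \<omega> * W \<phi> \<omega>) \<in> borel_measurable (unit_lebesgue \<Otimes>\<^sub>M M)"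
        by (rule measurable_pair_unit) measurable
      then have "(\<lambda>t. expectation (\<lambda>\<omega>. D t \<omega> * W \<phi> \<omega>)) \<in> borel_measurable unit_lebesgue"
        by (rule borel_measurable_lebesgue_integral)
      then show "(\<lambda>t. cas j t * expectation (\<lambda>\<omega>. D t \<omega> * W \<phi> \<omega>)) \<in> borel_measurable unit_lebesgue"
        by (intro borel_measurable_times measurable_unit_lebesgue) auto
    qed
    also have "\<dots> = \<tau> / h * L2_inner (\<lambda>t. L2_inner (ker t) \<phi>) (cas j)"
      by (simp add: L2_inner_eq)
    also have "\<dots> = \<tau> * \<mu> j * L2_inner \<phi> (cas j)"
      using h_pos by (simp add: ker_operator_cas[OF \<phi>])
    finally have 1: "expectation (\<lambda>\<omega>. X j \<omega> * W \<phi> \<omega>) = \<tau> * \<mu> j * L2_inner \<phi> (cas j)" .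
    have 2: "integrable M (\<lambda>\<omega>. X j \<omega> * W \<phi> \<omega>)"
      using W_second_moment[OF \<phi>] by (intro expectation_X_mult) auto
    have "expectation (\<lambda>\<omega>. W \<phi> \<omega> * Z \<omega>) =
        expectation (\<lambda>\<omega>. X j \<omega> * W \<phi> \<omega> - \<tau> * \<mu> j * (W \<phi> \<omega> * W (cas j) \<omega>))"
      by (simp add: Z_def \<xi>_def algebra_simps)
    then show ?thesis
      using 1 2 W_covariance[OF \<phi> cas_L2_unit] by simp
  qed
  have "expectation (\<lambda>\<omega>. X j \<omega> * Z \<omega>) = (LINT t|unit_lebesgue. cas j t * expectation (\<lambda>\<omega>. D t \<omega> * Z \<omega>))"
    by (intro expectation_X_mult Z2) simp
  also have "\<dots> = (LINT t|unit_lebesgue. 0)"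
  proof (rule integral_cong_AE)
    show "AE t in unit_lebesgue. cas j t * expectation (\<lambda>\<omega>. D t \<omega> * Z \<omega>) = 0"
      using AE_unit_interior
    proof eventually_elim
      case (elim t)
      then have "ker t \<in> L2_unit" by (intro ker_L2) auto
      with elim show ?case by (simp add: expectation_D_mult orth)
    qed
    have "(\<lambda>(t, \<omega>). D t \<omega> * Z \<omega>) \<in> borel_measurable (unit_lebesgue \<Otimes>\<^sub>M M)"
      by (rule measurable_pair_unit) measurable
    then have "(\<lambda>t. expectation (\<lambda>\<omega>. D t \<omega> * Z \<omega>)) \<in> borel_measurable unit_lebesgue"
      by (rule borel_measurable_lebesgue_integral)
    then show "(\<lambda>t. cas j t * expectation (\<lambda>\<omega>. D t \<omega> * Z \<omega>)) \<in> borel_measurable unit_lebesgue"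
      by (intro borel_measurable_times measurable_unit_lebesgue) auto
  qed simp
  finally have XZ: "expectation (\<lambda>\<omega>. X j \<omega> * Z \<omega>) = 0" by simp
  have iXZ: "integrable M (\<lambda>\<omega>. X j \<omega> * Z \<omega>)"
    by (intro expectation_X_mult Z2) simp
  have i\<xi>Z: "integrable M (\<lambda>\<omega>. \<xi> j \<omega> * Z \<omega>)"
    by (intro integrable_mult_of_squares \<xi>2 Z2) simp_all
  have \<xi>Z: "expectation (\<lambda>\<omega>. \<xi> j \<omega> * Z \<omega>) = 0"
    unfolding \<xi>_def by (rule orth) simp
  have "expectation (\<lambda>\<omega>. (Z \<omega>)\<^sup>2) = expectation (\<lambda>\<omega>. X j \<omega> * Z \<omega> - \<tau> * \<mu> j * (\<xi> j \<omega> * Z \<omega>))"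
    by (intro Bochner_Integration.integral_cong refl) (simp add: Z_def power2_eq_square algebra_simps)
  also have "\<dots> = 0" using iXZ i\<xi>Z XZ \<xi>Z by simp
  finally have "AE \<omega> in M. (Z \<omega>)\<^sup>2 = 0"
    using integral_nonneg_eq_0_iff_AE[OF Z2] by simp
  then show ?thesis by eventually_elim (simp add: Z_def)
qed

text \<open>The coefficients are indexed by a countable set, so one null set serves all of them,
  unlike the null sets attached to the times \<open>t\<close>.\<close>

theorem estimator_coefficients:
  "AE \<omega> in M. (\<lambda>t. F t \<omega>) \<in> L2_unit \<and>
    (\<forall>j. L2_inner (\<lambda>t. F t \<omega>) (cas j) = \<mu> j * (L2_inner f (cas j) + \<tau> * \<xi> j \<omega>))"
proof -
  define G where "G t = L2_inner (ker t) f" for t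
  have G: "G \<in> L2_unit"
  proof -
    obtain C where "\<forall>t\<in>{0..1}. \<bar>G t\<bar> \<le> C"
      unfolding G_def using ker_operator_cas(2)[OF f_L2] by blast
    then show ?thesis unfolding G_def by (intro bounded_L2_unit[of _ C]) auto
  qed
  have "AE \<omega> in M. \<forall>j. X j \<omega> = \<tau> * \<mu> j * \<xi> j \<omega>"
    using X_eq by (simp add: AE_all_countable)
  with D_L2 show ?thesis
  proof eventually_elim
    case (elim \<omega>)
    have F: "(\<lambda>t. F t \<omega>) = (\<lambda>t. 1 * D t \<omega> + 1 / h * G t)"
      by (simp add: D_def G_def)
    have "L2_inner (\<lambda>t. F t \<omega>) (cas j) = 1 * L2_inner (\<lambda>t. D t \<omega>) (cas j) + 1 / h * L2_inner G (cas j)" for j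
      unfolding F by (intro L2_inner_lincomb elim G cas_L2_unit)
    also have "\<dots> j = \<mu> j * (L2_inner f (cas j) + \<tau> * \<xi> j \<omega>)" for j
      using elim h_pos ker_operator_cas(3)[OF f_L2, of j]
      by (simp add: X_def[symmetric] G_def[abs_def] field_simps)
    finally show ?case
      using L2_unit_lincomb[OF elim(1) G, of 1 "1 / h"] unfolding F by simp
  qed
qed

corollary estimator_norm:
  "AE \<omega> in M. ((\<lambda>j. (\<mu> j * (L2_inner f (cas j) + \<tau> * \<xi> j \<omega>))\<^sup>2) has_sum (L2_nrm (\<lambda>t. F t \<omega>))\<^sup>2) UNIV"
  using estimator_coefficients
proof eventually_elim
  case (elim \<omega>)
  then show ?case
    using parseval[of "\<lambda>t. F t \<omega>"] by (simp add: L2_nrm_squared)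
qed

lemma estimator_norm_measurable [measurable]: "(\<lambda>\<omega>. L2_nrm (\<lambda>t. F t \<omega>)) \<in> borel_measurable M"
proof -
  have "(\<lambda>(t, \<omega>). F t \<omega> * F t \<omega>) \<in> borel_measurable (unit_lebesgue \<Otimes>\<^sub>M M)"
    by (rule measurable_pair_unit) measurable
  then have "(\<lambda>\<omega>. LINT t|unit_lebesgue. F t \<omega> * F t \<omega>) \<in> borel_measurable M"
    by (rule integral_unit_measurable)
  then show ?thesis
    unfolding L2_nrm_def L2_inner_eq by measurable
qed

end

subsection \<open>The normal distribution function\<close>

abbreviation Phi :: "real \<Rightarrow> real" where "Phi \<equiv> cdf std_normal_distribution"

interpretation std_normal: real_distribution std_normal_distribution
  by (rule real_dist_normal_dist)

lemma isCont_Phi: "isCont Phi x"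
proof -
  have "emeasure std_normal_distribution {x} = 0"
    by (subst emeasure_density) (auto simp: nn_integral_0_iff_AE intro!: AE_I'[of "{x}"])
  then show ?thesis by (simp add: std_normal.isCont_cdf measure_def)
qed

text \<open>The normal density is positive everywhere, so an interval of positive length cannot have
  normal measure 0.\<close>

lemma Phi_strict_mono:
  assumes "x < y" shows "Phi x < Phi y"
proof (rule ccontr)
  assume "\<not> Phi x < Phi y"
  moreover have "Phi y - Phi x = measure std_normal_distribution {x<..y}"
    using std_normal.cdf_diff_eq[OF assms] .
  ultimately have "measure std_normal_distribution {x<..y} = 0"
    using measure_nonneg[of std_normal_distribution "{x<..y}"] by linarith
  then have "emeasure std_normal_distribution {x<..y} = 0"
    by (simp add: std_normal.emeasure_eq_measure)
  then have "AE t in lborel. ennreal (std_normal_density t) * indicator {x<..y} t = 0"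
    by (subst (asm) emeasure_density) (auto simp: nn_integral_0_iff_AE)
  then have "AE t in lborel. t \<notin> {x<..y}"
  proof eventually_elim
    case (elim t)
    then show ?case
      using normal_density_pos[of 1 0 t] by (auto simp: indicator_def split: if_splits)
  qed
  then have "emeasure lborel {x<..y} = 0"
    by (subst (asm) AE_iff_measurable[of "{x<..y}"]) auto
  then show False using assms by simp
qed

lemma Phi_surj:
  assumes "0 < v" "v < 1"
  obtains z where "Phi z = v"
proof -
  have "\<forall>\<^sub>F x in at_bot. Phi x < v"
    using order_tendstoD(2)[OF std_normal.cdf_lim_at_bot assms(1)] .
  then obtain a where a: "Phi a < v" using eventually_happens'[OF trivial_limit_at_bot_linorder] by blast
  have "\<forall>\<^sub>F x in at_top. Phi x > v"
    using order_tendstoD(1)[OF std_normal.cdf_lim_at_top_prob assms(2)] .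
  then obtain b where b: "Phi b > v" using eventually_happens'[OF trivial_limit_at_top_linorder] by blast
  have "a \<le> b" using a b Phi_strict_mono[of b a] by force
  then obtain x where "Phi x = v"
    using IVT'[of Phi a v b] a b isCont_Phi by (auto intro: continuous_at_imp_continuous_on)
  then show ?thesis by (rule that)
qed

subsection \<open>A central limit theorem for weighted chi-square sums\<close>

lemma exp_minus_approx:
  fixes x :: real
  assumes "x \<ge> 0"
  shows "\<bar>exp (- x) - (1 - x)\<bar> \<le> x\<^sup>2 / 2"
proof -
  have "exp (- x) \<le> 1 - x + x\<^sup>2 / 2"
  proof -
    define g where "g y = 1 - y + y\<^sup>2 / 2 - exp (- y)" for y :: real
    have "g 0 \<le> g x"
    proof (rule DERIV_nonneg_imp_nondecreasing[OF assms])
      fix y :: real assume "0 \<le> y" "y \<le> x"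
      have "(g has_real_derivative (- 1 + y + exp (- y))) (at y)"
        unfolding g_def by (auto intro!: derivative_eq_intros)
      moreover have "- 1 + y + exp (- y) \<ge> 0"
        using exp_ge_add_one_self[of "- y"] by simp
      ultimately show "\<exists>d. (g has_real_derivative d) (at y) \<and> 0 \<le> d" by blast
    qed
    then show ?thesis by (simp add: g_def)
  qed
  moreover have "exp (- x) \<ge> 1 - x"
    using exp_ge_add_one_self[of "- x"] by simp
  ultimately show ?thesis by simp
qed

context white_noise_space
begin

definition chi :: "int \<Rightarrow> 'w \<Rightarrow> real" where
  "chi j \<omega> = (\<xi> j \<omega>)\<^sup>2 - 1"

lemma chi_measurable [measurable]: "chi j \<in> borel_measurable M"
  unfolding chi_def by measurable

text \<open>The third absolute moment of a centred squared standard normal variable. It enters the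
  error bounds only as a constant; what matters is that the integral converges.\<close>

definition chi3 :: real where
  "chi3 = (LINT x|std_normal_distribution. \<bar>x\<^sup>2 - 1\<bar> ^ 3)"

lemma chi3_nonneg: "chi3 \<ge> 0"
  unfolding chi3_def by (intro Bochner_Integration.integral_nonneg) simp

lemma chi_moments:
  shows "integrable M (chi j)" "integrable M (\<lambda>\<omega>. (chi j \<omega>)\<^sup>2)" "integrable M (\<lambda>\<omega>. \<bar>chi j \<omega>\<bar> ^ 3)"
    and "expectation (chi j) = 0" "expectation (\<lambda>\<omega>. (chi j \<omega>)\<^sup>2) = 2" "expectation (\<lambda>\<omega>. \<bar>chi j \<omega>\<bar> ^ 3) = chi3"
proof -
  note mom = integrable_std_normal_distribution_moment
  have distr: "integrable M (\<lambda>\<omega>. g (\<xi> j \<omega>)) \<longleftrightarrow> integrable std_normal_distribution g"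
    "expectation (\<lambda>\<omega>. g (\<xi> j \<omega>)) = (LINT x|std_normal_distribution. g x)"
    if "g \<in> borel_measurable borel" for g :: "real \<Rightarrow> real"
    using that by (simp_all flip: distr_\<xi>[of j] add: integrable_distr_eq integral_distr)
  have p2: "(\<lambda>x::real. (x\<^sup>2 - 1)\<^sup>2) = (\<lambda>x. x ^ 4 - 2 * x ^ 2 + 1)"
    by (auto simp: power2_eq_square power4_eq_xxxx algebra_simps)
  have p3: "(\<lambda>x::real. (x\<^sup>2 + 1) ^ 3) = (\<lambda>x. x ^ 6 + 3 * x ^ 4 + 3 * x ^ 2 + 1)"
    by (auto simp: eval_nat_numeral algebra_simps)
  have one: "integrable std_normal_distribution (\<lambda>_. 1 :: real)" "(LINT x|std_normal_distribution. 1) = (1::real)"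
    using std_normal.prob_space by simp_all
  have m2: "(LINT x|std_normal_distribution. x ^ 2) = 1"
    using std_normal_distribution_even_moments[of 1] by (simp add: fact_numeral)
  have m4: "(LINT x|std_normal_distribution. x ^ 4) = 3"
    using std_normal_distribution_even_moments[of 2] by (simp add: fact_numeral)
  have "integrable std_normal_distribution (\<lambda>x. x\<^sup>2 - 1)" using mom[of 2] one by simp
  then show "integrable M (chi j)" unfolding chi_def[abs_def] by (subst distr(1)) auto
  have "integrable std_normal_distribution (\<lambda>x. (x\<^sup>2 - 1)\<^sup>2)" unfolding p2 using mom[of 2] mom[of 4] one by simp
  then show "integrable M (\<lambda>\<omega>. (chi j \<omega>)\<^sup>2)" unfolding chi_def by (subst distr(1)) auto
  have "integrable std_normal_distribution (\<lambda>x. \<bar>x\<^sup>2 - 1\<bar> ^ 3)"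
  proof (rule Bochner_Integration.integrable_bound)
    show "integrable std_normal_distribution (\<lambda>x. (x\<^sup>2 + 1) ^ 3)"
      unfolding p3 using mom[of 2] mom[of 4] mom[of 6] one by simp
    show "AE x in std_normal_distribution. norm (\<bar>x\<^sup>2 - 1\<bar> ^ 3) \<le> norm ((x\<^sup>2 + 1 :: real) ^ 3)"
    proof (intro AE_I2)
      fix x :: real
      have "\<bar>x\<^sup>2 - 1\<bar> \<le> x\<^sup>2 + 1" using zero_le_power2[of x] by linarith
      then have "\<bar>x\<^sup>2 - 1\<bar> ^ 3 \<le> (x\<^sup>2 + 1) ^ 3" by (intro power_mono) auto
      then show "norm (\<bar>x\<^sup>2 - 1\<bar> ^ 3) \<le> norm ((x\<^sup>2 + 1) ^ 3)" by simp
    qed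
  qed measurable
  then show "integrable M (\<lambda>\<omega>. \<bar>chi j \<omega>\<bar> ^ 3)" unfolding chi_def by (subst distr(1)) auto
  have "(LINT x|std_normal_distribution. x\<^sup>2 - 1) = 0" using mom[of 2] one m2 by simp
  then show "expectation (chi j) = 0" unfolding chi_def[abs_def] by (subst distr(2)) auto
  have "(LINT x|std_normal_distribution. (x\<^sup>2 - 1)\<^sup>2) = 2"
    unfolding p2 using mom[of 2] mom[of 4] one m2 m4 by simp
  then show "expectation (\<lambda>\<omega>. (chi j \<omega>)\<^sup>2) = 2" unfolding chi_def by (subst distr(2)) auto
  show "expectation (\<lambda>\<omega>. \<bar>chi j \<omega>\<bar> ^ 3) = chi3" unfolding chi_def chi3_def by (subst distr(2)) auto
qed

text \<open>Two comparisons: the characteristic function with its second order Taylor polynomial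
  \<open>1 - t^2 l^2\<close> (the variance of \<open>chi j\<close> is 2), and this polynomial with
  the exponential.\<close>

lemma char_chi_approx:
  "cmod (char (distr M borel (\<lambda>\<omega>. l * chi j \<omega>)) t - complex_of_real (exp (- (t\<^sup>2 * l\<^sup>2)))) \<le>
    \<bar>t\<bar> ^ 3 * \<bar>l\<bar> ^ 3 * chi3 / 6 + t ^ 4 * l ^ 4 / 2"
proof -
  have "cmod (char (distr M borel (\<lambda>\<omega>. l * chi j \<omega>)) t - (1 - t\<^sup>2 * (2 * l\<^sup>2) / 2)) \<le>
    t\<^sup>2 / 6 * expectation (\<lambda>\<omega>. min (6 * (l * chi j \<omega>)\<^sup>2) (\<bar>t\<bar> * \<bar>l * chi j \<omega>\<bar> ^ 3))"
  proof (rule char_approx3')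
    show "expectation (\<lambda>\<omega>. l * chi j \<omega>) = 0" by (simp add: chi_moments)
    then show "variance (\<lambda>\<omega>. l * chi j \<omega>) = 2 * l\<^sup>2" by (simp add: chi_moments power_mult_distrib)
  qed (auto simp: chi_moments power_mult_distrib)
  also have "\<dots> \<le> t\<^sup>2 / 6 * expectation (\<lambda>\<omega>. \<bar>t\<bar> * \<bar>l\<bar> ^ 3 * \<bar>chi j \<omega>\<bar> ^ 3)"
  proof (intro mult_left_mono integral_mono')
    show "integrable M (\<lambda>\<omega>. \<bar>t\<bar> * \<bar>l\<bar> ^ 3 * \<bar>chi j \<omega>\<bar> ^ 3)" using chi_moments by simp
  qed (auto simp: abs_mult power_mult_distrib mult.assoc)
  also have "\<dots> = \<bar>t\<bar>\<^sup>2 / 6 * (\<bar>t\<bar> * \<bar>l\<bar> ^ 3 * chi3)"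
    by (simp only: integral_mult_right_zero chi_moments power2_abs)
  also have "\<dots> = \<bar>t\<bar> ^ 3 * \<bar>l\<bar> ^ 3 * chi3 / 6"
  proof -
    have "a\<^sup>2 / 6 * (a * b * c) = a ^ 3 * b * c / 6" for a b c :: real
      by (simp add: power3_eq_cube power2_eq_square)
    then show ?thesis .
  qed
  finally have 1: "cmod (char (distr M borel (\<lambda>\<omega>. l * chi j \<omega>)) t - complex_of_real (1 - t\<^sup>2 * l\<^sup>2)) \<le>
    \<bar>t\<bar> ^ 3 * \<bar>l\<bar> ^ 3 * chi3 / 6" by simp
  have "cmod (complex_of_real (1 - t\<^sup>2 * l\<^sup>2) - complex_of_real (exp (- (t\<^sup>2 * l\<^sup>2)))) = \<bar>exp (- (t\<^sup>2 * l\<^sup>2)) - (1 - t\<^sup>2 * l\<^sup>2)\<bar>"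
    by (simp only: of_real_diff[symmetric] norm_of_real abs_minus_commute)
  also have "\<dots> \<le> (t\<^sup>2 * l\<^sup>2)\<^sup>2 / 2" by (rule exp_minus_approx) simp
  also have "\<dots> = t ^ 4 * l ^ 4 / 2" by (simp add: power_mult_distrib flip: power_mult)
  finally show ?thesis
    by (rule norm_diff_triangle_le[OF 1])
qed

text \<open>By independence both sides are products of factors of modulus at most 1, so their
  distance is at most the sum of the factorwise errors. One or two powers of
  \<open>\<bar>l j\<bar>\<close> are traded for \<open>e\<close>, as in Lyapunov's condition,
  leaving the sum of squares.\<close>

lemma char_chi_sum_approx:
  assumes A: "finite A" and le: "\<And>j. j \<in> A \<Longrightarrow> \<bar>l j\<bar> \<le> e"
  shows "cmod (char (distr M borel (\<lambda>\<omega>. \<Sum>j\<in>A. l j * chi j \<omega>)) t - complex_of_real (exp (- (t\<^sup>2 * (\<Sum>j\<in>A. (l j)\<^sup>2)))))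
    \<le> (\<bar>t\<bar> ^ 3 * e * chi3 / 6 + t ^ 4 * e\<^sup>2 / 2) * (\<Sum>j\<in>A. (l j)\<^sup>2)"
proof -
  have "indep_vars (\<lambda>_. borel) (\<lambda>j \<omega>. (\<lambda>x. l j * (x\<^sup>2 - 1)) (\<xi> j \<omega>)) UNIV"
    by (rule indep_vars_compose2[OF \<xi>_indep]) measurable
  then have "indep_vars (\<lambda>_. borel) (\<lambda>j \<omega>. l j * chi j \<omega>) A"
    unfolding chi_def by (rule indep_vars_subset) simp
  then have "char (distr M borel (\<lambda>\<omega>. \<Sum>j\<in>A. l j * chi j \<omega>)) t = (\<Prod>j\<in>A. char (distr M borel (\<lambda>\<omega>. l j * chi j \<omega>)) t)"
    by (rule char_distr_sum)
  moreover have "complex_of_real (exp (- (t\<^sup>2 * (\<Sum>j\<in>A. (l j)\<^sup>2)))) = (\<Prod>j\<in>A. complex_of_real (exp (- (t\<^sup>2 * (l j)\<^sup>2))))"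
    using A by (simp add: exp_sum sum_distrib_left flip: sum_negf of_real_prod)
  moreover have "cmod ((\<Prod>j\<in>A. char (distr M borel (\<lambda>\<omega>. l j * chi j \<omega>)) t) - (\<Prod>j\<in>A. complex_of_real (exp (- (t\<^sup>2 * (l j)\<^sup>2)))))
    \<le> (\<Sum>j\<in>A. cmod (char (distr M borel (\<lambda>\<omega>. l j * chi j \<omega>)) t - complex_of_real (exp (- (t\<^sup>2 * (l j)\<^sup>2)))))"
  proof (rule norm_prod_diff)
    fix j
    show "cmod (char (distr M borel (\<lambda>\<omega>. l j * chi j \<omega>)) t) \<le> 1"
      by (intro real_distribution.cmod_char_le_1 real_distribution_distr) simp
    show "cmod (complex_of_real (exp (- (t\<^sup>2 * (l j)\<^sup>2)))) \<le> 1" by simp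
  qed
  moreover have "\<dots> \<le> (\<Sum>j\<in>A. (\<bar>t\<bar> ^ 3 * e * chi3 / 6 + t ^ 4 * e\<^sup>2 / 2) * (l j)\<^sup>2)"
  proof (rule sum_mono)
    fix j assume j: "j \<in> A"
    have "\<bar>l j\<bar> ^ 3 \<le> e * (l j)\<^sup>2"
      using mult_right_mono[OF le[OF j], of "(l j)\<^sup>2"] by (simp add: power3_eq_cube power2_eq_square abs_mult_self_eq mult.assoc)
    then have "\<bar>t\<bar> ^ 3 * \<bar>l j\<bar> ^ 3 * chi3 / 6 \<le> \<bar>t\<bar> ^ 3 * (e * (l j)\<^sup>2) * chi3 / 6"
      using chi3_nonneg by (intro divide_right_mono mult_right_mono mult_left_mono) auto
    moreover have "l j ^ 4 \<le> e\<^sup>2 * (l j)\<^sup>2"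
    proof -
      have "(l j)\<^sup>2 \<le> e\<^sup>2" using power_mono[OF le[OF j], of 2] by simp
      then have "(l j)\<^sup>2 * (l j)\<^sup>2 \<le> e\<^sup>2 * (l j)\<^sup>2" by (intro mult_right_mono) auto
      then show ?thesis by (simp flip: power_add)
    qed
    then have "t ^ 4 * l j ^ 4 / 2 \<le> t ^ 4 * (e\<^sup>2 * (l j)\<^sup>2) / 2"
      by (intro divide_right_mono mult_left_mono) auto
    ultimately show "cmod (char (distr M borel (\<lambda>\<omega>. l j * chi j \<omega>)) t - complex_of_real (exp (- (t\<^sup>2 * (l j)\<^sup>2)))) \<le>
      (\<bar>t\<bar> ^ 3 * e * chi3 / 6 + t ^ 4 * e\<^sup>2 / 2) * (l j)\<^sup>2"
      using char_chi_approx[of "l j" j t] by (simp add: algebra_simps)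
  qed
  ultimately show ?thesis by (simp add: sum_distrib_left)
qed

text \<open>The sums are infinite for each \<open>n\<close>: the finite estimate is carried to the
  limit in \<open>N\<close> first, on characteristic functions, and only then \<open>n\<close> grows
  and Levy's continuity theorem applies. The limit 1/2 of the squared weights corresponds to
  variance 1, as each \<open>chi j\<close> has variance 2.\<close>

theorem chi_square_clt:
  fixes l :: "nat \<Rightarrow> int \<Rightarrow> real" and T :: "nat \<Rightarrow> 'w \<Rightarrow> real"
  assumes T [measurable]: "\<And>n. T n \<in> borel_measurable M"
    and lim: "\<And>n. AE \<omega> in M. (\<lambda>N. \<Sum>j\<in>{- int N..int N}. l n j * chi j \<omega>) \<longlonglongrightarrow> T n \<omega>"
    and var: "\<And>n. (\<lambda>N. \<Sum>j\<in>{- int N..int N}. (l n j)\<^sup>2) \<longlonglongrightarrow> 1 / 2"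
    and le: "\<And>n j. \<bar>l n j\<bar> \<le> e n" and e: "e \<longlonglongrightarrow> 0"
  shows "(\<lambda>n. prob {\<omega> \<in> space M. T n \<omega> \<le> x}) \<longlonglongrightarrow> Phi x"
proof -
  have bound: "cmod (char (distr M borel (T n)) t - complex_of_real (exp (- (t\<^sup>2 * (1 / 2)))))
      \<le> (\<bar>t\<bar> ^ 3 * e n * chi3 / 6 + t ^ 4 * (e n)\<^sup>2 / 2) * (1 / 2)" for n t
  proof (rule LIMSEQ_le)
    let ?S = "\<lambda>N. \<Sum>j\<in>{- int N..int N}. (l n j)\<^sup>2"
    show "(\<lambda>N. (\<bar>t\<bar> ^ 3 * e n * chi3 / 6 + t ^ 4 * (e n)\<^sup>2 / 2) * ?S N) \<longlonglongrightarrow> (\<bar>t\<bar> ^ 3 * e n * chi3 / 6 + t ^ 4 * (e n)\<^sup>2 / 2) * (1 / 2)"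
      by (intro tendsto_intros var) simp_all
    have "(\<lambda>N. CLINT \<omega>|M. iexp (t * (\<Sum>j\<in>{- int N..int N}. l n j * chi j \<omega>))) \<longlonglongrightarrow> (CLINT \<omega>|M. iexp (t * T n \<omega>))"
    proof (rule integral_dominated_convergence[where w = "\<lambda>_. 1"])
      show "AE \<omega> in M. (\<lambda>N. iexp (t * (\<Sum>j\<in>{- int N..int N}. l n j * chi j \<omega>))) \<longlonglongrightarrow> iexp (t * T n \<omega>)"
        using lim[of n] by eventually_elim (intro tendsto_intros)
    qed auto
    then have "(\<lambda>N. char (distr M borel (\<lambda>\<omega>. \<Sum>j\<in>{- int N..int N}. l n j * chi j \<omega>)) t) \<longlonglongrightarrow> char (distr M borel (T n)) t"
      by (simp add: char_def integral_distr)
    then show "(\<lambda>N. cmod (char (distr M borel (\<lambda>\<omega>. \<Sum>j\<in>{- int N..int N}. l n j * chi j \<omega>)) t - complex_of_real (exp (- (t\<^sup>2 * ?S N)))))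
        \<longlonglongrightarrow> cmod (char (distr M borel (T n)) t - complex_of_real (exp (- (t\<^sup>2 * (1 / 2)))))"
      by (intro tendsto_intros var) simp_all
    show "\<exists>N0. \<forall>N\<ge>N0. cmod (char (distr M borel (\<lambda>\<omega>. \<Sum>j\<in>{- int N..int N}. l n j * chi j \<omega>)) t - complex_of_real (exp (- (t\<^sup>2 * ?S N))))
        \<le> (\<bar>t\<bar> ^ 3 * e n * chi3 / 6 + t ^ 4 * (e n)\<^sup>2 / 2) * ?S N"
      by (intro exI allI impI char_chi_sum_approx le) simp
  qed
  have "weak_conv_m (\<lambda>n. distr M borel (T n)) std_normal_distribution"
  proof (rule levy_continuity)
    fix t :: real
    have "(\<lambda>n. (\<bar>t\<bar> ^ 3 * e n * chi3 / 6 + t ^ 4 * (e n)\<^sup>2 / 2) * (1 / 2)) \<longlonglongrightarrow> (\<bar>t\<bar> ^ 3 * 0 * chi3 / 6 + t ^ 4 * 0\<^sup>2 / 2) * (1 / 2)"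
      by (intro tendsto_intros e) simp_all
    then have z: "(\<lambda>n. (\<bar>t\<bar> ^ 3 * e n * chi3 / 6 + t ^ 4 * (e n)\<^sup>2 / 2) * (1 / 2)) \<longlonglongrightarrow> 0" by simp
    have "(\<lambda>n. char (distr M borel (T n)) t - complex_of_real (exp (- (t\<^sup>2 * (1 / 2))))) \<longlonglongrightarrow> 0"
      by (rule Lim_null_comparison[OF always_eventually z]) (use bound in blast)
    then show "(\<lambda>n. char (distr M borel (T n)) t) \<longlonglongrightarrow> char std_normal_distribution t"
      unfolding char_std_normal_distribution by (simp add: LIM_zero_iff)
  qed (auto intro: real_dist_normal_dist)
  then have "(\<lambda>n. cdf (distr M borel (T n)) x) \<longlonglongrightarrow> Phi x"
    using isCont_Phi by (simp add: weak_conv_m_def weak_conv_def)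
  then show ?thesis
    by (simp add: cdf_def measure_distr vimage_def Int_def conj_commute)
qed

end

subsection \<open>The standardized statistic\<close>

lemma has_sum_symmetric_intervals:
  fixes f :: "int \<Rightarrow> real"
  shows "(f has_sum S) UNIV \<Longrightarrow> (\<lambda>N. \<Sum>j\<in>{- int N..int N}. f j) \<longlonglongrightarrow> S"
  unfolding has_sum_def by (rule filterlim_compose[OF _ filterlim_symmetric_intervals])

locale unit_kernel = even_kernel +
  assumes K_integral: "(LINT v|lborel. K v) = 1"
begin

lemma B_pos: "B > 0"
proof -
  have "1 \<le> 2 * B" using integral_K_le[of "\<lambda>_. 1" 1] K_integral by simp
  then show ?thesis by simp
qed

lemma abs_kernel_ft_le: "\<bar>kernel_ft K x\<bar> \<le> 2 * B"
  unfolding kernel_ft_def using integral_K_le[of "\<lambda>v. cos (2 * pi * x * v)" 1] by simp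

lemma kernel_ft_zero: "kernel_ft K 0 = 1"
  by (simp add: kernel_ft_def K_integral)

lemma kernel_ft_lipschitz: "\<bar>kernel_ft K x - kernel_ft K y\<bar> \<le> 4 * pi * B * \<bar>x - y\<bar>"
proof -
  have i: "integrable lborel (\<lambda>v. K v * cos (2 * pi * x * v))" for x
    by (rule K_integrable[where C = 1]) auto
  have "kernel_ft K x - kernel_ft K y = (LINT v|lborel. K v * (cos (2 * pi * x * v) - cos (2 * pi * y * v)))"
    unfolding kernel_ft_def using i by (simp add: right_diff_distrib)
  also have "\<bar>\<dots>\<bar> \<le> 2 * B * (2 * pi * \<bar>x - y\<bar>)"
  proof (rule integral_K_le)
    fix v :: real assume v: "\<bar>v\<bar> \<le> 1"
    have "\<bar>cos a - cos b\<bar> \<le> \<bar>a - b\<bar>" for a b :: real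
    proof -
      have "\<bar>cos a - cos b\<bar> = 2 * (\<bar>sin ((a + b) / 2)\<bar> * \<bar>sin ((b - a) / 2)\<bar>)"
        by (simp add: cos_diff_cos abs_mult)
      also have "\<dots> \<le> 2 * (1 * \<bar>(b - a) / 2\<bar>)"
        by (intro mult_left_mono mult_mono abs_sin_x_le_abs_x) auto
      finally show ?thesis by (simp add: abs_minus_commute)
    qed
    then have "\<bar>cos (2 * pi * x * v) - cos (2 * pi * y * v)\<bar> \<le> \<bar>2 * pi * x * v - 2 * pi * y * v\<bar>" .
    also have "\<dots> = 2 * pi * \<bar>x - y\<bar> * \<bar>v\<bar>"
      by (simp add: abs_mult flip: left_diff_distrib right_diff_distrib)
    also have "\<dots> \<le> 2 * pi * \<bar>x - y\<bar> * 1" using v by (intro mult_left_mono) auto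
    finally show "\<bar>cos (2 * pi * x * v) - cos (2 * pi * y * v)\<bar> \<le> 2 * pi * \<bar>x - y\<bar>" by simp
  qed auto
  finally show ?thesis by (simp add: mult_ac)
qed

text \<open>Parseval's identity for \<open>ker 0\<close>: all \<open>cas j 0\<close> equal 1, so its
  coefficients are exactly \<open>h * \<mu> j\<close>.\<close>

lemma \<mu>_squared_has_sum: "((\<lambda>j. (h * \<mu> j)\<^sup>2) has_sum L2_inner (ker 0) (ker 0)) UNIV"
proof -
  have "cas j 0 = 1" for j by (simp add: cas_def)
  then show ?thesis
    using parseval[OF ker_L2[of 0]] by (simp add: ker_cas)
qed

text \<open>Times \<open>\<tau>\<^sup>2\<close>, the mean of the squared norm of the estimator under
  the hypothesis.\<close>

definition m2 :: real where "m2 = (\<Sum>\<^sub>\<infinity>j. (\<mu> j)\<^sup>2)"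

lemma m2_has_sum: "((\<lambda>j. (\<mu> j)\<^sup>2) has_sum m2) UNIV" and h2_m2: "h\<^sup>2 * m2 = L2_inner (ker 0) (ker 0)"
proof -
  have 1: "((\<lambda>j. (\<mu> j)\<^sup>2) has_sum (1 / h\<^sup>2 * L2_inner (ker 0) (ker 0))) UNIV"
    using has_sum_cmult_right[OF \<mu>_squared_has_sum, of "1 / h\<^sup>2"] h_pos by (simp add: power_mult_distrib)
  from has_sum_infsum[OF has_sum_imp_summable[OF 1]]
  show "((\<lambda>j. (\<mu> j)\<^sup>2) has_sum m2) UNIV"
    unfolding m2_def .
  show "h\<^sup>2 * m2 = L2_inner (ker 0) (ker 0)"
    using infsumI[OF 1] h_pos by (simp add: m2_def)
qed

text \<open>A sup bound on both factors of the squared kernel would give only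
  \<open>1 / h^2\<close>. One factor is bounded by the supremum and the other integrated: the
  periodization of \<open>\<bar>K\<bar>\<close> has integral \<open>h\<close> times that of
  \<open>\<bar>K\<bar>\<close>.\<close>

lemma m2_le: "m2 \<le> 2 * (2 * h + 5) * B\<^sup>2 / h"
proof -
  interpret A: compact_kernel "\<lambda>t. \<bar>K t\<bar>" B h
    by unfold_locales (use K_bound K_support h_pos in auto)
  obtain N where N: "1 + h \<le> real N" using real_arch_simple by blast
  have A: "\<bar>ker 0 u\<bar> \<le> A.ker 0 u" if "u \<in> {0..<1}" for u
  proof -
    have "\<bar>0 - u\<bar> + h \<le> real N" using that N by auto
    then show ?thesis by (simp only: ker_eq_sum A.ker_eq_sum) (rule sum_abs)
  qed
  have one: "(\<lambda>_. 1 :: real) \<in> L2_unit" by (rule bounded_L2_unit[of _ 1]) auto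
  have iA: "integrable unit_lebesgue (A.ker 0)"
    using integrable_mult_L2[OF A.ker_L2 one, of 0] by simp
  have L: "ker 0 \<in> L2_unit" by (rule ker_L2) simp
  have "h\<^sup>2 * m2 = (LINT u|unit_lebesgue. ker 0 u * ker 0 u)"
    by (simp add: h2_m2 L2_inner_eq)
  also have "\<dots> \<le> (LINT u|unit_lebesgue. (2 * h + 5) * B * A.ker 0 u)"
  proof (rule integral_mono)
    fix u assume u: "u \<in> space unit_lebesgue"
    have "ker 0 u * ker 0 u = \<bar>ker 0 u\<bar> * \<bar>ker 0 u\<bar>" by simp
    also have "\<dots> \<le> (2 * h + 5) * B * A.ker 0 u"
      using u A[of u] abs_ker_le[of 0 u] by (intro mult_mono) auto
    finally show "ker 0 u * ker 0 u \<le> (2 * h + 5) * B * A.ker 0 u" .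
  qed (use L iA in \<open>auto intro: integrable_mult_L2\<close>)
  also have "\<dots> = (2 * h + 5) * B * L2_inner (A.ker 0) (\<lambda>_. 1)"
    by (simp add: L2_inner_eq)
  also have "L2_inner (A.ker 0) (\<lambda>_. 1) = h * (LINT v|lborel. \<bar>K v\<bar>)"
    using A.integral_ker[of "\<lambda>_. 1" 1 0] by simp
  also have "(LINT v|lborel. \<bar>K v\<bar>) = (LINT v|lborel. K v * sgn (K v))"
    by (simp add: abs_sgn)
  also have "(2 * h + 5) * B * (h * \<dots>) \<le> (2 * h + 5) * B * (h * (2 * B * 1))"
  proof (intro mult_left_mono)
    have "\<bar>LINT v|lborel. K v * sgn (K v)\<bar> \<le> 2 * B * 1"
      by (rule integral_K_le) (auto simp: sgn_real_def)
    then show "(LINT v|lborel. K v * sgn (K v)) \<le> 2 * B * 1" by linarith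
  qed (use h_pos B_nonneg in auto)
  finally have "h * (h * m2) \<le> h * ((2 * h + 5) * B * 2 * B)"
    by (simp add: power2_eq_square mult_ac)
  then have "h * m2 \<le> (2 * h + 5) * B * 2 * B"
    using h_pos by (simp add: mult_le_cancel_left)
  then show ?thesis
    using h_pos by (simp add: field_simps power2_eq_square)
qed

text \<open>The Riemann-Lebesgue lemma follows from the square summability of the values on a
  fine lattice, because the Fourier transform is Lipschitz.\<close>

lemma riemann_lebesgue_lattice:
  obtains X where "\<And>x. \<bar>x\<bar> > X \<Longrightarrow> \<bar>kernel_ft K x\<bar> \<le> 8 * pi * B * h"
proof -
  have "(\<lambda>j. (\<mu> j)\<^sup>2) summable_on UNIV"
    using m2_has_sum by (auto simp: summable_on_def)
  \<comment> \<open>The threshold is the Lipschitz constant times the lattice spacing; adding the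
    same amount for the distance to the nearest lattice point on the left yields
    \<open>8 * pi * B * h\<close>. Each index in the set uses up a fixed share of the finite sum
    \<open>m2\<close>.\<close>
  have "finite {j. (\<mu> j)\<^sup>2 \<ge> (4 * pi * B * h)\<^sup>2}"
  proof (rule ccontr)
    assume inf: "infinite {j. (\<mu> j)\<^sup>2 \<ge> (4 * pi * B * h)\<^sup>2}"
    let ?c = "(4 * pi * B * h)\<^sup>2"
    have c: "?c > 0" using B_pos h_pos by simp
    obtain m :: nat where m: "m2 < real m * ?c" using reals_Archimedean3[OF c] by blast
    obtain A where A: "A \<subseteq> {j. (\<mu> j)\<^sup>2 \<ge> ?c}" "card A = m" "finite A"
      using infinite_arbitrarily_large[OF inf] by blast
    have "real m * ?c \<le> (\<Sum>j\<in>A. (\<mu> j)\<^sup>2)"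
      using A sum_bounded_below[of A ?c "\<lambda>j. (\<mu> j)\<^sup>2"] by auto
    also have "\<dots> \<le> m2"
      using A by (intro has_sum_mono_neutral[OF has_sum_finite m2_has_sum]) auto
    finally show False using m by simp
  qed
  then have "bdd_above (abs ` {j. (\<mu> j)\<^sup>2 \<ge> (4 * pi * B * h)\<^sup>2})" by (intro bdd_above_finite) simp
  then obtain J where J: "\<And>j. (\<mu> j)\<^sup>2 \<ge> (4 * pi * B * h)\<^sup>2 \<Longrightarrow> \<bar>j\<bar> \<le> J"
    by (auto simp: bdd_above_def)
  show ?thesis
  proof (rule that[of "(of_int J + 1) * h"])
    fix x :: real assume x: "\<bar>x\<bar> > (of_int J + 1) * h"
    define j where "j = \<lfloor>x / h\<rfloor>"
    have "of_int j \<le> x / h" "x / h < of_int j + 1" by (auto simp: j_def)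
    then have j: "of_int j * h \<le> x" "x < of_int j * h + h"
      using h_pos by (auto simp: field_simps)
    have "\<bar>j\<bar> > J"
    proof (rule ccontr)
      assume "\<not> \<bar>j\<bar> > J"
      then have "- of_int J \<le> (of_int j :: real)" "of_int j \<le> (of_int J :: real)" by linarith+
      then have "- of_int J * h \<le> of_int j * h" "of_int j * h \<le> of_int J * h"
        using h_pos by (simp_all only: mult_le_cancel_right_pos)
      moreover have "(of_int J + 1) * h = of_int J * h + h" by (simp add: algebra_simps)
      ultimately have "\<bar>x\<bar> \<le> (of_int J + 1) * h" using j h_pos by linarith
      then show False using x by simp
    qed
    then have "(\<mu> j)\<^sup>2 < (4 * pi * B * h)\<^sup>2" using J[of j] by linarith
    then have "\<bar>\<mu> j\<bar> < 4 * pi * B * h"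
      using B_pos h_pos by (intro power2_less_imp_less[of "\<bar>\<mu> j\<bar>"]) auto
    moreover have "\<bar>kernel_ft K x - \<mu> j\<bar> \<le> 4 * pi * B * h"
    proof -
      have "4 * pi * B * \<bar>x - of_int j * h\<bar> \<le> 4 * pi * B * h"
        using j B_pos by (intro mult_left_mono) auto
      then show ?thesis using kernel_ft_lipschitz[of x "of_int j * h"] by linarith
    qed
    ultimately show "\<bar>kernel_ft K x\<bar> \<le> 8 * pi * B * h" by linarith
  qed
qed

text \<open>The transform equals 1 at 0 and has Lipschitz constant \<open>4 * pi * B\<close>, so it
  cannot fall below 1/2 within distance \<open>1 / (8 * pi * B)\<close>. This is the origin of the
  frequency cutoff.\<close>

lemma \<mu>_ge_half: "\<bar>of_int j * h\<bar> \<le> 1 / (8 * pi * B) \<Longrightarrow> \<mu> j \<ge> 1 / 2"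
proof -
  assume j: "\<bar>of_int j * h\<bar> \<le> 1 / (8 * pi * B)"
  have "\<bar>\<mu> j - 1\<bar> \<le> 4 * pi * B * \<bar>of_int j * h\<bar>"
    using kernel_ft_lipschitz[of "of_int j * h" 0] by (simp add: kernel_ft_zero)
  also have "\<dots> \<le> 4 * pi * B * (1 / (8 * pi * B))"
    using j B_pos by (intro mult_left_mono) auto
  also have "\<dots> = 1 / 2" using B_pos by (simp add: field_simps)
  finally show "\<mu> j \<ge> 1 / 2" by linarith
qed

text \<open>Times \<open>2 * \<tau> ^ 4\<close>, the null variance of the squared norm of the
  estimator; hence the normalization by \<open>1 / sqrt (2 * m4)\<close> below.\<close>

definition m4 :: real where "m4 = (\<Sum>\<^sub>\<infinity>j. (\<mu> j) ^ 4)"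

lemma \<mu>4_le: "(\<mu> j) ^ 4 \<le> 4 * B\<^sup>2 * (\<mu> j)\<^sup>2"
proof -
  have "(\<mu> j)\<^sup>2 \<le> (2 * B)\<^sup>2" using power_mono[OF abs_kernel_ft_le, of "of_int j * h" 2] by simp
  then have "(\<mu> j)\<^sup>2 * (\<mu> j)\<^sup>2 \<le> (2 * B)\<^sup>2 * (\<mu> j)\<^sup>2" by (intro mult_right_mono) auto
  then show ?thesis by (simp add: power_mult_distrib flip: power_add)
qed

lemma m4_has_sum: "((\<lambda>j. (\<mu> j) ^ 4) has_sum m4) UNIV" and m4_le: "m4 \<le> 4 * B\<^sup>2 * m2"
proof -
  have s: "((\<lambda>j. 4 * B\<^sup>2 * (\<mu> j)\<^sup>2) has_sum (4 * B\<^sup>2 * m2)) UNIV"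
    by (intro has_sum_cmult_right m2_has_sum)
  have "(\<lambda>j. (\<mu> j) ^ 4) summable_on UNIV"
    by (rule summable_on_comparison_test[of "\<lambda>j. 4 * B\<^sup>2 * (\<mu> j)\<^sup>2"])
       (use s \<mu>4_le in \<open>auto simp: summable_on_def\<close>)
  then show *: "((\<lambda>j. (\<mu> j) ^ 4) has_sum m4) UNIV" by (simp add: m4_def)
  show "m4 \<le> 4 * B\<^sup>2 * m2"
    by (rule has_sum_mono[OF * s]) (rule \<mu>4_le)
qed

lemma weighted_summable:
  assumes "f \<in> L2_unit"
  shows "(\<lambda>j. (\<mu> j * L2_inner f (cas j))\<^sup>2) summable_on A"
proof (rule summable_on_comparison_test)
  show "(\<lambda>j. (2 * B)\<^sup>2 * (L2_inner f (cas j))\<^sup>2) summable_on A"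
    by (intro summable_on_cmult_right cas_coeff_summable assms)
  show "(\<mu> j * L2_inner f (cas j))\<^sup>2 \<le> (2 * B)\<^sup>2 * (L2_inner f (cas j))\<^sup>2" for j
    using power_mono[OF abs_kernel_ft_le, of "of_int j * h" 2] by (simp add: power_mult_distrib mult_right_mono)
qed simp

text \<open>At least \<open>1 / (8 * pi * B * h)\<close> frequencies satisfy
  \<open>\<mu> j \<ge> 1 / 2\<close>, and each of them contributes at least 1/16.\<close>

lemma m4_ge: "m4 \<ge> 1 / (128 * pi * B * h)"
proof -
  define N where "N = nat \<lfloor>1 / (8 * pi * B * h)\<rfloor>"
  have pos: "1 / (8 * pi * B * h) > 0" using B_pos h_pos by simp
  then have N: "real N \<le> 1 / (8 * pi * B * h)" "1 / (8 * pi * B * h) < real N + 1"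
    unfolding N_def by linarith+
  have "(1 / 2) ^ 4 \<le> (\<mu> j) ^ 4" if j: "j \<in> {- int N..int N}" for j
  proof (intro power_mono \<mu>_ge_half)
    have "\<bar>of_int j\<bar> \<le> 1 / (8 * pi * B * h)" using j N(1) by auto
    then show "\<bar>of_int j * h\<bar> \<le> 1 / (8 * pi * B)" using h_pos B_pos by (simp add: abs_mult field_simps)
  qed simp
  then have "(\<Sum>j\<in>{- int N..int N}. (1 / 2) ^ 4) \<le> (\<Sum>j\<in>{- int N..int N}. (\<mu> j) ^ 4)"
    by (rule sum_mono)
  also have "\<dots> \<le> m4"
    by (rule has_sum_mono_neutral[OF has_sum_finite m4_has_sum]) auto
  finally have "(2 * real N + 1) / 16 \<le> m4" by (simp add: power4_eq_xxxx)
  moreover have "1 / (128 * pi * B * h) \<le> (2 * real N + 1) / 16"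
  proof -
    have "1 / (128 * pi * B * h) = 1 / (8 * pi * B * h) / 16" by simp
    also have "\<dots> \<le> (2 * real N + 1) / 16" using N by (intro divide_right_mono) auto
    finally show ?thesis .
  qed
  ultimately show ?thesis by linarith
qed

lemma m4_pos: "m4 > 0"
proof -
  have "1 / (128 * pi * B * h) > 0" using B_pos h_pos by simp
  then show ?thesis using m4_ge by linarith
qed

definition \<delta> :: real where "\<delta> = 1 / sqrt (2 * m4)"

lemma \<delta>_pos: "\<delta> > 0" using m4_pos by (simp add: \<delta>_def)

text \<open>Together with \<open>\<delta>_ge\<close>: the normalizing factor is of exact order
  \<open>sqrt h\<close> for bounded \<open>h\<close>. The upper bound makes the largest weight in
  the central limit theorem vanish and limits the drift of tails; the lower bound makes signals in
  the ball visible.\<close>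

lemma \<delta>_le: "\<delta> \<le> sqrt (64 * pi * B * h)"
proof -
  have pos: "64 * pi * B * h > 0" using B_pos h_pos by simp
  have "1 / (64 * pi * B * h) \<le> 2 * m4" using m4_ge by simp
  then have "sqrt (1 / (64 * pi * B * h)) \<le> sqrt (2 * m4)" by (rule real_sqrt_le_mono)
  then have "1 / sqrt (2 * m4) \<le> 1 / sqrt (1 / (64 * pi * B * h))"
    using pos by (intro divide_left_mono) (auto simp: m4_pos)
  then show ?thesis by (simp add: \<delta>_def real_sqrt_divide)
qed

lemma \<delta>_ge: "\<delta> \<ge> sqrt (h / (16 * (2 * h + 5) * B ^ 4))"
proof -
  have "2 * m4 \<le> 2 * (4 * B\<^sup>2 * (2 * (2 * h + 5) * B\<^sup>2 / h))"
    using order.trans[OF m4_le mult_left_mono[OF m2_le, of "4 * B\<^sup>2"]] by simp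
  also have "\<dots> = 16 * (2 * h + 5) * B ^ 4 / h" by (simp add: power4_eq_xxxx power2_eq_square)
  finally have "sqrt (2 * m4) \<le> sqrt (16 * (2 * h + 5) * B ^ 4 / h)" by simp
  then have "1 / sqrt (16 * (2 * h + 5) * B ^ 4 / h) \<le> \<delta>"
    unfolding \<delta>_def using m4_pos B_pos h_pos by (intro divide_left_mono mult_pos_pos) auto
  moreover have "1 / sqrt (16 * (2 * h + 5) * B ^ 4 / h) = sqrt (h / (16 * (2 * h + 5) * B ^ 4))"
    by (simp add: real_sqrt_divide)
  ultimately show ?thesis by simp
qed

definition weight :: "int \<Rightarrow> real" where "weight j = \<delta> * (\<mu> j)\<^sup>2"

lemma weight_le: "\<bar>weight j\<bar> \<le> 4 * B\<^sup>2 * \<delta>"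
  using power_mono[OF abs_kernel_ft_le, of "of_int j * h" 2] \<delta>_pos
  by (simp add: weight_def power_mult_distrib mult.commute)

lemma weight_squared: "(\<lambda>N. \<Sum>j\<in>{- int N..int N}. (weight j)\<^sup>2) \<longlonglongrightarrow> 1 / 2"
proof -
  have "((\<lambda>j. \<delta>\<^sup>2 * (\<mu> j) ^ 4) has_sum (\<delta>\<^sup>2 * m4)) UNIV"
    by (intro has_sum_cmult_right m4_has_sum)
  moreover have "\<delta>\<^sup>2 * m4 = 1 / 2"
    using m4_pos by (simp add: \<delta>_def power_divide)
  moreover have "\<delta>\<^sup>2 * (\<mu> j) ^ 4 = (weight j)\<^sup>2" for j
    by (simp add: weight_def power_mult_distrib flip: power_mult)
  ultimately show ?thesis
    by (intro has_sum_symmetric_intervals) simp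
qed

text \<open>Centred and scaled by the exact mean and variance under the hypothesis, and not by the
  limiting ones as in the statistic \<open>T\<^sub>n\<close>: both generate the same tests.\<close>

definition standardized :: "real \<Rightarrow> (real \<Rightarrow> real) \<Rightarrow> real" where
  "standardized \<tau> y = \<delta> / \<tau>\<^sup>2 * (L2_nrm y)\<^sup>2 - \<delta> * m2"

end

text \<open>Chebyshev's inequality for an almost sure limit: by Fatou's lemma the bound on second
  moments passes to \<open>L\<close>, so neither mean square convergence nor the law of
  \<open>L\<close> has to be established.\<close>

lemma (in prob_space) prob_abs_limit_ge_le:
  fixes X :: "nat \<Rightarrow> 'a \<Rightarrow> real"
  assumes [measurable]: "\<And>N. X N \<in> borel_measurable M" "L \<in> borel_measurable M"
    and int: "\<And>N. integrable M (\<lambda>\<omega>. (X N \<omega>)\<^sup>2)" and C: "\<And>N. expectation (\<lambda>\<omega>. (X N \<omega>)\<^sup>2) \<le> C"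
    and lim: "AE \<omega> in M. (\<lambda>N. X N \<omega>) \<longlonglongrightarrow> L \<omega>" and e: "e > 0"
  shows "prob {\<omega> \<in> space M. \<bar>L \<omega>\<bar> \<ge> e} \<le> C / e\<^sup>2"
proof -
  have "expectation (\<lambda>\<omega>. (X 0 \<omega>)\<^sup>2) \<ge> 0" by (rule Bochner_Integration.integral_nonneg) simp
  then have C0: "C \<ge> 0" using C[of 0] by linarith
  have "(\<integral>\<^sup>+\<omega>. ennreal ((L \<omega>)\<^sup>2) \<partial>M) = (\<integral>\<^sup>+\<omega>. liminf (\<lambda>N. ennreal ((X N \<omega>)\<^sup>2)) \<partial>M)"
  proof (rule nn_integral_cong_AE)
    show "AE \<omega> in M. ennreal ((L \<omega>)\<^sup>2) = liminf (\<lambda>N. ennreal ((X N \<omega>)\<^sup>2))"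
      using lim
    proof eventually_elim
      case (elim \<omega>)
      then have "(\<lambda>N. ennreal ((X N \<omega>)\<^sup>2)) \<longlonglongrightarrow> ennreal ((L \<omega>)\<^sup>2)"
        by (intro tendsto_ennrealI tendsto_intros)
      then show ?case by (intro lim_imp_Liminf[symmetric] trivial_limit_sequentially)
    qed
  qed
  also have "\<dots> \<le> liminf (\<lambda>N. \<integral>\<^sup>+\<omega>. ennreal ((X N \<omega>)\<^sup>2) \<partial>M)"
    by (rule nn_integral_liminf) measurable
  also have "\<dots> \<le> liminf (\<lambda>N. ennreal C)"
  proof (intro Liminf_mono always_eventually allI)
    fix N
    have "(\<integral>\<^sup>+\<omega>. ennreal ((X N \<omega>)\<^sup>2) \<partial>M) = ennreal (expectation (\<lambda>\<omega>. (X N \<omega>)\<^sup>2))"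
      by (rule nn_integral_eq_integral[OF int]) simp
    then show "(\<integral>\<^sup>+\<omega>. ennreal ((X N \<omega>)\<^sup>2) \<partial>M) \<le> ennreal C" using C by (simp add: ennreal_leI)
  qed
  also have "\<dots> = ennreal C" by (simp add: Liminf_const)
  finally have *: "(\<integral>\<^sup>+\<omega>. ennreal ((L \<omega>)\<^sup>2) \<partial>M) \<le> ennreal C" .
  have "emeasure M {\<omega> \<in> space M. \<bar>L \<omega>\<bar> \<ge> e} \<le> emeasure M ({\<omega> \<in> space M. 1 \<le> ennreal (1 / e\<^sup>2) * ennreal ((L \<omega>)\<^sup>2)} \<inter> space M)"
  proof (intro emeasure_mono subsetI)
    fix \<omega> assume \<omega>: "\<omega> \<in> {\<omega> \<in> space M. \<bar>L \<omega>\<bar> \<ge> e}"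
    then have "e\<^sup>2 \<le> (L \<omega>)\<^sup>2" using power_mono[of e "\<bar>L \<omega>\<bar>" 2] e by simp
    then have "1 \<le> 1 / e\<^sup>2 * (L \<omega>)\<^sup>2" using e by (simp add: field_simps)
    then show "\<omega> \<in> {\<omega> \<in> space M. 1 \<le> ennreal (1 / e\<^sup>2) * ennreal ((L \<omega>)\<^sup>2)} \<inter> space M"
      using \<omega> by (simp flip: ennreal_mult'' add: ennreal_1[symmetric] ennreal_leI del: ennreal_1)
  qed measurable
  also have "\<dots> \<le> ennreal (1 / e\<^sup>2) * (\<integral>\<^sup>+\<omega>. ennreal ((L \<omega>)\<^sup>2) * indicator (space M) \<omega> \<partial>M)"
    by (intro order.trans[OF _ nn_integral_Markov_inequality] emeasure_mono) auto
  also have "(\<integral>\<^sup>+\<omega>. ennreal ((L \<omega>)\<^sup>2) * indicator (space M) \<omega> \<partial>M) = (\<integral>\<^sup>+\<omega>. ennreal ((L \<omega>)\<^sup>2) \<partial>M)"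
    by (intro nn_integral_cong) simp
  also have "ennreal (1 / e\<^sup>2) * \<dots> \<le> ennreal (1 / e\<^sup>2) * ennreal C"
    by (intro mult_left_mono *) simp
  also have "\<dots> = ennreal (C / e\<^sup>2)" using C0 by (simp flip: ennreal_mult'')
  finally show ?thesis
    using C0 by (simp add: emeasure_eq_measure)
qed

locale unit_observation = kernel_observation M W K B h \<sigma> n f F + unit_kernel K B h
  for M :: "'w measure" and W :: "(real \<Rightarrow> real) \<Rightarrow> 'w \<Rightarrow> real" and K B h \<sigma> n f F +
  assumes \<sigma>_pos: "\<sigma> > 0" and n_pos: "n > 0"
begin

lemma \<tau>_pos: "\<tau> > 0"
  using \<sigma>_pos n_pos by (simp add: \<tau>_def)

definition stat :: "'w \<Rightarrow> real" where
  "stat \<omega> = standardized \<tau> (\<lambda>t. F t \<omega>)"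

lemma stat_measurable [measurable]: "stat \<in> borel_measurable M"
  unfolding stat_def standardized_def by measurable

lemma stat_limit:
  "AE \<omega> in M. (\<lambda>N. \<Sum>j\<in>{- int N..int N}.
      weight j / \<tau>\<^sup>2 * (L2_inner f (cas j) + \<tau> * \<xi> j \<omega>)\<^sup>2 - weight j) \<longlonglongrightarrow> stat \<omega>"
  using estimator_norm
proof eventually_elim
  case (elim \<omega>)
  have "((\<lambda>j. \<delta> / \<tau>\<^sup>2 * (\<mu> j * (L2_inner f (cas j) + \<tau> * \<xi> j \<omega>))\<^sup>2 + (- \<delta>) * (\<mu> j)\<^sup>2) has_sum
      (\<delta> / \<tau>\<^sup>2 * (L2_nrm (\<lambda>t. F t \<omega>))\<^sup>2 + (- \<delta>) * m2)) UNIV"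
    by (intro has_sum_add has_sum_cmult_right elim m2_has_sum)
  from has_sum_symmetric_intervals[OF this] show ?case
    by (simp add: stat_def standardized_def weight_def power_mult_distrib mult.assoc)
qed

definition signal :: real where
  "signal = (\<Sum>\<^sub>\<infinity>j. (\<mu> j * L2_inner f (cas j))\<^sup>2)"

lemma signal_has_sum: "((\<lambda>j. (\<mu> j * L2_inner f (cas j))\<^sup>2) has_sum signal) UNIV"
  unfolding signal_def by (intro has_sum_infsum weighted_summable f_L2)

text \<open>Up to the deterministic drift, the signal enters through a limit of Gaussian variables of
  variance at most \<open>16 B\<^sup>2 \<delta>\<close> times the drift.\<close>

lemma stat_shift:
  assumes F0: "kernel_estimator M (observation W \<sigma> n (\<lambda>_. 0)) K h F0" and e: "e > 0"
  defines "drift \<equiv> \<delta> / \<tau>\<^sup>2 * signal"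
  shows "prob {\<omega> \<in> space M. \<bar>stat \<omega> - standardized \<tau> (\<lambda>t. F0 t \<omega>) - drift\<bar> \<ge> e} \<le> 16 * B\<^sup>2 * \<delta> * drift / e\<^sup>2"
proof -
  interpret Z: unit_observation M W K B h \<sigma> n "\<lambda>_. 0" F0
    by unfold_locales (use F0 \<sigma>_pos n_pos in auto)
  define g where "g j = L2_inner f (cas j)" for j
  \<comment> \<open>The coefficient of \<open>\<xi> j\<close> in the cross term of the expanded
    square.\<close>
  define s where "s j = 2 / \<tau> * weight j * g j" for j
  show ?thesis
  proof (rule prob_abs_limit_ge_le[where X = "\<lambda>N \<omega>. \<Sum>j\<in>{- int N..int N}. s j * \<xi> j \<omega>"])
    fix N
    show "integrable M (\<lambda>\<omega>. (\<Sum>j\<in>{- int N..int N}. s j * \<xi> j \<omega>)\<^sup>2)"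
      by (rule second_moment_\<xi>_sum) simp
    have "expectation (\<lambda>\<omega>. (\<Sum>j\<in>{- int N..int N}. s j * \<xi> j \<omega>)\<^sup>2) = (\<Sum>j\<in>{- int N..int N}. (s j)\<^sup>2)"
      by (rule second_moment_\<xi>_sum) simp
    also have "\<dots> \<le> (\<Sum>j\<in>{- int N..int N}. 16 * B\<^sup>2 * \<delta> * (\<delta> / \<tau>\<^sup>2) * (\<mu> j * g j)\<^sup>2)"
    proof (rule sum_mono)
      fix j
      \<comment> \<open>One factor \<open>(\<mu> j)\<^sup>2\<close> is split off and bounded by
        \<open>(2 * B)\<^sup>2\<close>; the other stays with \<open>g j\<close> to rebuild the
        drift.\<close>
      have "(s j)\<^sup>2 = 4 * (\<delta> / \<tau>)\<^sup>2 * (\<mu> j)\<^sup>2 * (\<mu> j * g j)\<^sup>2"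
        by (simp add: s_def weight_def power_mult_distrib power_divide power2_eq_square)
      also have "\<dots> \<le> 4 * (\<delta> / \<tau>)\<^sup>2 * (2 * B)\<^sup>2 * (\<mu> j * g j)\<^sup>2"
        using power_mono[OF abs_kernel_ft_le, of "of_int j * h" 2]
        by (intro mult_right_mono mult_left_mono) auto
      also have "\<dots> = 16 * B\<^sup>2 * \<delta> * (\<delta> / \<tau>\<^sup>2) * (\<mu> j * g j)\<^sup>2"
        by (simp add: power2_eq_square)
      finally show "(s j)\<^sup>2 \<le> 16 * B\<^sup>2 * \<delta> * (\<delta> / \<tau>\<^sup>2) * (\<mu> j * g j)\<^sup>2" .
    qed
    also have "\<dots> \<le> 16 * B\<^sup>2 * \<delta> * (\<delta> / \<tau>\<^sup>2) * signal"
      using \<delta>_pos \<tau>_pos unfolding sum_distrib_left[symmetric] g_def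
      by (intro mult_left_mono has_sum_mono_neutral[OF has_sum_finite signal_has_sum]) auto
    finally show "expectation (\<lambda>\<omega>. (\<Sum>j\<in>{- int N..int N}. s j * \<xi> j \<omega>)\<^sup>2) \<le> 16 * B\<^sup>2 * \<delta> * drift"
      by (simp add: drift_def mult.assoc)
  next
    have "((\<lambda>j. \<delta> / \<tau>\<^sup>2 * (\<mu> j * g j)\<^sup>2) has_sum drift) UNIV"
      unfolding drift_def g_def by (intro has_sum_cmult_right signal_has_sum)
    from has_sum_symmetric_intervals[OF this]
    have sh: "(\<lambda>N. \<Sum>j\<in>{- int N..int N}. \<delta> / \<tau>\<^sup>2 * (\<mu> j * g j)\<^sup>2) \<longlonglongrightarrow> drift" .
    show "AE \<omega> in M. (\<lambda>N. \<Sum>j\<in>{- int N..int N}. s j * \<xi> j \<omega>) \<longlonglongrightarrow> stat \<omega> - standardized \<tau> (\<lambda>t. F0 t \<omega>) - drift"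
      using stat_limit Z.stat_limit
    proof eventually_elim
      case (elim \<omega>)
      \<comment> \<open>Both statistics are driven by the same noise, so the quadratic terms in
        \<open>\<xi> j\<close> cancel and only the cross term survives.\<close>
      have "weight j / \<tau>\<^sup>2 * (g j + \<tau> * \<xi> j \<omega>)\<^sup>2 - weight j - (weight j / \<tau>\<^sup>2 * (0 + \<tau> * \<xi> j \<omega>)\<^sup>2 - weight j)
          - \<delta> / \<tau>\<^sup>2 * (\<mu> j * g j)\<^sup>2 = s j * \<xi> j \<omega>" for j
        using \<tau>_pos by (simp add: s_def weight_def field_simps power2_eq_square)
      then show ?case
        using tendsto_diff[OF tendsto_diff[OF elim] sh]
        by (simp add: Z.stat_def g_def sum_subtractf[symmetric])
    qed
    have [measurable]: "(\<lambda>\<omega>. standardized \<tau> (\<lambda>t. F0 t \<omega>)) \<in> borel_measurable M"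
      using Z.stat_measurable unfolding Z.stat_def[abs_def] .
    show "(\<lambda>\<omega>. stat \<omega> - standardized \<tau> (\<lambda>t. F0 t \<omega>) - drift) \<in> borel_measurable M"
      by measurable
  qed (use e in auto)
qed

end

subsection \<open>Complex Fourier coefficients and the Hartley basis\<close>

definition cos_coeff :: "(real \<Rightarrow> real) \<Rightarrow> int \<Rightarrow> real" where
  "cos_coeff f j = (LINT t|unit_lebesgue. f t * cos (2 * pi * of_int j * t))"

definition sin_coeff :: "(real \<Rightarrow> real) \<Rightarrow> int \<Rightarrow> real" where
  "sin_coeff f j = (LINT t|unit_lebesgue. f t * sin (2 * pi * of_int j * t))"

lemma trig_eq_cis: "trig j t = cis (2 * pi * of_int j * t)"
  unfolding trig_def cis_conv_exp by (simp add: mult_ac)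

context
  fixes f :: "real \<Rightarrow> real"
  assumes f: "f \<in> L2_unit"
begin

lemma integrable_cos_sin:
  "integrable unit_lebesgue (\<lambda>t. f t * cos (2 * pi * of_int j * t))"
  "integrable unit_lebesgue (\<lambda>t. f t * sin (2 * pi * of_int j * t))"
  by (auto intro!: integrable_mult_L2[OF f] bounded_L2_unit[of _ 1])

lemma fourier_coeff_eq: "fourier_coeff f j = Complex (cos_coeff f j) (- sin_coeff f j)"
proof -
  have "fourier_coeff f j = (CLINT t|unit_lebesgue. of_real (f t * cos (2 * pi * of_int j * t)) - \<i> * of_real (f t * sin (2 * pi * of_int j * t)))"
    unfolding fourier_coeff_def set_integral_unit trig_eq_cis
    by (intro Bochner_Integration.integral_cong refl) (simp add: complex_eq_iff)
  also have "\<dots> = complex_of_real (cos_coeff f j) - \<i> * complex_of_real (sin_coeff f j)"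
    using integrable_cos_sin unfolding cos_coeff_def sin_coeff_def
    by (simp only: Bochner_Integration.integral_diff integrable_mult_right integrable_of_real integral_mult_right_zero integral_complex_of_real)
  finally show ?thesis by (simp add: complex_eq_iff)
qed

lemma cas_coeff: "L2_inner f (cas j) = cos_coeff f j + sin_coeff f j"
  unfolding L2_inner_eq cos_coeff_def sin_coeff_def cas_def
  using integrable_cos_sin by (simp add: distrib_left)

lemma cas_coeff_minus: "L2_inner f (cas (- j)) = cos_coeff f j - sin_coeff f j"
  unfolding cas_coeff by (simp add: cos_coeff_def sin_coeff_def)

lemma cmod_fourier_coeff:
  "(cmod (fourier_coeff f j))\<^sup>2 = ((L2_inner f (cas j))\<^sup>2 + (L2_inner f (cas (- j)))\<^sup>2) / 2"
  unfolding fourier_coeff_eq cas_coeff_minus cmod_power2 unfolding cas_coeff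
  by (simp add: power2_eq_square algebra_simps)

text \<open>Termwise, the squared modulus is the mean of the squared Hartley coefficients at
  \<open>j\<close> and \<open>- j\<close>; the index set is symmetric, so the two sums
  agree.\<close>

lemma infsum_fourier_coeff:
  "(\<Sum>\<^sub>\<infinity>j\<in>{j. real_of_int \<bar>j\<bar> > x}. (cmod (fourier_coeff f j))\<^sup>2) =
   (\<Sum>\<^sub>\<infinity>j\<in>{j. real_of_int \<bar>j\<bar> > x}. (L2_inner f (cas j))\<^sup>2)"
proof -
  let ?S = "{j. real_of_int \<bar>j\<bar> > x}" and ?c = "\<lambda>j. (L2_inner f (cas j))\<^sup>2"
  have bij: "bij_betw uminus ?S ?S"
    by (rule bij_betwI[where g = uminus]) auto
  have s: "?c summable_on ?S"
    using has_sum_imp_summable[OF parseval[OF f]] by (rule summable_on_subset_banach) simp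
  then have s': "(\<lambda>j. ?c (- j)) summable_on ?S"
    using summable_on_reindex_bij_betw[OF bij, of ?c] by simp
  have "(\<Sum>\<^sub>\<infinity>j\<in>?S. (cmod (fourier_coeff f j))\<^sup>2) = (\<Sum>\<^sub>\<infinity>j\<in>?S. 1/2 * ?c j + 1/2 * ?c (- j))"
    by (simp add: cmod_fourier_coeff add_divide_distrib)
  also have "\<dots> = (\<Sum>\<^sub>\<infinity>j\<in>?S. 1/2 * ?c j) + (\<Sum>\<^sub>\<infinity>j\<in>?S. 1/2 * ?c (- j))"
    by (intro infsum_add summable_on_cmult_right s s')
  also have "\<dots> = 1/2 * (\<Sum>\<^sub>\<infinity>j\<in>?S. ?c j) + 1/2 * (\<Sum>\<^sub>\<infinity>j\<in>?S. ?c (- j))"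
    by (simp only: infsum_cmult_right')
  also have "(\<Sum>\<^sub>\<infinity>j\<in>?S. ?c (- j)) = (\<Sum>\<^sub>\<infinity>j\<in>?S. ?c j)"
    using infsum_reindex_bij_betw[OF bij, of ?c] by simp
  finally show ?thesis by simp
qed

text \<open>Complex and Hartley partial sums coincide once the terms at \<open>j\<close> and
  \<open>- j\<close> are averaged, since the index range is symmetric.\<close>

lemma fourier_tail_eq: "fourier_tail i f t = f t - (\<Sum>j\<in>{- int i..int i}. L2_inner f (cas j) * cas j t)"
proof -
  let ?I = "{- int i..int i}" and ?g = "\<lambda>j. L2_inner f (cas j) * cas j t"
  have "(\<Sum>j\<in>?I. ?g (- j)) = (\<Sum>j\<in>?I. ?g j)"
    by (rule sum.reindex_bij_witness[where i = uminus and j = uminus]) auto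
  then have "(\<Sum>j\<in>?I. ?g j) = (\<Sum>j\<in>?I. (?g j + ?g (- j)) / 2)"
    by (simp add: sum.distrib flip: sum_divide_distrib)
  also have "\<dots> = (\<Sum>j\<in>?I. Re (fourier_coeff f j * trig j t))"
  proof (intro sum.cong refl)
    fix j
    have 1: "cas j t = cos (2 * pi * of_int j * t) + sin (2 * pi * of_int j * t)"
      "cas (- j) t = cos (2 * pi * of_int j * t) - sin (2 * pi * of_int j * t)"
      by (simp_all add: cas_def)
    show "(?g j + ?g (- j)) / 2 = Re (fourier_coeff f j * trig j t)"
      unfolding 1 cas_coeff_minus fourier_coeff_eq trig_eq_cis unfolding cas_coeff
      by (simp add: algebra_simps)
  qed
  finally show ?thesis by (simp add: fourier_tail_def)
qed

lemma fourier_tail_L2: "fourier_tail i f \<in> L2_unit"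
  unfolding fourier_tail_eq[abs_def]
  by (intro L2_unit_diff f L2_unit_sum L2_unit_cmult cas_L2_unit)

lemma cas_coeff_tail: "L2_inner (fourier_tail i f) (cas j) = (if \<bar>j\<bar> > int i then L2_inner f (cas j) else 0)"
proof -
  let ?s = "\<lambda>t. \<Sum>l\<in>{- int i..int i}. L2_inner f (cas l) * cas l t"
  have "?s \<in> L2_unit" by (intro L2_unit_sum L2_unit_cmult cas_L2_unit)
  then have "L2_inner (fourier_tail i f) (cas j) = L2_inner f (cas j) - L2_inner ?s (cas j)"
    unfolding fourier_tail_eq[abs_def] by (intro L2_inner_diff f cas_L2_unit)
  also have "L2_inner ?s (cas j) = (\<Sum>l\<in>{- int i..int i}. L2_inner f (cas l) * (if l = j then 1 else 0))"
    by (subst L2_inner_sum) (auto intro: L2_unit_cmult simp: L2_inner_cmult L2_inner_cas)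
  also have "\<dots> = (if \<bar>j\<bar> > int i then 0 else L2_inner f (cas j))"
    by (auto simp: if_distrib[of "\<lambda>x. _ * x"] cong: if_cong)
  finally show ?thesis by simp
qed

lemma fourier_tail_norm:
  "(L2_nrm (fourier_tail i f))\<^sup>2 = (\<Sum>\<^sub>\<infinity>j\<in>{j. real_of_int \<bar>j\<bar> > real i}. (L2_inner f (cas j))\<^sup>2)"
proof -
  have "(L2_nrm (fourier_tail i f))\<^sup>2 = (\<Sum>\<^sub>\<infinity>j. (L2_inner (fourier_tail i f) (cas j))\<^sup>2)"
    unfolding L2_nrm_squared using parseval[OF fourier_tail_L2] by (rule infsumI[symmetric])
  also have "\<dots> = (\<Sum>\<^sub>\<infinity>j\<in>{j. real_of_int \<bar>j\<bar> > real i}. (L2_inner f (cas j))\<^sup>2)"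
    by (rule infsum_cong_neutral) (auto simp: cas_coeff_tail split: if_splits)
  finally show ?thesis .
qed

end

lemma L2_per_L2_unit: "f \<in> L2_per \<Longrightarrow> f \<in> L2_unit"
  by (simp add: L2_per_def)

lemma fourier_tail_L2_per: "f \<in> L2_per \<Longrightarrow> fourier_tail i f \<in> L2_per"
  using fourier_tail_L2[of f i] by (simp add: L2_per_def fourier_tail_eq[of f] cas_periodic)

subsection \<open>Tests based on the kernel statistic\<close>

lemma generated_by_affine:
  assumes "p > 0" and T: "\<And>y. T y = p * (S y) + q"
  shows "generated_by T R \<longleftrightarrow> generated_by S R"
proof
  assume "generated_by T R"
  then obtain x where "\<forall>y. R y \<longleftrightarrow> T y > x" by (auto simp: generated_by_def)
  then have "\<forall>y. R y \<longleftrightarrow> S y > (x - q) / p"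
    using assms(1) by (simp add: T field_simps)
  then show "generated_by S R" unfolding generated_by_def by blast
next
  assume "generated_by S R"
  then obtain x where "\<forall>y. R y \<longleftrightarrow> S y > x" by (auto simp: generated_by_def)
  then have "\<forall>y. R y \<longleftrightarrow> T y > p * x + q"
    using assms(1) by (simp add: T)
  then show "generated_by T R" unfolding generated_by_def by blast
qed

text \<open>The convolution of \<open>K\<close> with itself has integral 1 by Fubini's theorem, so
  it is not almost everywhere 0. Positivity makes \<open>kernel_stat\<close> strictly increasing in
  the squared norm.\<close>

lemma kernel_kappa_pos:
  assumes "smoothing_kernel K"
  shows "kernel_kappa K > 0"
proof -
  have [measurable]: "K \<in> borel_measurable borel" and int1: "(LINT t|lborel. K t) = 1"
    and supp: "\<And>t. t \<notin> {-1..1} \<Longrightarrow> K t = 0"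
    using assms by (auto simp: smoothing_kernel_def)
  obtain B where B: "\<And>t. \<bar>K t\<bar> \<le> B"
    using assms by (auto simp: smoothing_kernel_def bounded_iff)
  have B0: "B \<ge> 0" using B[of 0] by linarith
  have le: "\<bar>K (t - s) * K s\<bar> \<le> B\<^sup>2 * (indicator {-2..2} t * indicator {-1..1} s)" for t s
  proof (cases "t \<in> {-2..2} \<and> s \<in> {-1..1}")
    case True
    then show ?thesis using B B0 by (auto simp: abs_mult power2_eq_square intro!: mult_mono)
  next
    case False
    then have "s \<notin> {-1..1} \<or> t - s \<notin> {-1..1}" by auto
    then have "K (t - s) * K s = 0" using supp by auto
    then show ?thesis by (simp only:) (simp add: indicator_def)
  qed
  have "emeasure (lborel \<Otimes>\<^sub>M lborel) ({-2..2::real} \<times> {-1..1::real}) < \<infinity>"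
    by (subst lborel.emeasure_pair_measure_Times) (auto simp: ennreal_mult_less_top)
  then have box: "integrable (lborel \<Otimes>\<^sub>M lborel) (indicator ({-2..2::real} \<times> {-1..1::real}) :: _ \<Rightarrow> real)"
    by (intro integrable_real_indicator) auto
  have int: "integrable (lborel \<Otimes>\<^sub>M lborel) (\<lambda>(t, s). K (t - s) * K s)"
  proof (rule Bochner_Integration.integrable_bound)
    show "integrable (lborel \<Otimes>\<^sub>M lborel) (\<lambda>x. B\<^sup>2 * indicator ({-2..2::real} \<times> {-1..1::real}) x :: real)"
      using box by simp
    show "AE x in lborel \<Otimes>\<^sub>M lborel. norm (case x of (t, s) \<Rightarrow> K (t - s) * K s) \<le> norm (B\<^sup>2 * indicator ({-2..2::real} \<times> {-1..1::real}) x :: real)"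
      using le by (intro AE_I2) (auto simp: indicator_times split: prod.splits intro: order.trans[OF _ abs_ge_self])
  qed measurable
  define G where "G t = (LINT s|lborel. K (t - s) * K s)" for t
  have Gm [measurable]: "G \<in> borel_measurable borel" unfolding G_def by measurable
  have Gint: "(LINT t|lborel. G t) = 1"
  proof -
    have "(LINT t|lborel. G t) = (LINT s|lborel. LINT t|lborel. K (t - s) * K s)"
      unfolding G_def using lborel_pair.Fubini_integral[OF int] by simp
    also have "\<dots> = (LINT s|lborel. K s)"
    proof (intro Bochner_Integration.integral_cong refl)
      fix s :: real
      have "(LINT t|lborel. K t) = \<bar>1\<bar> *\<^sub>R (LINT t|lborel. K (- s + 1 * t))"
        by (rule lborel_integral_real_affine) simp
      then show "(LINT t|lborel. K (t - s) * K s) = K s" using int1 by simp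
    qed
    finally show ?thesis using int1 by simp
  qed
  have Gle: "\<bar>G t\<bar> \<le> 2 * B\<^sup>2 * indicator {-2..2} t" for t
  proof -
    have i: "integrable lborel (\<lambda>s::real. B\<^sup>2 * (indicator {-2..2} t * indicator {-1..1} s) :: real)"
      by (intro integrable_mult_right integrable_real_indicator) auto
    have "\<bar>G t\<bar> \<le> (LINT s|lborel. \<bar>K (t - s) * K s\<bar>)"
      unfolding G_def by (rule integral_abs_bound)
    also have "\<dots> \<le> (LINT s::real|lborel. B\<^sup>2 * (indicator {-2..2} t * indicator {-1..1} s))"
      by (rule integral_mono'[OF i le]) simp
    finally show ?thesis by simp
  qed
  have G2: "integrable lborel (\<lambda>t. (G t)\<^sup>2)"
  proof (rule Bochner_Integration.integrable_bound)
    show "integrable lborel (\<lambda>t::real. (2 * B\<^sup>2)\<^sup>2 * indicator {-2..2} t :: real)"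
      by (intro integrable_mult_right integrable_real_indicator) auto
    show "AE t in lborel. norm ((G t)\<^sup>2) \<le> norm ((2 * B\<^sup>2)\<^sup>2 * indicator {-2..2} t :: real)"
    proof (intro AE_I2)
      fix t :: real
      have "(G t)\<^sup>2 \<le> (2 * B\<^sup>2 * indicator {-2..2} t)\<^sup>2" using power_mono[OF Gle, of t 2] by simp
      also have "\<dots> = (2 * B\<^sup>2)\<^sup>2 * indicator {-2..2} t"
        by (simp add: power_mult_distrib indicator_def)
      finally show "norm ((G t)\<^sup>2) \<le> norm ((2 * B\<^sup>2)\<^sup>2 * indicator {-2..2} t :: real)" by simp
    qed
  qed measurable
  have "(LINT t|lborel. (G t)\<^sup>2) \<noteq> 0"
  proof
    assume "(LINT t|lborel. (G t)\<^sup>2) = 0"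
    then have "AE t in lborel. (G t)\<^sup>2 = 0"
      using integral_nonneg_eq_0_iff_AE[OF G2] by simp
    then have "(LINT t|lborel. G t) = (LINT t|(lborel :: real measure). 0)"
      by (intro integral_cong_AE) auto
    then show False using Gint by simp
  qed
  moreover have "(LINT t|lborel. (G t)\<^sup>2) \<ge> 0" by (rule Bochner_Integration.integral_nonneg) simp
  ultimately have "(LINT t|lborel. (G t)\<^sup>2) > 0" by linarith
  then show ?thesis by (simp add: kernel_kappa_def G_def)
qed

locale kernel_test = white_noise_space M W
  for M :: "'w measure" and W :: "(real \<Rightarrow> real) \<Rightarrow> 'w \<Rightarrow> real" +
  fixes K :: "real \<Rightarrow> real" and B \<sigma> :: real and h :: "nat \<Rightarrow> real"
    and F :: "nat \<Rightarrow> (real \<Rightarrow> real) \<Rightarrow> real \<Rightarrow> 'w \<Rightarrow> real"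
  assumes smoothing: "smoothing_kernel K" and K_le: "\<And>t. \<bar>K t\<bar> \<le> B" and \<sigma>_pos: "\<sigma> > 0"
    and h_pos: "\<And>n. n \<ge> 1 \<Longrightarrow> h n > 0" and h_lim: "h \<longlonglongrightarrow> 0"
    and est: "\<And>n f. n \<ge> 1 \<Longrightarrow> f \<in> L2_per \<Longrightarrow> kernel_estimator M (observation W \<sigma> n f) K (h n) (F n f)"
begin

lemma unit_kernel: "e > 0 \<Longrightarrow> unit_kernel K B e"
  using smoothing K_le by unfold_locales (auto simp: smoothing_kernel_def)

lemma zero_L2_per: "(\<lambda>_. 0) \<in> L2_per"
  by (simp add: L2_per_def)

lemma unit_observation: "n \<ge> 1 \<Longrightarrow> f \<in> L2_per \<Longrightarrow> unit_observation M W K B (h n) \<sigma> n f (F n f)"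
  using unit_kernel[OF h_pos] est \<sigma>_pos L2_per_L2_unit
  unfolding unit_observation_def unit_observation_axioms_def kernel_observation_def
    kernel_observation_axioms_def unit_kernel_def
  by (auto intro: white_noise_space_axioms)

definition test_stat :: "nat \<Rightarrow> (real \<Rightarrow> real) \<Rightarrow> real" where
  "test_stat n = unit_kernel.standardized K (h n) (\<sigma> / sqrt (real n))"

definition S :: "nat \<Rightarrow> (real \<Rightarrow> real) \<Rightarrow> 'w \<Rightarrow> real" where
  "S n f \<omega> = test_stat n (\<lambda>t. F n f t \<omega>)"

abbreviation df :: "nat \<Rightarrow> (real \<Rightarrow> real) \<Rightarrow> real \<Rightarrow> real" where
  "df n f x \<equiv> prob {\<omega> \<in> space M. S n f \<omega> \<le> x}"

definition scale :: "nat \<Rightarrow> real" where "scale n = unit_kernel.\<delta> K (h n)"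

definition drift :: "nat \<Rightarrow> (real \<Rightarrow> real) \<Rightarrow> real" where
  "drift n f = scale n / (\<sigma> / sqrt (real n))\<^sup>2 * (\<Sum>\<^sub>\<infinity>j. (kernel_ft K (of_int j * h n) * L2_inner f (cas j))\<^sup>2)"

lemma B_pos: "B > 0" by (rule unit_kernel.B_pos[OF unit_kernel[of 1]]) simp

lemma scale_pos: "n \<ge> 1 \<Longrightarrow> scale n > 0"
  unfolding scale_def by (rule unit_kernel.\<delta>_pos[OF unit_kernel[OF h_pos]])

lemma scale_le: "n \<ge> 1 \<Longrightarrow> scale n \<le> sqrt (64 * pi * B * h n)"
  unfolding scale_def by (rule unit_kernel.\<delta>_le[OF unit_kernel[OF h_pos]])

lemma scale_ge: "n \<ge> 1 \<Longrightarrow> scale n \<ge> sqrt (h n / (16 * (2 * h n + 5) * B ^ 4))"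
  unfolding scale_def by (rule unit_kernel.\<delta>_ge[OF unit_kernel[OF h_pos]])

lemma scale_lim: "scale \<longlonglongrightarrow> 0"
proof (rule tendsto_sandwich)
  show "\<forall>\<^sub>F n in sequentially. 0 \<le> scale n"
    using eventually_ge_at_top[of 1] by eventually_elim (rule less_imp_le[OF scale_pos])
  show "\<forall>\<^sub>F n in sequentially. scale n \<le> sqrt (64 * pi * B * h n)"
    using eventually_ge_at_top[of 1] by eventually_elim (rule scale_le)
  have "(\<lambda>n. sqrt (64 * pi * B * h n)) \<longlonglongrightarrow> sqrt (64 * pi * B * 0)"
    by (intro tendsto_intros h_lim)
  then show "(\<lambda>n. sqrt (64 * pi * B * h n)) \<longlonglongrightarrow> 0" by simp
qed simp

lemma S_measurable: "n \<ge> 1 \<Longrightarrow> f \<in> L2_per \<Longrightarrow> S n f \<in> borel_measurable M"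
proof -
  assume *: "n \<ge> 1" "f \<in> L2_per"
  interpret unit_observation M W K B "h n" \<sigma> n f "F n f" by (rule unit_observation[OF *])
  have "S n f = stat" by (rule ext) (simp add: S_def test_stat_def stat_def \<tau>_def)
  then show ?thesis by simp
qed

lemma null_clt: "(\<lambda>n. df n (\<lambda>_. 0) x) \<longlonglongrightarrow> Phi x"
proof -
  \<comment> \<open>The estimator and the positivity of \<open>h\<close> are given from
    \<open>n = 1\<close> on, hence the shift by one.\<close>
  have "(\<lambda>n. df (Suc n) (\<lambda>_. 0) x) \<longlonglongrightarrow> Phi x"
  proof (rule chi_square_clt[where l = "\<lambda>n. unit_kernel.weight K (h (Suc n))" and e = "\<lambda>n. 4 * B\<^sup>2 * scale (Suc n)"])
    fix n :: nat
    interpret unit_observation M W K B "h (Suc n)" \<sigma> "Suc n" "\<lambda>_. 0" "F (Suc n) (\<lambda>_. 0)"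
      by (rule unit_observation) (auto simp: zero_L2_per)
    show "S (Suc n) (\<lambda>_. 0) \<in> borel_measurable M"
      by (rule S_measurable) (auto simp: zero_L2_per)
    have st: "S (Suc n) (\<lambda>_. 0) = stat" by (rule ext) (simp add: S_def test_stat_def stat_def \<tau>_def)
    show "AE \<omega> in M. (\<lambda>N. \<Sum>j\<in>{- int N..int N}. weight j * chi j \<omega>) \<longlonglongrightarrow> S (Suc n) (\<lambda>_. 0) \<omega>"
      using stat_limit
    proof eventually_elim
      case (elim \<omega>)
      have "weight j / \<tau>\<^sup>2 * (L2_inner (\<lambda>_. 0) (cas j) + \<tau> * \<xi> j \<omega>)\<^sup>2 - weight j = weight j * chi j \<omega>" for j
        using \<tau>_pos by (simp add: chi_def power_mult_distrib right_diff_distrib)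
      with elim show ?case by (simp add: st)
    qed
    show "(\<lambda>N. \<Sum>j\<in>{- int N..int N}. (weight j)\<^sup>2) \<longlonglongrightarrow> 1 / 2" by (rule weight_squared)
    show "\<bar>weight j\<bar> \<le> 4 * B\<^sup>2 * scale (Suc n)" for j
      unfolding scale_def by (rule weight_le)
  next
    have "(\<lambda>n. 4 * B\<^sup>2 * scale (Suc n)) \<longlonglongrightarrow> 4 * B\<^sup>2 * 0"
      by (intro tendsto_intros LIMSEQ_Suc scale_lim)
    then show "(\<lambda>n. 4 * B\<^sup>2 * scale (Suc n)) \<longlonglongrightarrow> 0" by simp
  qed
  then show ?thesis by (rule LIMSEQ_imp_Suc)
qed

lemma shift_bound:
  assumes "n \<ge> 1" "f \<in> L2_per" "e > 0"
  shows "prob {\<omega> \<in> space M. \<bar>S n f \<omega> - S n (\<lambda>_. 0) \<omega> - drift n f\<bar> \<ge> e} \<le> 16 * B\<^sup>2 * scale n * drift n f / e\<^sup>2"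
proof -
  interpret unit_observation M W K B "h n" \<sigma> n f "F n f" by (rule unit_observation[OF assms(1,2)])
  have "S n f = stat" by (rule ext) (simp add: S_def test_stat_def stat_def \<tau>_def)
  moreover have "drift n f = \<delta> / \<tau>\<^sup>2 * signal" by (simp add: drift_def scale_def signal_def \<tau>_def)
  ultimately show ?thesis
    using stat_shift[OF est[OF assms(1) zero_L2_per] assms(3)]
    by (simp add: scale_def S_def test_stat_def \<tau>_def)
qed

lemma generated_by_standardized:
  assumes "n \<ge> 1"
  shows "generated_by (kernel_stat \<sigma> K n (h n)) R \<longleftrightarrow> generated_by (test_stat n) R"
proof -
  have hn: "h n > 0" using assms by (rule h_pos)
  interpret unit_kernel K B "h n" by (rule unit_kernel[OF hn])
  let ?p = "real n * sqrt (h n) / (\<sigma>\<^sup>2 * kernel_kappa K)"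
  have "generated_by (kernel_stat \<sigma> K n (h n)) R \<longleftrightarrow> generated_by (\<lambda>y. (L2_nrm y)\<^sup>2) R"
  proof (rule generated_by_affine)
    show "?p > 0" using assms hn \<sigma>_pos kernel_kappa_pos[OF smoothing] by simp
    show "kernel_stat \<sigma> K n (h n) y = ?p * (L2_nrm y)\<^sup>2 + - (?p * (\<sigma>\<^sup>2 / (real n * h n) * (LINT t|lborel. (K t)\<^sup>2)))" for y
      unfolding kernel_stat_def right_diff_distrib by simp
  qed
  also have "\<dots> \<longleftrightarrow> generated_by (test_stat n) R"
  proof (rule generated_by_affine[symmetric])
    show "\<delta> / (\<sigma> / sqrt (real n))\<^sup>2 > 0" using assms \<sigma>_pos \<delta>_pos by simp
    show "test_stat n y = \<delta> / (\<sigma> / sqrt (real n))\<^sup>2 * (L2_nrm y)\<^sup>2 + - (\<delta> * m2)" for y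
      by (simp add: test_stat_def standardized_def)
  qed
  finally show ?thesis .
qed

text \<open>The allowed deviation is half the drift itself and not a fixed amount: Chebyshev's bound
  then decreases in the drift, so the estimate is uniform over signals whose drift may be
  arbitrarily large.\<close>

lemma accept_upper:
  assumes n: "n \<ge> 1" and f: "f \<in> L2_per" and \<rho>: "\<rho> > 0" "drift n f \<ge> \<rho>"
  shows "df n f z \<le> df n (\<lambda>_. 0) (z - \<rho> / 2) + 64 * B\<^sup>2 * scale n / \<rho>"
proof -
  have [measurable]: "S n f \<in> borel_measurable M" "S n (\<lambda>_. 0) \<in> borel_measurable M"
    using S_measurable[OF n] f zero_L2_per by auto
  let ?D = "drift n f"
  let ?A = "{\<omega> \<in> space M. S n (\<lambda>_. 0) \<omega> \<le> z - \<rho> / 2}"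
  let ?E = "{\<omega> \<in> space M. \<bar>S n f \<omega> - S n (\<lambda>_. 0) \<omega> - ?D\<bar> \<ge> ?D / 2}"
  have D: "?D > 0" using \<rho> by simp
  have "b \<le> z - \<rho> / 2" if "a \<le> z" "\<not> \<bar>a - b - ?D\<bar> \<ge> ?D / 2" for a b
    using that \<rho>(2) by linarith
  then have "df n f z \<le> prob (?A \<union> ?E)"
    by (intro finite_measure_mono) auto
  also have "\<dots> \<le> prob ?A + prob ?E" by (intro measure_Un_le) measurable
  also have "prob ?E \<le> 16 * B\<^sup>2 * scale n * ?D / (?D / 2)\<^sup>2"
    using D by (intro shift_bound n f) simp
  also have "\<dots> = 64 * B\<^sup>2 * scale n / ?D" using D by (simp add: field_simps power2_eq_square)
  also have "\<dots> \<le> 64 * B\<^sup>2 * scale n / \<rho>"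
    using \<rho> scale_pos[OF n] by (intro divide_left_mono mult_nonneg_nonneg mult_pos_pos) auto
  finally show ?thesis by simp
qed

text \<open>The thresholds \<open>x n\<close> are arbitrary apart from their null probabilities.
  Normal quantiles \<open>a < a'\<close> are taken at levels strictly between \<open>u\<close> and
  \<open>v\<close>; the thresholds eventually exceed \<open>a'\<close>, and the gap of length
  \<open>2 * \<eta>\<close> absorbs the drift and the random part of the shift. Negative
  \<open>u\<close> is split off because quantiles exist only at levels between 0 and 1.\<close>

lemma accept_lower:
  assumes m: "filterlim m at_top sequentially" "\<And>n. m n \<ge> 1"
    and f: "\<And>n. f n \<in> L2_per" and D: "(\<lambda>n. drift (m n) (f n)) \<longlonglongrightarrow> 0"
    and null: "(\<lambda>n. df (m n) (\<lambda>_. 0) (x n)) \<longlonglongrightarrow> v"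
    and v: "v < 1" and u: "u < v"
  shows "\<forall>\<^sub>F n in sequentially. df (m n) (f n) (x n) > u"
proof (cases "u < 0")
  case True
  then show ?thesis by (simp add: order.strict_trans2[OF True measure_nonneg])
next
  case False
  have "0 < (2 * v + u) / 3" "(2 * v + u) / 3 < 1" "0 < (v + 2 * u) / 3" "(v + 2 * u) / 3 < 1"
    using False u v by auto
  then obtain a a' where a: "Phi a = (v + 2 * u) / 3" "Phi a' = (2 * v + u) / 3"
    using Phi_surj by metis
  have "a < a'"
  proof (rule ccontr)
    assume "\<not> a < a'"
    then have "Phi a' \<le> Phi a" using Phi_strict_mono[of a' a] by (cases "a = a'") auto
    then show False using a u by simp
  qed
  define \<eta> where "\<eta> = (a' - a) / 2"
  have \<eta>: "\<eta> > 0" using \<open>a < a'\<close> by (simp add: \<eta>_def)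
  have clt: "(\<lambda>n. df (m n) (\<lambda>_. 0) y) \<longlonglongrightarrow> Phi y" for y
    using filterlim_compose[OF null_clt m(1)] .
  have meas [measurable]: "S (m n) (f n) \<in> borel_measurable M" "S (m n) (\<lambda>_. 0) \<in> borel_measurable M" for n
    using S_measurable[OF m(2)] f zero_L2_per by auto
  have sc: "(\<lambda>n. scale (m n)) \<longlonglongrightarrow> 0" using filterlim_compose[OF scale_lim m(1)] .
  have "(\<lambda>n. df (m n) (\<lambda>_. 0) a - 16 * B\<^sup>2 * scale (m n) * drift (m n) (f n) / \<eta>\<^sup>2)
      \<longlonglongrightarrow> Phi a - 16 * B\<^sup>2 * 0 * 0 / \<eta>\<^sup>2"
    using \<eta> by (intro tendsto_intros clt sc D) auto
  moreover have "u < Phi a - 16 * B\<^sup>2 * 0 * 0 / \<eta>\<^sup>2" using a u by simp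
  ultimately have 1: "\<forall>\<^sub>F n in sequentially.
      u < df (m n) (\<lambda>_. 0) a - 16 * B\<^sup>2 * scale (m n) * drift (m n) (f n) / \<eta>\<^sup>2"
    by (rule order_tendstoD(1))
  have "(\<lambda>n. df (m n) (\<lambda>_. 0) (x n) - df (m n) (\<lambda>_. 0) a') \<longlonglongrightarrow> v - Phi a'"
    by (intro tendsto_intros clt null)
  then have 2: "\<forall>\<^sub>F n in sequentially. 0 < df (m n) (\<lambda>_. 0) (x n) - df (m n) (\<lambda>_. 0) a'"
    by (rule order_tendstoD) (use a u in auto)
  have 3: "\<forall>\<^sub>F n in sequentially. drift (m n) (f n) < \<eta>" using D \<eta> by (rule order_tendstoD)
  from 1 2 3 show ?thesis
  proof eventually_elim
    case (elim n)
    have ax: "a' < x n"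
    proof (rule ccontr)
      assume "\<not> a' < x n"
      then have "df (m n) (\<lambda>_. 0) (x n) \<le> df (m n) (\<lambda>_. 0) a'"
        by (intro finite_measure_mono) auto
      then show False using elim by simp
    qed
    let ?E = "{\<omega> \<in> space M. \<bar>S (m n) (f n) \<omega> - S (m n) (\<lambda>_. 0) \<omega> - drift (m n) (f n)\<bar> \<ge> \<eta>}"
    have "df (m n) (\<lambda>_. 0) a \<le> prob ({\<omega> \<in> space M. S (m n) (f n) \<omega> \<le> x n} \<union> ?E)"
    proof (intro finite_measure_mono subsetI)
      fix \<omega> assume \<omega>: "\<omega> \<in> {\<omega> \<in> space M. S (m n) (\<lambda>_. 0) \<omega> \<le> a}"
      have "S (m n) (f n) \<omega> \<le> x n" if "\<bar>S (m n) (f n) \<omega> - S (m n) (\<lambda>_. 0) \<omega> - drift (m n) (f n)\<bar> < \<eta>"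
      proof -
        have "S (m n) (f n) \<omega> < a + \<eta> + \<eta>" using that \<omega> elim(3) by auto
        also have "\<dots> = a'" by (simp add: \<eta>_def)
        finally show ?thesis using ax by simp
      qed
      then show "\<omega> \<in> {\<omega> \<in> space M. S (m n) (f n) \<omega> \<le> x n} \<union> ?E" using \<omega> by (auto simp: not_le)
    qed measurable
    also have "\<dots> \<le> df (m n) (f n) (x n) + prob ?E"
      by (intro measure_Un_le) measurable
    also have "prob ?E \<le> 16 * B\<^sup>2 * scale (m n) * drift (m n) (f n) / \<eta>\<^sup>2"
      by (intro shift_bound m f \<eta>)
    finally show ?case using elim(1) by linarith
  qed
qed

end

subsection \<open>Detectable and undetectable signals\<close>

text \<open>The balance behind the critical bandwidth, used with \<open>a = 2 * r - 1\<close> for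
  the normalizing factor, one factor \<open>n\<close> from the noise level and
  \<open>b = - 2 * r\<close> for the signal energy.\<close>

lemma real_powr_product:
  fixes x :: real
  assumes "x > 0" "a + b + 1 = 0"
  shows "x powr a * x * x powr b = 1"
proof -
  have "x powr a * x * x powr b = x powr a * x powr 1 * x powr b" using assms(1) by simp
  also have "\<dots> = x powr (a + 1 + b)" by (simp only: powr_add)
  also have "a + 1 + b = 0" using assms(2) by simp
  finally show ?thesis using assms(1) by simp
qed

lemma sqrt_powr: "sqrt (x powr (2 * a)) = x powr a" for x :: real
  by (simp add: powr_half_sqrt[symmetric] powr_powr)

lemma besov_ball_tail:
  assumes "g \<in> besov_ball s P" "x > 0"
  shows "(\<Sum>\<^sub>\<infinity>j\<in>{j. real_of_int \<bar>j\<bar> > x}. (L2_inner g (cas j))\<^sup>2) \<le> P * x powr (- 2 * s)"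
proof -
  have g: "g \<in> L2_unit" using assms by (auto simp: besov_ball_def intro: L2_per_L2_unit)
  have "x powr (2 * s) * (\<Sum>\<^sub>\<infinity>j\<in>{j. real_of_int \<bar>j\<bar> > x}. (L2_inner g (cas j))\<^sup>2) \<le> P"
    using assms unfolding infsum_fourier_coeff[OF g, symmetric] by (simp add: besov_ball_def)
  then show ?thesis using assms(2) by (simp add: powr_minus field_simps)
qed

text \<open>Constants carry the frequency 0 alone. They show that the sets of alternatives are
  nonempty, so that the supremum of the error probabilities is meaningful over the reals.\<close>

lemma constant_in_besov_ball:
  assumes "P \<ge> 0"
  shows "(\<lambda>_. a) \<in> besov_ball s P" and "L2_nrm (\<lambda>_. a) = \<bar>a\<bar>"
proof -
  have L: "(\<lambda>_. a) \<in> L2_unit" by (rule bounded_L2_unit[of _ "\<bar>a\<bar>"]) auto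
  have c: "L2_inner (\<lambda>_. a) (cas j) = (if j = 0 then a else 0)" for j
    by (simp add: L2_inner_eq integral_cas)
  have "(\<Sum>\<^sub>\<infinity>j\<in>{j. real_of_int \<bar>j\<bar> > x}. (cmod (fourier_coeff (\<lambda>_. a) j))\<^sup>2) = 0" if "x > 0" for x
    unfolding infsum_fourier_coeff[OF L] using that by (intro infsum_0) (auto simp: c)
  then show "(\<lambda>_. a) \<in> besov_ball s P"
    using assms L by (simp add: besov_ball_def L2_per_def)
  show "L2_nrm (\<lambda>_. a) = \<bar>a\<bar>"
    using unit.prob_space by (simp add: L2_nrm_def L2_inner_eq flip: power2_eq_square)
qed

lemma fourier_tail_norm_tendsto: "f \<in> L2_unit \<Longrightarrow> (\<lambda>i. (L2_nrm (fourier_tail i f))\<^sup>2) \<longlonglongrightarrow> 0"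
proof -
  assume f: "f \<in> L2_unit"
  have "(L2_nrm (fourier_tail i f))\<^sup>2 = residual i f" for i
  proof -
    have "{j. real_of_int \<bar>j\<bar> > real i} = UNIV - {- int i..int i}" by auto
    then have "(L2_nrm (fourier_tail i f))\<^sup>2 =
        (\<Sum>\<^sub>\<infinity>j. (L2_inner f (cas j))\<^sup>2) - (\<Sum>\<^sub>\<infinity>j\<in>{- int i..int i}. (L2_inner f (cas j))\<^sup>2)"
      unfolding fourier_tail_norm[OF f] by (simp only:) (intro infsum_Diff cas_coeff_summable[OF f], simp)
    then show ?thesis
      by (simp add: residual_def L2_nrm_squared_infsum[OF f, symmetric] L2_nrm_squared)
  qed
  then show ?thesis
    using parseval_holds_L2_unit[OF f] by (simp add: parseval_holds_def)
qed

text \<open>Outside the Besov space \<open>x^(2s)\<close> times the tail energy is unbounded over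
  all real \<open>x > 0\<close>. What has to be added is that large values occur at large integers
  \<open>i\<close>, where the tail norm is already at most 1.\<close>

lemma besov_escape:
  fixes n :: nat
  assumes f: "f \<in> L2_per" and not: "f \<notin> besov_space s" and s: "s > 0"
  shows "\<exists>i\<ge>n. i \<ge> 1 \<and> 0 < (L2_nrm (fourier_tail i f))\<^sup>2 \<and> (L2_nrm (fourier_tail i f))\<^sup>2 \<le> 1 \<and>
    real n \<le> real i powr (2 * s) * (L2_nrm (fourier_tail i f))\<^sup>2"
proof -
  have fL: "f \<in> L2_unit" using f by (rule L2_per_L2_unit)
  let ?t = "\<lambda>x. \<Sum>\<^sub>\<infinity>j\<in>{j. real_of_int \<bar>j\<bar> > x}. (L2_inner f (cas j))\<^sup>2"
  have "\<forall>\<^sub>F i in sequentially. (L2_nrm (fourier_tail i f))\<^sup>2 < 1"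
    using fourier_tail_norm_tendsto[OF fL] by (rule order_tendstoD) simp
  then obtain N1 where N1: "\<And>i. i \<ge> N1 \<Longrightarrow> (L2_nrm (fourier_tail i f))\<^sup>2 < 1"
    by (auto simp: eventually_sequentially)
  define N where "N = max N1 (max n 1)"
  \<comment> \<open>The second summand dominates the product for every \<open>x < N + 1\<close>, so
    exceeding \<open>P\<close> forces \<open>x\<close> to be large; its extra 1 makes
    \<open>P\<close> positive. The first summand pays for rounding \<open>x\<close> down to
    \<open>i\<close>, as \<open>x \<le> 2 * i\<close>.\<close>
  define P where "P = 2 powr (2 * s) * real n + (real N + 1) powr (2 * s) * ((L2_nrm f)\<^sup>2 + 1)"
  have "P > 0" unfolding P_def by (intro add_nonneg_pos mult_pos_pos mult_nonneg_nonneg) (auto intro: add_nonneg_pos)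
  then have "f \<notin> besov_ball s P" using not by (auto simp: besov_space_def)
  then obtain x where x: "x > 0" "\<not> x powr (2 * s) * (\<Sum>\<^sub>\<infinity>j\<in>{j. real_of_int \<bar>j\<bar> > x}. (cmod (fourier_coeff f j))\<^sup>2) \<le> P"
    using f unfolding besov_ball_def by blast
  then have x: "x > 0" "P < x powr (2 * s) * ?t x"
    unfolding infsum_fourier_coeff[OF fL] by linarith+
  have t0: "?t x \<ge> 0" by (intro infsum_nonneg) simp
  have tle: "?t x \<le> (L2_nrm f)\<^sup>2"
    unfolding L2_nrm_squared_infsum[OF fL]
    by (intro infsum_mono_neutral cas_coeff_summable[OF fL]) auto
  have xN: "x \<ge> real N + 1"
  proof (rule ccontr)
    assume "\<not> x \<ge> real N + 1"
    then have "x powr (2 * s) \<le> (real N + 1) powr (2 * s)"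
      using x s by (intro powr_mono2) auto
    then have "x powr (2 * s) * ?t x \<le> (real N + 1) powr (2 * s) * ((L2_nrm f)\<^sup>2 + 1)"
      using tle t0 by (intro mult_mono) auto
    also have "\<dots> \<le> P" by (simp add: P_def)
    finally show False using x by simp
  qed
  define i where "i = nat \<lfloor>x\<rfloor>"
  have ix: "real i \<le> x" "x < real i + 1" using x by (auto simp: i_def)
  have iN: "i \<ge> N" using xN ix by linarith
  then have i1: "i \<ge> 1" by (simp add: N_def)
  have "(real_of_int \<bar>j\<bar> > x) = (real_of_int \<bar>j\<bar> > real i)" for j
  proof -
    have "real_of_int \<bar>j\<bar> > real i \<longleftrightarrow> \<bar>j\<bar> \<ge> int i + 1" by linarith
    moreover have "\<bar>j\<bar> \<ge> int i + 1 \<longleftrightarrow> real_of_int \<bar>j\<bar> \<ge> real i + 1" by linarith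
    ultimately show ?thesis using ix by linarith
  qed
  then have T: "(L2_nrm (fourier_tail i f))\<^sup>2 = ?t x"
    by (simp add: fourier_tail_norm[OF fL])
  have "x powr (2 * s) \<le> (2 * real i) powr (2 * s)"
    using x s ix i1 by (intro powr_mono2) auto
  also have "\<dots> = 2 powr (2 * s) * real i powr (2 * s)" by (simp add: powr_mult)
  finally have up: "x powr (2 * s) * ?t x \<le> 2 powr (2 * s) * real i powr (2 * s) * ?t x"
    using t0 by (rule mult_right_mono)
  have "2 powr (2 * s) * real n < x powr (2 * s) * ?t x"
    using x(2) by (simp add: P_def) (smt (verit) mult_nonneg_nonneg powr_ge_zero zero_le_power2)
  from less_le_trans[OF this up]
  have "2 powr (2 * s) * real n < 2 powr (2 * s) * (real i powr (2 * s) * ?t x)"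
    by (simp only: mult.assoc)
  then have "real n < real i powr (2 * s) * ?t x" by simp
  moreover have "?t x > 0" using t0 x \<open>P > 0\<close> by (cases "?t x = 0") auto
  moreover have "(L2_nrm (fourier_tail i f))\<^sup>2 \<le> 1" using N1[of i] iN by (simp add: N_def less_imp_le)
  moreover have "i \<ge> n" using iN by (simp add: N_def)
  ultimately show ?thesis using i1 T by auto
qed

section \<open>Size of the drift on the ball and on Fourier tails\<close>

context kernel_test
begin

text \<open>The cutoff is \<open>x = b / h n\<close>. Since
  \<open>(4 * r - 2) * (2 * s) = - 2 * r\<close>, the hypothesis \<open>small\<close> is exactly
  what makes the Besov bound \<open>P * x^(-2s)\<close> at most half of \<open>c^2 n^(-2r)\<close>.
  Below the cutoff \<open>(\<mu> j)\<^sup>2 \<ge> 1 / 4\<close>, whence the factor 1/8 in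
  \<open>\<rho>\<close>; the square root in \<open>\<rho>\<close> comes from \<open>scale_ge\<close>
  with \<open>h n \<le> 1 / a\<close> and \<open>h n \<ge> n^(4r-2) / A\<close>.\<close>

lemma drift_lower:
  fixes r s P c a A :: real
  defines "b \<equiv> 1 / (8 * pi * B)"
  defines "\<rho> \<equiv> c\<^sup>2 / (8 * \<sigma>\<^sup>2) / sqrt (A * (16 * (2 / a + 5) * B ^ 4))"
  assumes n: "n \<ge> 1" and r: "0 < r" "r < 1 / 2" and s: "s = r / (2 - 4 * r)" and P: "P > 0" and c: "c > 0"
    and a: "a > 0" "a * h n \<le> real n powr (4 * r - 2)" and A: "A > 0" "real n powr (4 * r - 2) \<le> A * h n"
    and small: "h n < b * (c\<^sup>2 / (2 * P)) powr (1 / (2 * s)) * real n powr (4 * r - 2)"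
    and g: "g \<in> besov_ball s P" "L2_nrm g \<ge> c * real n powr (- r)"
  shows "drift n g \<ge> \<rho>"
proof -
  interpret unit_kernel K B "h n" by (rule unit_kernel[OF h_pos[OF n]])
  have gL: "g \<in> L2_unit" using g by (auto simp: besov_ball_def intro: L2_per_L2_unit)
  have hn: "h n > 0" by (rule h_pos)
  have npos: "real n > 0" using n by simp
  have spos: "s > 0" using r s by simp
  have bpos: "b > 0" using B_pos by (simp add: b_def)
  define x where "x = b / h n"
  have x: "x > 0" using bpos hn by (simp add: x_def)
  have "(4 * r - 2) * (2 * s) = - 2 * r" using r by (simp add: s field_simps)
  then have rs: "(real n powr (4 * r - 2)) powr (2 * s) = real n powr (- 2 * r)" by (simp only: powr_powr)
  have "h n / b \<le> (c\<^sup>2 / (2 * P)) powr (1 / (2 * s)) * real n powr (4 * r - 2)"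
    using small bpos by (simp add: field_simps)
  then have "(h n / b) powr (2 * s) \<le> ((c\<^sup>2 / (2 * P)) powr (1 / (2 * s)) * real n powr (4 * r - 2)) powr (2 * s)"
    using hn bpos spos by (intro powr_mono2) auto
  also have "\<dots> = c\<^sup>2 / (2 * P) * real n powr (- 2 * r)"
    using spos c P by (simp add: powr_mult powr_powr[of "c\<^sup>2 / (2 * P)"] rs)
  finally have hb: "(h n / b) powr (2 * s) \<le> c\<^sup>2 / (2 * P) * real n powr (- 2 * r)" .
  have "x powr (- 2 * s) = (h n / b) powr (2 * s)"
    using hn bpos by (simp add: x_def powr_minus powr_divide)
  with hb have "P * x powr (- 2 * s) \<le> P * (c\<^sup>2 / (2 * P) * real n powr (- 2 * r))"
    using P by (intro mult_left_mono) auto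
  then have high: "(\<Sum>\<^sub>\<infinity>j\<in>{j. real_of_int \<bar>j\<bar> > x}. (L2_inner g (cas j))\<^sup>2) \<le> c\<^sup>2 / 2 * real n powr (- 2 * r)"
    using besov_ball_tail[OF g(1) x] P by simp
  have "(c * real n powr (- r))\<^sup>2 \<le> (L2_nrm g)\<^sup>2"
    using g(2) c by (intro power_mono) auto
  moreover have "(real n powr (- r))\<^sup>2 = real n powr (- 2 * r)"
    by (simp add: power2_eq_square flip: powr_add)
  ultimately have total: "c\<^sup>2 * real n powr (- 2 * r) \<le> (L2_nrm g)\<^sup>2"
    by (simp add: power_mult_distrib)
  let ?L = "UNIV - {j. real_of_int \<bar>j\<bar> > x}"
  have "(\<Sum>\<^sub>\<infinity>j\<in>?L. (L2_inner g (cas j))\<^sup>2) = (L2_nrm g)\<^sup>2 - (\<Sum>\<^sub>\<infinity>j\<in>{j. real_of_int \<bar>j\<bar> > x}. (L2_inner g (cas j))\<^sup>2)"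
    unfolding L2_nrm_squared_infsum[OF gL] by (intro infsum_Diff cas_coeff_summable gL) simp
  then have low: "(\<Sum>\<^sub>\<infinity>j\<in>?L. (L2_inner g (cas j))\<^sup>2) \<ge> c\<^sup>2 / 2 * real n powr (- 2 * r)"
    using high total by simp
  have "1 / 4 * (\<Sum>\<^sub>\<infinity>j\<in>?L. (L2_inner g (cas j))\<^sup>2) = (\<Sum>\<^sub>\<infinity>j\<in>?L. 1 / 4 * (L2_inner g (cas j))\<^sup>2)"
    by (rule infsum_cmult_right'[symmetric])
  also have "\<dots> \<le> (\<Sum>\<^sub>\<infinity>j. (\<mu> j * L2_inner g (cas j))\<^sup>2)"
  proof (rule infsum_mono_neutral)
    fix j assume "j \<in> ?L \<inter> UNIV"
    then have "\<bar>of_int j\<bar> * h n \<le> b" using hn by (simp add: x_def field_simps not_less)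
    then have "\<bar>of_int j * h n\<bar> \<le> 1 / (8 * pi * B)" using hn by (simp add: abs_mult b_def)
    then have "\<mu> j \<ge> 1 / 2" by (rule \<mu>_ge_half)
    then have "(1 / 2)\<^sup>2 \<le> (\<mu> j)\<^sup>2" by (intro power_mono) auto
    then have "(1 / 2)\<^sup>2 * (L2_inner g (cas j))\<^sup>2 \<le> (\<mu> j)\<^sup>2 * (L2_inner g (cas j))\<^sup>2" by (rule mult_right_mono) simp
    then show "1 / 4 * (L2_inner g (cas j))\<^sup>2 \<le> (\<mu> j * L2_inner g (cas j))\<^sup>2"
      by (simp add: power_mult_distrib power_divide)
  next
    show "(\<lambda>j. 1 / 4 * (L2_inner g (cas j))\<^sup>2) summable_on ?L"
      by (intro summable_on_cmult_right cas_coeff_summable gL)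
    show "(\<lambda>j. (\<mu> j * L2_inner g (cas j))\<^sup>2) summable_on UNIV"
      by (rule weighted_summable[OF gL])
  qed auto
  finally have sig: "c\<^sup>2 / 8 * real n powr (- 2 * r) \<le> (\<Sum>\<^sub>\<infinity>j. (\<mu> j * L2_inner g (cas j))\<^sup>2)"
    using low by simp
  have le1: "real n powr (4 * r - 2) \<le> 1"
    using n r powr_mono[of "4 * r - 2" 0 "real n"] by simp
  have "h n \<le> 1 / a" using a le1 by (simp add: field_simps)
  have sc: "real n powr (2 * r - 1) / sqrt (A * (16 * (2 / a + 5) * B ^ 4)) \<le> scale n"
  proof -
    have "real n powr (4 * r - 2) / (A * (16 * (2 / a + 5) * B ^ 4)) \<le> A * h n / (A * (16 * (2 / a + 5) * B ^ 4))"
      using A a B_pos by (intro divide_right_mono) auto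
    also have "\<dots> = h n / (16 * (2 / a + 5) * B ^ 4)" using A by simp
    also have "\<dots> \<le> h n / (16 * (2 * h n + 5) * B ^ 4)"
      using \<open>h n \<le> 1 / a\<close> hn B_pos a by (intro divide_left_mono mult_right_mono mult_left_mono) auto
    finally have "sqrt (real n powr (4 * r - 2) / (A * (16 * (2 / a + 5) * B ^ 4))) \<le> scale n"
      using scale_ge[OF n] real_sqrt_le_mono order.trans by blast
    moreover have "sqrt (real n powr (4 * r - 2)) = real n powr (2 * r - 1)"
      using sqrt_powr[of "real n" "2 * r - 1"] by (simp add: right_diff_distrib)
    ultimately show ?thesis by (simp add: real_sqrt_divide)
  qed
  have "\<rho> = (real n powr (2 * r - 1) * real n * real n powr (- 2 * r)) * \<rho>"
    using real_powr_product[of "real n" "2 * r - 1" "- 2 * r"] npos by simp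
  also have "\<dots> = real n powr (2 * r - 1) / sqrt (A * (16 * (2 / a + 5) * B ^ 4)) / (\<sigma> / sqrt (real n))\<^sup>2 * (c\<^sup>2 / 8 * real n powr (- 2 * r))"
    by (simp add: \<rho>_def power_divide mult_ac)
  also have "\<dots> \<le> scale n / (\<sigma> / sqrt (real n))\<^sup>2 * (\<Sum>\<^sub>\<infinity>j. (\<mu> j * L2_inner g (cas j))\<^sup>2)"
    using sc sig scale_pos[OF n] by (intro mult_mono divide_right_mono) auto
  finally show ?thesis by (simp add: drift_def)
qed

text \<open>Every frequency of the tail exceeds \<open>i\<close> in modulus, hence lies where the
  transform is at most \<open>\<epsilon>\<close>. The powers of \<open>n\<close> cancel, so that
  only \<open>\<epsilon>\<^sup>2\<close> can make the drift small.\<close>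

lemma drift_tail_upper:
  fixes r a \<epsilon> X C :: real
  assumes n: "n \<ge> 1" and a: "a > 0" "a * h n \<le> real n powr (4 * r - 2)"
    and f: "f \<in> L2_unit" and decay: "\<And>x. \<bar>x\<bar> > X \<Longrightarrow> \<bar>kernel_ft K x\<bar> \<le> \<epsilon>" and i: "real i * h n \<ge> X"
    and norm: "L2_nrm (fourier_tail i f) \<le> C * real n powr (- r)"
  shows "drift n (fourier_tail i f) \<le> sqrt (64 * pi * B / a) * C\<^sup>2 / \<sigma>\<^sup>2 * \<epsilon>\<^sup>2"
proof -
  let ?g = "fourier_tail i f"
  interpret unit_kernel K B "h n" by (rule unit_kernel[OF h_pos[OF n]])
  have hn: "h n > 0" by (rule h_pos)
  have npos: "real n > 0" using n by simp
  have gL: "?g \<in> L2_unit" by (rule fourier_tail_L2[OF f])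
  have "(\<Sum>\<^sub>\<infinity>j. (\<mu> j * L2_inner ?g (cas j))\<^sup>2) \<le> (\<Sum>\<^sub>\<infinity>j. \<epsilon>\<^sup>2 * (L2_inner ?g (cas j))\<^sup>2)"
  proof (rule infsum_mono)
    fix j :: int
    show "(\<mu> j * L2_inner ?g (cas j))\<^sup>2 \<le> \<epsilon>\<^sup>2 * (L2_inner ?g (cas j))\<^sup>2"
    proof (cases "\<bar>j\<bar> > int i")
      case True
      then have "real i < \<bar>of_int j\<bar>" by linarith
      then have "real i * h n < \<bar>of_int j * h n\<bar>" using hn by (simp add: abs_mult)
      then have "\<bar>\<mu> j\<bar> \<le> \<epsilon>" using i by (intro decay) simp
      then have "(\<mu> j)\<^sup>2 \<le> \<epsilon>\<^sup>2" using power_mono[of "\<bar>\<mu> j\<bar>" \<epsilon> 2] by simp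
      then show ?thesis by (simp add: power_mult_distrib mult_right_mono)
    qed (simp add: cas_coeff_tail[OF f])
  qed (intro weighted_summable gL summable_on_cmult_right cas_coeff_summable)+
  also have "\<dots> = \<epsilon>\<^sup>2 * (L2_nrm ?g)\<^sup>2"
    unfolding L2_nrm_squared_infsum[OF gL] by (rule infsum_cmult_right')
  also have "\<dots> \<le> \<epsilon>\<^sup>2 * (C\<^sup>2 * real n powr (- 2 * r))"
  proof -
    have "(L2_nrm ?g)\<^sup>2 \<le> (C * real n powr (- r))\<^sup>2" using norm by (intro power_mono) auto
    also have "\<dots> = C\<^sup>2 * real n powr (- 2 * r)"
      using npos by (simp add: power_mult_distrib power2_eq_square flip: powr_add)
    finally show ?thesis by (intro mult_left_mono) auto
  qed
  finally have sig: "(\<Sum>\<^sub>\<infinity>j. (\<mu> j * L2_inner ?g (cas j))\<^sup>2) \<le> \<epsilon>\<^sup>2 * (C\<^sup>2 * real n powr (- 2 * r))" .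
  have sc: "scale n \<le> sqrt (64 * pi * B / a) * real n powr (2 * r - 1)"
  proof -
    have "h n \<le> real n powr (4 * r - 2) / a" using a by (simp add: field_simps)
    then have "64 * pi * B * h n \<le> 64 * pi * B * (real n powr (4 * r - 2) / a)"
      using B_pos by (intro mult_left_mono) auto
    then have "scale n \<le> sqrt (64 * pi * B * (real n powr (4 * r - 2) / a))"
      using scale_le[OF n] real_sqrt_le_mono order.trans by blast
    also have "\<dots> = sqrt (64 * pi * B / a) * sqrt (real n powr (4 * r - 2))"
      by (simp flip: real_sqrt_mult)
    also have "sqrt (real n powr (4 * r - 2)) = real n powr (2 * r - 1)"
      using sqrt_powr[of "real n" "2 * r - 1"] by (simp add: right_diff_distrib)
    finally show ?thesis .
  qed
  have "drift n ?g \<le> sqrt (64 * pi * B / a) * real n powr (2 * r - 1) / (\<sigma> / sqrt (real n))\<^sup>2 * (\<epsilon>\<^sup>2 * (C\<^sup>2 * real n powr (- 2 * r)))"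
    unfolding drift_def using sc sig scale_pos[OF n] a B_pos
    by (intro mult_mono divide_right_mono infsum_nonneg) auto
  also have "\<dots> = (real n powr (2 * r - 1) * real n * real n powr (- 2 * r)) * (sqrt (64 * pi * B / a) * C\<^sup>2 / \<sigma>\<^sup>2 * \<epsilon>\<^sup>2)"
    by (simp add: power_divide)
  also have "\<dots> = sqrt (64 * pi * B / a) * C\<^sup>2 / \<sigma>\<^sup>2 * \<epsilon>\<^sup>2"
    using real_powr_product[of "real n" "2 * r - 1" "- 2 * r"] npos by simp
  finally show ?thesis .
qed

lemma drift_nonneg: "n \<ge> 1 \<Longrightarrow> drift n f \<ge> 0"
  unfolding drift_def using scale_pos[of n] by (intro mult_nonneg_nonneg divide_nonneg_nonneg infsum_nonneg) auto

text \<open>Here the locale parameter is the spacing \<open>e\<close> of an auxiliary lattice,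
  chosen from \<open>\<epsilon>\<close> and unrelated to the bandwidth.\<close>

lemma kernel_ft_decay:
  assumes "\<epsilon> > 0"
  obtains X where "\<And>x. \<bar>x\<bar> > X \<Longrightarrow> \<bar>kernel_ft K x\<bar> \<le> \<epsilon>"
proof -
  define e where "e = \<epsilon> / (8 * pi * B)"
  have e: "e > 0" "8 * pi * B * e = \<epsilon>" using assms B_pos by (auto simp: e_def)
  interpret unit_kernel K B e by (rule unit_kernel[OF e(1)])
  show ?thesis using riemann_lebesgue_lattice that e(2) by metis
qed

end

section \<open>Error probabilities of the tests: detection and its failure\<close>

context kernel_test
begin

lemma reject_prob_eq:
  assumes "n \<ge> 1" "f \<in> L2_per" and R: "\<And>y. R y \<longleftrightarrow> test_stat n y > x"
  shows "reject_prob M (F n f) R = 1 - df n f x"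
    and "accept_prob M (F n f) R = df n f x"
proof -
  have [measurable]: "S n f \<in> borel_measurable M" by (rule S_measurable[OF assms(1,2)])
  have "reject_prob M (F n f) R = prob (space M - {\<omega> \<in> space M. S n f \<omega> \<le> x})"
    unfolding reject_prob_def by (rule arg_cong[of _ _ prob]) (auto simp: R S_def not_le)
  also have "\<dots> = 1 - df n f x" by (rule prob_compl) measurable
  finally show "reject_prob M (F n f) R = 1 - df n f x" .
  show "accept_prob M (F n f) R = df n f x"
    unfolding accept_prob_def by (rule arg_cong[of _ _ prob]) (auto simp: R S_def not_less)
qed

text \<open>One normal quantile \<open>z\<close> serves as threshold for all \<open>n\<close>. A
  drift of at least \<open>\<rho>\<close> lowers the limiting acceptance probability to at most
  \<open>Phi (z - \<rho> / 2)\<close>, strictly below \<open>Phi z = 1 - \<alpha>\<close>.\<close>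

lemma uniform_detection:
  fixes V :: "nat \<Rightarrow> (real \<Rightarrow> real) set"
  assumes \<alpha>: "0 < \<alpha>" "\<alpha> < 1" and \<rho>: "\<rho> > 0"
    and V: "\<And>n g. n \<ge> 1 \<Longrightarrow> g \<in> V n \<Longrightarrow> g \<in> L2_per \<and> drift n g \<ge> \<rho>" and ne: "\<And>n. n \<ge> 1 \<Longrightarrow> V n \<noteq> {}"
  shows "\<exists>R. (\<forall>n\<ge>1. generated_by (kernel_stat \<sigma> K n (h n)) (R n)) \<and>
    (\<lambda>n. reject_prob M (F n (\<lambda>_. 0)) (R n)) \<sim>[sequentially] (\<lambda>_. \<alpha>) \<and>
    limsup (\<lambda>n. ereal (reject_prob M (F n (\<lambda>_. 0)) (R n) + (SUP g\<in>V n. accept_prob M (F n g) (R n)))) < 1"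
proof -
  obtain z where z: "Phi z = 1 - \<alpha>" using Phi_surj[of "1 - \<alpha>"] \<alpha> by auto
  define R where "R n y \<longleftrightarrow> test_stat n y > z" for n y
  let ?N = "\<lambda>n x. df n (\<lambda>_. 0) x"
  have rej: "reject_prob M (F n (\<lambda>_. 0)) (R n) = 1 - ?N n z" if "n \<ge> 1" for n
    using that by (intro reject_prob_eq zero_L2_per) (simp_all add: R_def)
  have "(\<lambda>n. 1 - ?N n z) \<longlonglongrightarrow> 1 - Phi z" by (intro tendsto_intros null_clt)
  moreover have "\<forall>\<^sub>F n in sequentially. 1 - ?N n z = reject_prob M (F n (\<lambda>_. 0)) (R n)"
    using eventually_ge_at_top[of 1] by eventually_elim (simp add: rej)
  ultimately have "(\<lambda>n. reject_prob M (F n (\<lambda>_. 0)) (R n)) \<longlonglongrightarrow> \<alpha>"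
    using z by (auto intro: Lim_transform_eventually)
  then have level: "(\<lambda>n. reject_prob M (F n (\<lambda>_. 0)) (R n)) \<sim>[sequentially] (\<lambda>_. \<alpha>)"
    using \<alpha> by (intro tendsto_imp_asymp_equiv_const) auto
  define u where "u n = 1 - ?N n z + (?N n (z - \<rho> / 2) + 64 * B\<^sup>2 * scale n / \<rho>)" for n
  have "u \<longlonglongrightarrow> 1 - Phi z + (Phi (z - \<rho> / 2) + 64 * B\<^sup>2 * 0 / \<rho>)"
    unfolding u_def using \<rho> by (intro tendsto_intros null_clt scale_lim) auto
  then have "(\<lambda>n. ereal (u n)) \<longlonglongrightarrow> ereal (\<alpha> + Phi (z - \<rho> / 2))"
    using z by (auto intro!: tendsto_intros)
  then have lim: "limsup (\<lambda>n. ereal (u n)) = ereal (\<alpha> + Phi (z - \<rho> / 2))"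
    by (intro lim_imp_Limsup trivial_limit_sequentially)
  have "limsup (\<lambda>n. ereal (reject_prob M (F n (\<lambda>_. 0)) (R n) + (SUP g\<in>V n. accept_prob M (F n g) (R n))))
      \<le> limsup (\<lambda>n. ereal (u n))"
  proof (rule Limsup_mono)
    show "\<forall>\<^sub>F n in sequentially. ereal (reject_prob M (F n (\<lambda>_. 0)) (R n) + (SUP g\<in>V n. accept_prob M (F n g) (R n))) \<le> ereal (u n)"
      using eventually_ge_at_top[of 1]
    proof eventually_elim
      case (elim n)
      have "(SUP g\<in>V n. accept_prob M (F n g) (R n)) \<le> ?N n (z - \<rho> / 2) + 64 * B\<^sup>2 * scale n / \<rho>"
      proof (rule cSUP_least[OF ne[OF elim]])
        fix g assume "g \<in> V n"
        then have g: "g \<in> L2_per" "drift n g \<ge> \<rho>" using V[OF elim] by auto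
        have "accept_prob M (F n g) (R n) = df n g z"
          by (rule reject_prob_eq[OF elim g(1)]) (simp add: R_def)
        also have "\<dots> \<le> ?N n (z - \<rho> / 2) + 64 * B\<^sup>2 * scale n / \<rho>"
          by (rule accept_upper[OF elim g(1) \<rho> g(2)])
        finally show "accept_prob M (F n g) (R n) \<le> ?N n (z - \<rho> / 2) + 64 * B\<^sup>2 * scale n / \<rho>" .
      qed
      then show ?case using rej[OF elim] by (simp add: u_def)
    qed
  qed
  also have "\<dots> < 1"
    using Phi_strict_mono[of "z - \<rho> / 2" z] \<rho> z by (simp add: lim one_ereal_def)
  finally have "limsup (\<lambda>n. ereal (reject_prob M (F n (\<lambda>_. 0)) (R n) + (SUP g\<in>V n. accept_prob M (F n g) (R n)))) < 1" .
  moreover have "generated_by (kernel_stat \<sigma> K n (h n)) (R n)" if "n \<ge> 1" for n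
    unfolding generated_by_standardized[OF that] unfolding generated_by_def R_def by blast
  ultimately show ?thesis using level by blast
qed

text \<open>The level condition fixes the limit \<open>1 - \<alpha>\<close> of the null acceptance
  probabilities without making the thresholds converge; a vanishing drift lets the acceptance
  probabilities under \<open>f n\<close> fall only negligibly below it.\<close>

lemma no_detection:
  assumes m: "filterlim m at_top sequentially" "\<And>n. m n \<ge> 1"
    and f: "\<And>n. f n \<in> L2_per" and D: "(\<lambda>n. drift (m n) (f n)) \<longlonglongrightarrow> 0"
    and \<alpha>: "0 < \<alpha>" "\<alpha> < 1"
    and R: "\<And>n. generated_by (kernel_stat \<sigma> K (m n) (h (m n))) (R n)"
    and level: "(\<lambda>n. reject_prob M (F (m n) (\<lambda>_. 0)) (R n)) \<sim>[sequentially] (\<lambda>_. \<alpha>)"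
  shows "liminf (\<lambda>n. ereal (reject_prob M (F (m n) (\<lambda>_. 0)) (R n) + accept_prob M (F (m n) (f n)) (R n))) \<ge> 1"
proof -
  have "\<exists>x. \<forall>y. R n y \<longleftrightarrow> test_stat (m n) y > x" for n
    using R[of n] unfolding generated_by_standardized[OF m(2)] unfolding generated_by_def .
  then obtain x where x: "\<And>n y. R n y \<longleftrightarrow> test_stat (m n) y > x n" by metis
  have rej: "reject_prob M (F (m n) (\<lambda>_. 0)) (R n) = 1 - df (m n) (\<lambda>_. 0) (x n)" for n
    by (rule reject_prob_eq[OF m(2) zero_L2_per x])
  have acc: "accept_prob M (F (m n) (f n)) (R n) = df (m n) (f n) (x n)" for n
    by (rule reject_prob_eq[OF m(2) f x])
  have lev: "(\<lambda>n. reject_prob M (F (m n) (\<lambda>_. 0)) (R n)) \<longlonglongrightarrow> \<alpha>"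
    using level by (rule asymp_equivD_const)
  then have "(\<lambda>n. 1 - reject_prob M (F (m n) (\<lambda>_. 0)) (R n)) \<longlonglongrightarrow> 1 - \<alpha>"
    by (intro tendsto_intros)
  then have null: "(\<lambda>n. df (m n) (\<lambda>_. 0) (x n)) \<longlonglongrightarrow> 1 - \<alpha>"
    by (simp add: rej)
  show ?thesis
    unfolding le_Liminf_iff
  proof (intro allI impI)
    fix y :: ereal assume "y < 1"
    then obtain v where v: "y < ereal v" "v < 1"
      using ereal_dense2[of y 1] by (auto simp: one_ereal_def)
    \<comment> \<open>The deficit \<open>1 - v\<close> is shared equally between the two error
      probabilities.\<close>
    define e where "e = (1 - v) / 2"
    have e: "e > 0" using v by (simp add: e_def)
    have 1: "\<forall>\<^sub>F n in sequentially. df (m n) (f n) (x n) > 1 - \<alpha> - e"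
      by (rule accept_lower[OF m f D null]) (use \<alpha> e in auto)
    have 2: "\<forall>\<^sub>F n in sequentially. reject_prob M (F (m n) (\<lambda>_. 0)) (R n) > \<alpha> - e"
      using lev by (rule order_tendstoD) (use e in auto)
    from 1 2 show "\<forall>\<^sub>F n in sequentially. y < ereal (reject_prob M (F (m n) (\<lambda>_. 0)) (R n) + accept_prob M (F (m n) (f n)) (R n))"
    proof eventually_elim
      case (elim n)
      then have "v < reject_prob M (F (m n) (\<lambda>_. 0)) (R n) + accept_prob M (F (m n) (f n)) (R n)"
        by (simp add: acc e_def field_simps)
      then show ?case using v(1) by (metis less_ereal.simps(1) order.strict_trans)
    qed
  qed
qed

text \<open>Outside the Besov space, the tails are placed at frequencies \<open>i n\<close> that are large compared
  with \<open>1 / h (m n)\<close>, where the Fourier transform of the kernel is small.\<close>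

lemma undetectable_tails:
  assumes f: "f \<in> L2_per" and not: "f \<notin> besov_space s"
    and r: "0 < r" "r < 1 / 2" and s: "s = r / (2 - 4 * r)"
    and a: "a > 0" "\<And>n. n \<ge> 1 \<Longrightarrow> a * h n \<le> real n powr (4 * r - 2)"
    and A: "A > 0" "\<And>n. n \<ge> 1 \<Longrightarrow> real n powr (4 * r - 2) \<le> A * h n"
  obtains i m :: "nat \<Rightarrow> nat" where "\<And>n. i n > 0" "\<And>n. m n > 0"
    "filterlim i at_top sequentially" "filterlim m at_top sequentially"
    "\<And>n. 1 / 2 * real (m n) powr (- r) < L2_nrm (fourier_tail (i n) f)"
    "\<And>n. L2_nrm (fourier_tail (i n) f) < 3 * real (m n) powr (- r)"
    "(\<lambda>n. drift (m n) (fourier_tail (i n) f)) \<longlonglongrightarrow> 0"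
proof -
  have fL: "f \<in> L2_unit" using f by (rule L2_per_L2_unit)
  have spos: "s > 0" using r s by simp
  let ?T = "\<lambda>i. (L2_nrm (fourier_tail i f))\<^sup>2"
  obtain i where i: "\<And>n. i n \<ge> n" "\<And>n. i n \<ge> 1" "\<And>n. 0 < ?T (i n)" "\<And>n. ?T (i n) \<le> 1"
      "\<And>n. real n \<le> real (i n) powr (2 * s) * ?T (i n)"
    using besov_escape[OF f not spos] by metis
  \<comment> \<open>The real solution of \<open>y powr (- r)\<close> = norm of the tail;
    \<open>m n\<close> rounds it up. Tail energy at most 1 gives \<open>y n \<ge> 1\<close>, so
    rounding costs at most a factor 2.\<close>
  define y where "y n = ?T (i n) powr (- 1 / (2 * r))" for n
  define m where "m n = nat \<lceil>y n\<rceil>" for n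
  have y1: "y n \<ge> 1" for n
  proof -
    have "1 powr (- 1 / (2 * r)) \<le> ?T (i n) powr (- 1 / (2 * r))"
      using i(3,4)[of n] r by (intro powr_mono2') auto
    then show ?thesis by (simp add: y_def)
  qed
  have my: "y n \<le> real (m n)" "real (m n) \<le> 2 * y n" for n
    using y1[of n] unfolding m_def by linarith+
  have m1: "m n \<ge> 1" for n using my(1)[of n] y1[of n] by linarith
  have norm: "L2_nrm (fourier_tail (i n) f) = y n powr (- r)" for n
  proof -
    have "y n powr (- r) = ?T (i n) powr (1 / 2)"
      using r by (simp add: y_def powr_powr)
    also have "\<dots> = sqrt (?T (i n))" using i(3)[of n] by (intro powr_half_sqrt) simp
    finally show ?thesis by simp
  qed
  have nrm_pos: "L2_nrm (fourier_tail (i n) f) > 0" for n using y1[of n] by (simp add: norm)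
  have lower: "real (m n) powr (- r) \<le> L2_nrm (fourier_tail (i n) f)" for n
    unfolding norm using my[of n] y1[of n] r by (intro powr_mono2') auto
  have upper: "L2_nrm (fourier_tail (i n) f) \<le> 2 * real (m n) powr (- r)" for n
  proof -
    have "(2 * y n) powr (- r) \<le> real (m n) powr (- r)"
      using my[of n] m1[of n] r by (intro powr_mono2') auto
    then have "y n powr (- r) \<le> 2 powr r * real (m n) powr (- r)"
      using y1[of n] by (simp add: powr_mult powr_minus field_simps)
    also have "\<dots> \<le> 2 powr 1 * real (m n) powr (- r)"
      using r by (intro mult_right_mono powr_mono) auto
    finally show ?thesis by (simp add: norm)
  qed
  have i_lim: "filterlim i at_top sequentially"
    by (rule filterlim_at_top_mono[OF filterlim_ident]) (simp add: i(1))
  have T_lim: "(\<lambda>n. ?T (i n)) \<longlonglongrightarrow> 0"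
    using filterlim_compose[OF fourier_tail_norm_tendsto[OF fL] i_lim] .
  have m_lim: "filterlim m at_top sequentially"
    unfolding filterlim_at_top
  proof
    fix Z :: nat
    have "\<forall>\<^sub>F n in sequentially. ?T (i n) < (real Z + 1) powr (- 2 * r)"
      using T_lim by (rule order_tendstoD) simp
    then show "\<forall>\<^sub>F n in sequentially. Z \<le> m n"
    proof eventually_elim
      case (elim n)
      have "((real Z + 1) powr (- 2 * r)) powr (- 1 / (2 * r)) \<le> y n"
        unfolding y_def using elim i(3)[of n] r by (intro powr_mono2') auto
      then have "real Z + 1 \<le> y n" using r by (simp add: powr_powr)
      then show ?case using my(1)[of n] by linarith
    qed
  qed
  have ih: "real (i n) * h (m n) \<ge> 2 powr (4 * r - 2) / A * real n powr (1 / (2 * s))" for n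
  proof -
    \<comment> \<open>This identity, which comes from the choice of \<open>s\<close>, turns the
      escape from the Besov space into growth of \<open>i n\<close> relative to
      \<open>1 / h (m n)\<close>.\<close>
    have rs: "(- 1 / (2 * r)) * (4 * r - 2) = 1 / (2 * s)" using r by (simp add: s field_simps)
    have "real n powr (1 / (2 * s)) \<le> (real (i n) powr (2 * s) * ?T (i n)) powr (1 / (2 * s))"
      using i(5)[of n] spos by (intro powr_mono2) auto
    also have "\<dots> = real (i n) * ?T (i n) powr (1 / (2 * s))"
      using spos i(2)[of n] by (simp add: powr_mult powr_powr)
    also have "?T (i n) powr (1 / (2 * s)) = y n powr (4 * r - 2)"
      unfolding y_def powr_powr rs ..
    finally have 1: "real n powr (1 / (2 * s)) \<le> real (i n) * y n powr (4 * r - 2)" .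
    have "2 powr (4 * r - 2) * y n powr (4 * r - 2) = (2 * y n) powr (4 * r - 2)"
      using y1[of n] by (simp add: powr_mult)
    also have "\<dots> \<le> real (m n) powr (4 * r - 2)"
      using my[of n] m1[of n] r by (intro powr_mono2') auto
    also have "\<dots> \<le> A * h (m n)" by (rule A(2)[OF m1])
    finally have 2: "2 powr (4 * r - 2) / A * y n powr (4 * r - 2) \<le> h (m n)"
      using A(1) by (simp add: field_simps)
    have "2 powr (4 * r - 2) / A * real n powr (1 / (2 * s)) \<le> 2 powr (4 * r - 2) / A * (real (i n) * y n powr (4 * r - 2))"
      using 1 A(1) by (intro mult_left_mono) auto
    also have "\<dots> = real (i n) * (2 powr (4 * r - 2) / A * y n powr (4 * r - 2))" by simp
    also have "\<dots> \<le> real (i n) * h (m n)" using 2 by (intro mult_left_mono) auto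
    finally show ?thesis .
  qed
  have ih_lim: "filterlim (\<lambda>n. real (i n) * h (m n)) at_top sequentially"
  proof (rule filterlim_at_top_mono)
    show "\<forall>\<^sub>F n in sequentially. 2 powr (4 * r - 2) / A * real n powr (1 / (2 * s)) \<le> real (i n) * h (m n)"
      using ih by simp
    have "filterlim (\<lambda>n. real n powr (1 / (2 * s))) at_top sequentially"
      unfolding filterlim_at_top
    proof
      fix Z :: real
      have "\<forall>\<^sub>F n in sequentially. \<bar>Z\<bar> powr (2 * s) \<le> real n"
        using filterlim_real_sequentially by (auto simp: filterlim_at_top)
      then show "\<forall>\<^sub>F n in sequentially. Z \<le> real n powr (1 / (2 * s))"
      proof eventually_elim
        case (elim n)
        then have "(\<bar>Z\<bar> powr (2 * s)) powr (1 / (2 * s)) \<le> real n powr (1 / (2 * s))"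
          using spos by (intro powr_mono2) auto
        moreover have "(\<bar>Z\<bar> powr (2 * s)) powr (1 / (2 * s)) = \<bar>Z\<bar>"
          using spos by (simp add: powr_powr)
        ultimately show ?case by linarith
      qed
    qed
    then show "filterlim (\<lambda>n. 2 powr (4 * r - 2) / A * real n powr (1 / (2 * s))) at_top sequentially"
      using A(1) by (intro filterlim_tendsto_pos_mult_at_top[OF tendsto_const]) auto
  qed
  define Q where "Q = sqrt (64 * pi * B / a) * 2\<^sup>2 / \<sigma>\<^sup>2"
  have Q: "Q > 0" using B_pos a \<sigma>_pos by (simp add: Q_def)
  have drift: "(\<lambda>n. drift (m n) (fourier_tail (i n) f)) \<longlonglongrightarrow> 0"
  proof (rule LIMSEQ_I)
    fix e :: real assume e: "e > 0"
    \<comment> \<open>Chosen so that \<open>Q * \<epsilon>\<^sup>2 = e / 2\<close>.\<close>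
    define \<epsilon> where "\<epsilon> = sqrt (e / (2 * Q))"
    have \<epsilon>: "\<epsilon> > 0" "\<epsilon>\<^sup>2 = e / (2 * Q)" using e Q by (simp_all add: \<epsilon>_def)
    obtain X where X: "\<And>x. \<bar>x\<bar> > X \<Longrightarrow> \<bar>kernel_ft K x\<bar> \<le> \<epsilon>" using kernel_ft_decay[OF \<epsilon>(1)] by blast
    have "\<forall>\<^sub>F n in sequentially. X \<le> real (i n) * h (m n)"
      using ih_lim by (auto simp: filterlim_at_top)
    then obtain n0 where n0: "\<And>n. n \<ge> n0 \<Longrightarrow> X \<le> real (i n) * h (m n)"
      by (auto simp: eventually_sequentially)
    show "\<exists>n0. \<forall>n\<ge>n0. norm (drift (m n) (fourier_tail (i n) f) - 0) < e"
    proof (intro exI[of _ n0] allI impI)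
      fix n assume "n \<ge> n0"
      have "drift (m n) (fourier_tail (i n) f) \<le> Q * \<epsilon>\<^sup>2"
        unfolding Q_def
        by (rule drift_tail_upper[OF m1 a(1) a(2)[OF m1] fL X n0[OF \<open>n \<ge> n0\<close>] upper])
      also have "\<dots> < e" using \<epsilon> Q e by simp
      finally show "norm (drift (m n) (fourier_tail (i n) f) - 0) < e"
        using drift_nonneg[OF m1] by simp
    qed
  qed
  show ?thesis
  proof (rule that[of i m])
    fix n
    show "i n > 0" "m n > 0" using i(2)[of n] m1[of n] by auto
    \<comment> \<open>The ratio of the tail norm to this power lies between 1 and 2; the constants
      1/2 and 3 leave room for strict inequalities.\<close>
    have "real (m n) powr (- r) > 0" using m1[of n] by simp
    then show "1 / 2 * real (m n) powr (- r) < L2_nrm (fourier_tail (i n) f)"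
      "L2_nrm (fourier_tail (i n) f) < 3 * real (m n) powr (- r)"
      using lower[of n] upper[of n] by linarith+
  qed (rule i_lim m_lim drift)+
qed

end

theorem theorem5p1:
  fixes r s P\<^sub>0 \<sigma> c :: real and K :: "real \<Rightarrow> real"
  assumes "0 < r" and "r < 1/2" and "s = r / (2 - 4 * r)" and "P\<^sub>0 > 0"
    and "\<sigma> > 0" and "smoothing_kernel K" and "c > 0"
  shows "4 * r - 2 = - 2 / (1 + 4 * s) \<and>
    (\<exists>c\<^sub>0>0. \<forall>(M :: 'w measure) W h F.
      white_noise M W \<and>
      (\<forall>n\<ge>1. h n > 0) \<and>
      same_order h (\<lambda>n. real n powr (4 * r - 2)) \<and>
      (\<forall>n\<ge>1. h n < c\<^sub>0 * real n powr (4 * r - 2)) \<and>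
      (\<forall>n\<ge>1. \<forall>f\<in>L2_per. kernel_estimator M (observation W \<sigma> n f) K (h n) (F n f))
      \<longrightarrow>
      (\<comment> \<open>(i)\<close> \<forall>\<alpha>. 0 < \<alpha> \<and> \<alpha> < 1 \<longrightarrow>
        (\<exists>R. (\<forall>n\<ge>1. generated_by (kernel_stat \<sigma> K n (h n)) (R n)) \<and>
             (\<lambda>n. reject_prob M (F n (\<lambda>_. 0)) (R n)) \<sim>[sequentially] (\<lambda>_. \<alpha>) \<and>
             limsup (\<lambda>n. ereal (reject_prob M (F n (\<lambda>_. 0)) (R n) +
               (SUP g\<in>{g \<in> besov_ball s P\<^sub>0. L2_nrm g \<ge> c * real n powr (- r)}.
                  accept_prob M (F n g) (R n)))) < 1)) \<and>
      (\<comment> \<open>(ii)\<close> \<forall>f\<in>L2_per. f \<notin> besov_space s \<longrightarrow>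
        (\<exists>(i :: nat \<Rightarrow> nat) (m :: nat \<Rightarrow> nat) c\<^sub>1 C\<^sub>1.
          (\<forall>n. i n > 0 \<and> m n > 0) \<and> filterlim i at_top sequentially \<and>
          0 < c\<^sub>1 \<and> c\<^sub>1 < C\<^sub>1 \<and>
          (\<forall>n. c\<^sub>1 * real (m n) powr (- r) < L2_nrm (fourier_tail (i n) f) \<and>
               L2_nrm (fourier_tail (i n) f) < C\<^sub>1 * real (m n) powr (- r)) \<and>
          (\<forall>\<alpha> R. 0 < \<alpha> \<and> \<alpha> < 1 \<and>
             (\<forall>n. generated_by (kernel_stat \<sigma> K (m n) (h (m n))) (R n)) \<and>
             (\<lambda>n. reject_prob M (F (m n) (\<lambda>_. 0)) (R n)) \<sim>[sequentially] (\<lambda>_. \<alpha>)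
             \<longrightarrow>
             liminf (\<lambda>n. ereal (reject_prob M (F (m n) (\<lambda>_. 0)) (R n) +
               accept_prob M (F (m n) (fourier_tail (i n) f)) (R n))) \<ge> 1))))"
proof -
  have r: "0 < r" "r < 1 / 2" and s: "s = r / (2 - 4 * r)" by fact+
  have exponents: "4 * r - 2 = - 2 / (1 + 4 * s)"
  proof -
    have "2 - 4 * r > 0" using r by simp
    then have "1 + 4 * s = 2 / (2 - 4 * r)" by (simp add: s field_simps)
    then show ?thesis by simp
  qed
  have "bounded (range K)" using assms(6) by (simp add: smoothing_kernel_def)
  then obtain B where B: "B > 0" "\<And>t. \<bar>K t\<bar> \<le> B" by (auto simp: bounded_pos)
  \<comment> \<open>The first factor is the range of \<open>h * j\<close> on which the transform of
    the kernel is at least 1/2; the second places the cutoff where the ball leaves at most half of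
    the energy \<open>c^2 n^(-2r)\<close> above it, see \<open>drift_lower\<close>.\<close>
  define c\<^sub>0 where "c\<^sub>0 = 1 / (8 * pi * B) * (c\<^sup>2 / (2 * P\<^sub>0)) powr (1 / (2 * s))"
  have "c\<^sub>0 > 0" using B assms by (simp add: c\<^sub>0_def)
  show ?thesis
    (is "_ \<and> (\<exists>c\<^sub>0>0. \<forall>M W h F. ?H c\<^sub>0 M W h F \<longrightarrow> (\<forall>\<alpha>. ?A \<alpha> \<longrightarrow> ?I M W h F \<alpha>) \<and> (\<forall>f\<in>L2_per. ?N f \<longrightarrow> ?II M W h F f))")
  proof (intro conjI exponents exI[of _ c\<^sub>0] \<open>c\<^sub>0 > 0\<close>, intro allI impI)
    fix M :: "'w measure" and W h F
    assume H: "?H c\<^sub>0 M W h F"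
    then obtain a A where aA: "0 < a" "a \<le> A" and rate:
      "\<And>n. n \<ge> 1 \<Longrightarrow> a * h n \<le> real n powr (4 * r - 2)" "\<And>n. n \<ge> 1 \<Longrightarrow> real n powr (4 * r - 2) \<le> A * h n"
      unfolding same_order_def by blast
    have h_lim: "h \<longlonglongrightarrow> 0"
    proof (rule tendsto_sandwich)
      show "\<forall>\<^sub>F n in sequentially. 0 \<le> h n"
        using eventually_ge_at_top[of 1] by eventually_elim (use H in \<open>auto intro: less_imp_le\<close>)
      show "\<forall>\<^sub>F n in sequentially. h n \<le> real n powr (4 * r - 2) / a"
        using eventually_ge_at_top[of 1] by eventually_elim (use rate aA in \<open>simp add: field_simps\<close>)
      have "(\<lambda>n. real n powr (4 * r - 2)) \<longlonglongrightarrow> 0"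
        using r by (intro tendsto_neg_powr filterlim_real_sequentially) simp
      from tendsto_divide[OF this tendsto_const[of a]]
      show "(\<lambda>n. real n powr (4 * r - 2) / a) \<longlonglongrightarrow> 0" using aA by simp
    qed simp
    interpret kernel_test M W K B \<sigma> h F
      using H h_lim B assms by unfold_locales auto
    define \<rho> where "\<rho> = c\<^sup>2 / (8 * \<sigma>\<^sup>2) / sqrt (A * (16 * (2 / a + 5) * B ^ 4))"
    have "\<rho> > 0" unfolding \<rho>_def using aA B assms by (intro divide_pos_pos) (auto intro!: mult_pos_pos add_pos_pos)
    let ?V = "\<lambda>n. {g \<in> besov_ball s P\<^sub>0. L2_nrm g \<ge> c * real n powr (- r)}"
    have V: "g \<in> L2_per \<and> drift n g \<ge> \<rho>" if "n \<ge> 1" "g \<in> ?V n" for n g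
    proof
      show "g \<in> L2_per" using that by (simp add: besov_ball_def)
      have "h n < 1 / (8 * pi * B) * (c\<^sup>2 / (2 * P\<^sub>0)) powr (1 / (2 * s)) * real n powr (4 * r - 2)"
        using H that unfolding c\<^sub>0_def by blast
      then show "drift n g \<ge> \<rho>"
        unfolding \<rho>_def using that aA
        by (intro drift_lower[OF that(1) r s assms(4,7) aA(1) rate(1)[OF that(1)] _ rate(2)[OF that(1)]]) auto
    qed
    have ne: "?V n \<noteq> {}" for n
    proof -
      have "(\<lambda>_. c * real n powr (- r)) \<in> ?V n"
        using constant_in_besov_ball[of P\<^sub>0] assms by simp
      then show ?thesis by blast
    qed
    have part1: "?I M W h F \<alpha>" if "0 < \<alpha> \<and> \<alpha> < 1" for \<alpha>
      using that by (intro uniform_detection[OF _ _ \<open>\<rho> > 0\<close> V ne]) auto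
    have part2: "?II M W h F f" if f: "f \<in> L2_per" and not: "f \<notin> besov_space s" for f
    proof -
      have "A > 0" using aA by simp
      from undetectable_tails[OF f not r s aA(1) rate(1) this rate(2)]
      obtain i m :: "nat \<Rightarrow> nat" where im: "\<And>n. i n > 0" "\<And>n. m n > 0"
        "filterlim i at_top sequentially" "filterlim m at_top sequentially"
        "\<And>n. 1 / 2 * real (m n) powr (- r) < L2_nrm (fourier_tail (i n) f)"
        "\<And>n. L2_nrm (fourier_tail (i n) f) < 3 * real (m n) powr (- r)"
        "(\<lambda>n. drift (m n) (fourier_tail (i n) f)) \<longlonglongrightarrow> 0"
        by blast
      have m1: "m n \<ge> 1" for n using im(2)[of n] by simp
      show ?thesis
        using im no_detection[OF im(4) m1 fourier_tail_L2_per[OF f] im(7)]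
        by (intro exI[of _ i] exI[of _ m] exI[of _ "1 / 2"] exI[of _ 3]) auto
    qed
    show "(\<forall>\<alpha>. ?A \<alpha> \<longrightarrow> ?I M W h F \<alpha>) \<and> (\<forall>f\<in>L2_per. ?N f \<longrightarrow> ?II M W h F f)"
      using part1 part2 by blast
  qed
qed

end
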